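(* Let $g\ge 1$ and $1\le t\le g$, and put $n=2g+t-1$. Let $\kappa^{\star}_g(n)$ be the Harer–Zagier coefficient defined in the context. Then \[ \kappa^{\star}_g(2g+t-1)=\frac{|\mathcal{R}_{g,t,0}|}{2^{2g}}=\frac{(2(2g+t-1))!}{2^{2g}\,(2g+t-1)!}\sum_{\substack{\gamma\vdash g\\ \ell(\gamma)=t}}\frac{1}{\prod_i m_i!\,(2i+1)^{m_i}}, \] where the sum runs over all partitions $\gamma=1^{m_1}2^{m_2}\cdots j^{m_j}$ of $g$ with exactly $t$ parts. In particular, $2^{2g}\kappa^{\star}_g(n)$ is the number of O-trees in $\mathcal{R}_{g,t,0}$.
   Context: A map of genus $g$ is a connected multigraph (loops and multiple edges allowed) embedded in a closed orientable surface of genus $g$ so that the complement is a union of open discs (faces), considered up to orientation-preserving homeomorphism; it is rooted by marking a sector (corner, i.e. pair of consecutive edges around a vertex). A unicellular map has exactly one face. Let $\epsilon_g(n)$ be the number of rooted unicellular maps of genus $g$ with $n$ edges and $C_g(z)=\sum_{n}\epsilon_g(n)z^n$. Harer and Zagier showed there is a polynomial $K^{\star}_g(z)=\sum_{n=2g}^{3g-1}\kappa^{\star}_g(n)z^n$ with $C_g(z)=\frac{1}{\sqrt{1-4z}}K^{\star}_g\big(\frac{z}{1-4z}\big)$; this defines $\kappa^{\star}_g(n)$. A plane tree with $m$ edges is a rooted plane (ordered) tree; its root vertex is thought of as attached to an extra "plant edge" (not counted among the edges). The degree of a vertex of $T$ is its number of incident edges, plus one for the root vertex (the plant edge). Vertices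 of a plane tree with $m$ edges are numbered $1,\dots,m+1$ in left-to-right depth-first (preorder) order, the root being $1$. An O-permutation is a permutation all of whose cycles have odd length; an O-permutation on $N$ elements with $\ell$ cycles has genus $(N-\ell)/2$. An O-tree with $m$ edges is a pair $(T,\sigma)$ where $T$ is a plane tree with $m$ edges and $\sigma$ is an O-permutation of $\{1,\dots,m+1\}$, viewed as a permutation of the vertices of $T$; its genus is that of $\sigma$. Its underlying graph $G(T,\sigma)$ is the multigraph obtained from $T$ by merging, for each cycle of $\sigma$, all vertices of that cycle into one vertex (so the degree of a merged vertex is the sum of the degrees in $T$, including the plant-edge contribution for the root). For integers $g\ge1$, $t\ge1$, $k\ge0$, $\mathcal{R}_{g,t,k}$ denotes the set of O-trees $(T,\sigma)$ where $T$ has $2g+t+k-1$ edges, $\sigma$ has exactly $k$ fixed points and exactly $t$ cycles of length $>1$ (so $\sigma$ has genus $g$), and every vertex of $G(T,\sigma)$ has degree $\ge 3$. *)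

theory Defs
  imports
    Complex_Main
    "HOL-Library.Multiset"
    "HOL-Combinatorics.Combinatorics"
    "HOL-Computational_Algebra.Computational_Algebra"
begin

section \<open>Rooted unicellular maps\<close>

text \<open>
  Maps on closed oriented surfaces, up to orientation-preserving homeomorphism, are encoded in the
  standard way as combinatorial maps up to relabelling. A map with \<open>n \<ge> 1\<close> edges is given by two
  permutations of its \<open>2n\<close> darts (half-edges), labelled by the numbers below \<open>2n\<close>: the
  involution \<open>\<alpha>\<close> without fixed points exchanges the two halves of each edge, and \<open>\<sigma>\<close> sends a dart
  to the next one counterclockwise around its vertex. Vertices, edges and faces are the cycles of
  \<open>\<sigma>\<close>, \<open>\<alpha>\<close> and \<open>\<sigma> \<circ> \<alpha>\<close>. The corner between the consecutive darts \<open>d\<close> and \<open>\<sigma> d\<close> is identified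
  with \<open>d\<close>, so a rooting is the choice of a dart.
\<close>

type_synonym rooted_cmap = "(nat \<Rightarrow> nat) \<times> (nat \<Rightarrow> nat) \<times> nat"

definition cycles_on :: "('a \<Rightarrow> 'a) \<Rightarrow> 'a set \<Rightarrow> 'a set set" where
  "cycles_on f A = orbit f ` A"

definition rooted_maps :: "nat \<Rightarrow> rooted_cmap set" where
  "rooted_maps n = {(\<alpha>, \<sigma>, r).
     \<alpha> permutes {..<2 * n} \<and> (\<forall>d<2 * n. \<alpha> d \<noteq> d \<and> \<alpha> (\<alpha> d) = d) \<and>
     \<sigma> permutes {..<2 * n} \<and>
     (\<forall>d<2 * n. \<forall>e<2 * n. (d, e) \<in> {(x, y). y = \<alpha> x \<or> y = \<sigma> x}\<^sup>*) \<and>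
     r < 2 * n}"

fun map_faces :: "nat \<Rightarrow> rooted_cmap \<Rightarrow> nat set set" where
  "map_faces n (\<alpha>, \<sigma>, r) = cycles_on (\<sigma> \<circ> \<alpha>) {..<2 * n}"

text \<open>Euler's formula \<open>V - E + F = 2 - 2g\<close>.\<close>

fun map_has_genus :: "nat \<Rightarrow> nat \<Rightarrow> rooted_cmap \<Rightarrow> bool" where
  "map_has_genus g n (\<alpha>, \<sigma>, r) \<longleftrightarrow>
     int (card (cycles_on \<sigma> {..<2 * n})) - int (card (cycles_on \<alpha> {..<2 * n}))
       + int (card (map_faces n (\<alpha>, \<sigma>, r))) = 2 - 2 * int g"

definition unicellular_maps :: "nat \<Rightarrow> nat \<Rightarrow> rooted_cmap set" where
  "unicellular_maps g n =
     {M \<in> rooted_maps n. map_has_genus g n M \<and> card (map_faces n M) = 1}"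

definition map_iso :: "nat \<Rightarrow> (rooted_cmap \<times> rooted_cmap) set" where
  "map_iso n = {((\<alpha>, \<sigma>, r), (\<alpha>', \<sigma>', r')).
     \<exists>\<pi>. \<pi> permutes {..<2 * n} \<and> \<pi> \<circ> \<alpha> = \<alpha>' \<circ> \<pi> \<and> \<pi> \<circ> \<sigma> = \<sigma>' \<circ> \<pi> \<and> \<pi> r = r'}"

text \<open>
  The map without edges (one vertex on the sphere, with a single corner) has no darts, hence is
  counted separately.
\<close>

definition eps :: "nat \<Rightarrow> nat \<Rightarrow> nat" where
  "eps g n = (if n = 0 then (if g = 0 then 1 else 0)
     else card (unicellular_maps g n // (map_iso n \<inter> unicellular_maps g n \<times> unicellular_maps g n)))"

definition C_series :: "nat \<Rightarrow> real fps" where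
  "C_series g = Abs_fps (\<lambda>n. real (eps g n))"


section \<open>The Harer--Zagier coefficients\<close>

text \<open>
  Composition with \<open>z / (1 - 4z)\<close>, which has zero constant and nonzero linear coefficient, is
  injective on power series, so at most one polynomial satisfies the predicate below.
\<close>

definition is_K_star :: "nat \<Rightarrow> real poly \<Rightarrow> bool" where
  "is_K_star g K \<longleftrightarrow>
     (\<forall>n. coeff K n \<noteq> 0 \<longrightarrow> 2 * g \<le> n \<and> n \<le> 3 * g - 1) \<and>
     C_series g = 1 / fps_radical root 2 (1 - 4 * fps_X)
                    * fps_compose (fps_of_poly K) (fps_X / (1 - 4 * fps_X))"

definition K_star :: "nat \<Rightarrow> real poly" where
  "K_star g = (THE K. is_K_star g K)"

definition kappa_star :: "nat \<Rightarrow> nat \<Rightarrow> real" where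
  "kappa_star g n = coeff (K_star g) n"


section \<open>Plane trees\<close>

datatype ptree = Node (children: "ptree list")

fun num_edges :: "ptree \<Rightarrow> nat" where
  "num_edges (Node ts) = (\<Sum>t\<leftarrow>ts. num_edges t + 1)"

text \<open>
  \<open>tree_edges i T\<close> lists the edges of \<open>T\<close> as pairs (parent, child), where the vertices are numbered
  in preorder and the root has number \<open>i\<close>; \<open>forest_edges p j ts\<close> does the same for a list of
  subtrees whose roots hang below vertex \<open>p\<close>, the numbering of their vertices starting at \<open>j\<close>.
  The plant edge is not listed.
\<close>

fun tree_edges :: "nat \<Rightarrow> ptree \<Rightarrow> (nat \<times> nat) list"
  and forest_edges :: "nat \<Rightarrow> nat \<Rightarrow> ptree list \<Rightarrow> (nat \<times> nat) list" where
  "tree_edges i (Node ts) = forest_edges i (i + 1) ts"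
| "forest_edges p j [] = []"
| "forest_edges p j (t # ts) =
     (p, j) # tree_edges j t @ forest_edges p (j + num_edges t + 1) ts"

definition tree_verts :: "ptree \<Rightarrow> nat set" where
  "tree_verts T = {1..num_edges T + 1}"


section \<open>O-trees\<close>

definition O_permutation_on :: "(nat \<Rightarrow> nat) \<Rightarrow> nat set \<Rightarrow> bool" where
  "O_permutation_on \<sigma> A \<longleftrightarrow> \<sigma> permutes A \<and> (\<forall>c\<in>cycles_on \<sigma> A. odd (card c))"

type_synonym otree = "ptree \<times> (nat \<Rightarrow> nat)"

definition O_trees :: "otree set" where
  "O_trees = {(T, \<sigma>). O_permutation_on \<sigma> (tree_verts T)}"

text \<open>
  The underlying graph, with the cycles of \<open>\<sigma>\<close> as vertices. In the degree, a loop counts twice and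
  the plant edge contributes 1 to the vertex containing the root.
\<close>

fun G_verts :: "otree \<Rightarrow> nat set set" where
  "G_verts (T, \<sigma>) = cycles_on \<sigma> (tree_verts T)"

fun G_edges :: "otree \<Rightarrow> (nat set \<times> nat set) multiset" where
  "G_edges (T, \<sigma>) = mset (map (\<lambda>(u, v). (orbit \<sigma> u, orbit \<sigma> v)) (tree_edges 1 T))"

definition G_degree :: "otree \<Rightarrow> nat set \<Rightarrow> nat" where
  "G_degree M c =
     size {#e \<in># G_edges M. fst e = c#} + size {#e \<in># G_edges M. snd e = c#}
       + (if 1 \<in> c then 1 else 0)"

definition R_set :: "nat \<Rightarrow> nat \<Rightarrow> nat \<Rightarrow> otree set" where
  "R_set g t k = {(T, \<sigma>) \<in> O_trees.
     num_edges T + 1 = 2 * g + t + k \<and>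
     card {i \<in> tree_verts T. \<sigma> i = i} = k \<and>
     card {c \<in> cycles_on \<sigma> (tree_verts T). card c > 1} = t \<and>
     (\<forall>c\<in>G_verts (T, \<sigma>). G_degree (T, \<sigma>) c \<ge> 3)}"


section \<open>Integer partitions\<close>

definition partitions_with_parts :: "nat \<Rightarrow> nat \<Rightarrow> nat multiset set" where
  "partitions_with_parts g t = {\<gamma>. sum_mset \<gamma> = g \<and> size \<gamma> = t \<and> 0 \<notin># \<gamma>}"

end

theory Submission
  imports Defs
begin

text \<open>
  Fix a fixed-point free involution \<open>\<alpha>\<close> of a set \<open>D\<close> of \<open>2n\<close> darts. The main step computes
  \<open>L(x) = \<Sum>\<^sub>c x\<^bsup>cyc(c \<circ> \<alpha>)\<^esup>\<close>, the sum over all cyclic permutations \<open>c\<close> of \<open>D\<close> (the possible faces).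
  For a dart \<open>d\<close>, the alternating sum of \<open>(-1)\<^bsup>cyc(c|A)\<^esup>\<close> over the \<open>c\<close>-invariant sets \<open>A\<close> avoiding
  \<open>d\<close> is 1 if \<open>c\<close> is a single cycle and 0 otherwise, because the sets \<open>A\<close> are the unions of
  cycles. Hence \<open>L(x)\<close> is a sum over \<open>A\<close> of sums over pairs of permutations of \<open>A\<close> and of its
  complement. If at least two edges of \<open>\<alpha>\<close> join \<open>A\<close> to its complement, transposing their ends
  is a sign-reversing involution; if there are 0 or 1 such edges, the inner sum is a product
  of two rising factorials, in \<open>-x\<close> and in \<open>x\<close>. Umbral calculus with these products evaluates
  \<open>L(x)\<close> as \<open>(2n-1)!/2\<close> times the coefficient of \<open>y\<^bsup>n+1\<^esup>\<close> in \<open>((1+y)/(1-y))\<^bsup>x\<^esup> = exp(2x artanh y)\<close>,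
  which expands over partitions into odd parts.

  Rooted maps have no automorphisms, so this gives the number of unicellular maps, and summing
  over \<open>n\<close> gives \<open>K\<^sup>\<star>\<close>. On the other side, the degree condition in \<open>R\<^bsub>g,t,0\<^esub>\<close> is automatic, since
  each cycle merges at least three vertices of degree at least 1, and \<open>|R\<^bsub>g,t,0\<^esub>|\<close> is a Catalan
  number times a number of permutations with odd cycles of length at least 3.
\<close>

section \<open>Cycles of permutations\<close>

text \<open>Being a single cycle is not a multiplicative condition. The alternating sum replaces it
  by sums over all permutations of a set, whose cycle counts are generated by rising factorials.
  Keeping \<open>A\<close> away from one dart is essential: over all invariant subsets of a nonempty
  \<open>D\<close> the alternating sum vanishes.

  Maps and partitions meet in the differential equation \<open>(1 - y^2) f' = 2 x f\<close> of
  \<open>f = ((1 + y) / (1 - y))^x\<close>. It enters as a three-term recurrence, established once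
  for the umbral values and once for the sums over partitions; the series in \<open>y\<close> is
  never formed. The underlying recurrence for weighted partitions also counts permutations with odd
  cycles, by removing two elements from a cycle, which is why both sides of the theorem lead to the
  same sum.

  In the number of maps, the term for \<open>t\<close> depends on \<open>n\<close> only through
  \<open>(2n)! / (n! (n - m)!)\<close> with \<open>m = 2g + t - 1\<close>. Up to a constant this is
  the expansion of \<open>z^m / (1 - 4z)^(m + 1/2)\<close>, so the coefficients of
  \<open>K_star\<close> are read off without inverting any series.\<close>

lemma orbit_eq:
  assumes "p permutes D" "finite D" "y \<in> orbit p x"
  shows "orbit p y = orbit p x"
  using cyclic_on_orbit[OF assms(1,2)] assms(3) by (rule orbit_cyclic_eq3)

lemma self_in_orbit:
  assumes "p permutes D" "finite D"
  shows "x \<in> orbit p x"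
  using assms permutation_permutes permutation_self_in_orbit by metis

lemma finite_cycles_on: "finite D \<Longrightarrow> finite (cycles_on p D)"
  by (simp add: cycles_on_def)

lemma cycles_on_eq_if_in_orbit:
  assumes "p permutes D" "finite D" "c \<in> cycles_on p D" "x \<in> c"
  shows "c = orbit p x"
  using assms orbit_eq unfolding cycles_on_def by fastforce

lemma Union_cycles_on:
  assumes "p permutes D" "finite D"
  shows "\<Union> (cycles_on p D) = D"
  unfolding cycles_on_def using permutes_orbit_subset[OF assms(1)] self_in_orbit[OF assms] by blast

lemma orbit_in_cycles_on: "x \<in> D \<Longrightarrow> orbit p x \<in> cycles_on p D"
  by (simp add: cycles_on_def)

lemma cycles_on_cong:
  assumes "\<And>x. x \<in> A \<Longrightarrow> p x \<in> A" "\<And>x. x \<in> A \<Longrightarrow> p x = q x"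
  shows "cycles_on p A = cycles_on q A"
  unfolding cycles_on_def
  by (intro image_cong refl orbit_cong0[where A = A]) (use assms in auto)

lemma card_cycles_on_conj:
  assumes p: "p permutes D" "finite D" and h: "inj_on h D"
    and eq: "\<And>x. x \<in> D \<Longrightarrow> h (p x) = q (h x)"
  shows "card (cycles_on q (h ` D)) = card (cycles_on p D)"
proof -
  have "orbit q (h x) = h ` orbit p x" if "x \<in> D" for x
    using orbit_inverse[OF self_in_orbit[OF p], of x q h] eq permutes_orbit_subset[OF p(1) that]
    by fastforce
  hence "cycles_on q (h ` D) = (`) h ` cycles_on p D"
    unfolding cycles_on_def image_image by (rule image_cong[OF refl])
  moreover have "inj_on ((`) h) (cycles_on p D)"
    by (rule inj_on_subset[OF inj_on_image_Pow[OF h]])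
       (use Union_cycles_on[OF p] in blast)
  ultimately show ?thesis by (simp add: card_image)
qed

lemma card_cycles_on_conj_perm:
  assumes "p permutes D" "finite D" "h permutes D" "h \<circ> p = q \<circ> h"
  shows "card (cycles_on q D) = card (cycles_on p D)"
  using card_cycles_on_conj[OF assms(1,2) permutes_inj_on[OF assms(3)], of q]
  unfolding permutes_image[OF assms(3)] using fun_cong[OF assms(4)] by simp

lemma card_cycles_on_Un:
  assumes p: "p permutes A" "finite A" and q: "q permutes B" "finite B" and "A \<inter> B = {}"
  shows "card (cycles_on (p \<circ> q) (A \<union> B)) = card (cycles_on p A) + card (cycles_on q B)"
proof -
  have qA: "q x = x" if "x \<in> A" for x
    using that \<open>A \<inter> B = {}\<close> by (intro permutes_not_in[OF q(1)]) blast
  have pB: "p x = x" if "x \<in> B" for x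
    using that \<open>A \<inter> B = {}\<close> by (intro permutes_not_in[OF p(1)]) blast
  have qB: "q x \<in> B" if "x \<in> B" for x using permutes_in_image[OF q(1)] that by simp
  have 1: "cycles_on (p \<circ> q) A = cycles_on p A"
    by (rule cycles_on_cong) (simp_all add: qA permutes_in_image[OF p(1)])
  have 2: "cycles_on (p \<circ> q) B = cycles_on q B"
    by (rule cycles_on_cong) (simp_all add: pB qB)
  have "cycles_on p A \<inter> cycles_on q B = {}"
  proof -
    have "c \<subseteq> A \<and> c \<subseteq> B \<and> c \<noteq> {}" if "c \<in> cycles_on p A" "c \<in> cycles_on q B" for c
      using that Union_cycles_on[OF p] Union_cycles_on[OF q] orbit_nonempty[of p] 
      unfolding cycles_on_def by blast
    thus ?thesis using \<open>A \<inter> B = {}\<close> by blast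
  qed
  moreover have "cycles_on (p \<circ> q) (A \<union> B) = cycles_on p A \<union> cycles_on q B"
    using 1 2 by (simp add: cycles_on_def image_Un)
  ultimately show ?thesis
    using assms by (simp add: card_Un_disjoint finite_cycles_on)
qed

section \<open>Merging two cycles by a transposition\<close>

lemma orbit_join:
  assumes p: "p permutes D" "finite D" and ab: "orbit p a \<noteq> orbit p b"
  shows "orbit (p \<circ> transpose a b) a = orbit p a \<union> orbit p b"
proof -
  define q where "q = p \<circ> transpose a b"
  have qa: "q a = p b" and qb: "q b = p a" and qx: "\<And>x. x \<noteq> a \<Longrightarrow> x \<noteq> b \<Longrightarrow> q x = p x"
    by (auto simp: q_def)
  \<comment> \<open>Starting at \<open>a\<close>, \<open>q\<close> jumps to \<open>p b\<close>, runs
    through the cycle of \<open>b\<close> up to \<open>b\<close>, then jumps to \<open>p a\<close>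
    and runs through the cycle of \<open>a\<close>. As the two orbits are disjoint, no changed value
    is met in between.\<close>
  have na: "a \<notin> orbit p b" and nb: "b \<notin> orbit p a" using ab orbit_eq[OF p] by blast+
  have "y \<in> orbit q a" if "y \<in> orbit p b" for y
    using that
  proof induction
    case base
    then show ?case using orbit.base[of q a] qa by simp
  next
    case (step y)
    show ?case
    proof (cases "y = b")
      case True
      then show ?thesis using orbit.base[of q a] qa by simp
    next
      case False
      moreover have "y \<noteq> a" using step na by blast
      ultimately show ?thesis using step orbit.step[of y q a] qx by simp
    qed
  qed
  note 1 = this
  have ba: "b \<in> orbit q a" using 1 self_in_orbit[OF p] by blast
  have "y \<in> orbit q a" if "y \<in> orbit p a" for y
    using that
  proof induction
    case base
    then show ?case using orbit.step[OF ba] qb by simp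
  next
    case (step y)
    show ?case
    proof (cases "y = a")
      case True
      then show ?thesis using orbit.step[OF ba] qb by simp
    next
      case False
      moreover have "y \<noteq> b" using step nb by blast
      ultimately show ?thesis using step orbit.step[of y q a] qx by simp
    qed
  qed
  moreover have "y \<in> orbit p a \<union> orbit p b" if "y \<in> orbit q a" for y
    using that
  proof induction
    case base
    then show ?case using orbit.base[of p b] qa by simp
  next
    case (step y)
    show ?case
    proof (cases "y = a \<or> y = b")
      case True
      then show ?thesis using orbit.base[of p a] orbit.base[of p b] qa qb by auto
    next
      case False
      then show ?thesis using step orbit.step[of y p] qx by auto
    qed
  qed
  ultimately show ?thesis using 1 unfolding q_def by blast
qed

lemma cycles_on_join:
  assumes p: "p permutes D" "finite D" and "a \<in> D" "b \<in> D" and ab: "orbit p a \<noteq> orbit p b"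
  shows "cycles_on (p \<circ> transpose a b) D =
    insert (orbit p a \<union> orbit p b) (cycles_on p D - {orbit p a, orbit p b})"
proof -
  define q where "q = p \<circ> transpose a b"
  have q: "q permutes D"
    unfolding q_def using assms by (intro permutes_compose permutes_swap_id)
  have qa: "orbit q a = orbit p a \<union> orbit p b"
    unfolding q_def by (rule orbit_join[OF p ab])
  have in_ab: "orbit q x = orbit p a \<union> orbit p b" if "x \<in> orbit p a \<union> orbit p b" for x
    using orbit_eq[OF q p(2)] qa that by metis
  have out: "orbit q x = orbit p x" if "x \<notin> orbit p a \<union> orbit p b" for x
  proof (rule orbit_cong[OF self_in_orbit[OF p]])
    fix s assume s: "s \<in> orbit p x"
    have "s \<noteq> a" "s \<noteq> b"
      using orbit_eq[OF p s] self_in_orbit[OF p, of x] that by auto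
    thus "q s = p s" by (simp add: q_def)
  qed
  have "cycles_on q D = insert (orbit p a \<union> orbit p b) (cycles_on p D - {orbit p a, orbit p b})"
  proof (intro set_eqI iffI)
    fix c assume "c \<in> cycles_on q D"
    then obtain x where x: "x \<in> D" "c = orbit q x" by (auto simp: cycles_on_def)
    show "c \<in> insert (orbit p a \<union> orbit p b) (cycles_on p D - {orbit p a, orbit p b})"
    proof (cases "x \<in> orbit p a \<union> orbit p b")
      case True
      then show ?thesis using in_ab x by simp
    next
      case False
      hence "c = orbit p x" using out x by simp
      moreover have "x \<in> orbit p x" by (rule self_in_orbit[OF p])
      ultimately show ?thesis using False x by (auto simp: cycles_on_def)
    qed
  next
    fix c assume c: "c \<in> insert (orbit p a \<union> orbit p b) (cycles_on p D - {orbit p a, orbit p b})"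
    show "c \<in> cycles_on q D"
    proof (cases "c = orbit p a \<union> orbit p b")
      case True
      then show ?thesis using qa assms(3) orbit_in_cycles_on by metis
    next
      case False
      then obtain x where x: "x \<in> D" "c = orbit p x" "c \<noteq> orbit p a" "c \<noteq> orbit p b"
        using c by (auto simp: cycles_on_def)
      hence "x \<notin> orbit p a \<union> orbit p b" using orbit_eq[OF p] by blast
      thus ?thesis using out x orbit_in_cycles_on by metis
    qed
  qed
  thus ?thesis by (simp add: q_def)
qed

lemma card_cycles_on_join:
  assumes p: "p permutes D" "finite D" and D: "a \<in> D" "b \<in> D" and ab: "orbit p a \<noteq> orbit p b"
  shows "Suc (card (cycles_on (p \<circ> transpose a b) D)) = card (cycles_on p D)"
proof -
  have "orbit p a \<union> orbit p b \<notin> cycles_on p D"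
  proof
    assume "orbit p a \<union> orbit p b \<in> cycles_on p D"
    note U = this
    have "orbit p a \<union> orbit p b = orbit p a"
      by (rule cycles_on_eq_if_in_orbit[OF p U]) (simp add: self_in_orbit[OF p])
    moreover have "orbit p a \<union> orbit p b = orbit p b"
      by (rule cycles_on_eq_if_in_orbit[OF p U]) (simp add: self_in_orbit[OF p])
    ultimately have "orbit p a = orbit p b" by simp
    thus False using ab by simp
  qed
  moreover have "card (cycles_on p D - {orbit p a, orbit p b}) = card (cycles_on p D) - 2"
    using ab D orbit_in_cycles_on[of _ D p] p(2) by (subst card_Diff_subset) auto
  moreover have "card {orbit p a, orbit p b} \<le> card (cycles_on p D)"
    using D orbit_in_cycles_on[of _ D p] p(2) by (intro card_mono finite_cycles_on) auto
  ultimately show ?thesis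
    unfolding cycles_on_join[OF assms] using ab p(2) by (simp add: finite_cycles_on)
qed

lemma orbit_fixpoint: "p x = x \<Longrightarrow> orbit p x = {x}"
  by (simp add: orbit_eq_singleton_iff)

lemma card_cycles_on_insert:
  assumes p: "p permutes A" "finite A" and x: "x \<notin> A"
  shows "card (cycles_on p (insert x A)) = Suc (card (cycles_on p A))"
  using card_cycles_on_Un[OF p permutes_id, of "{x}"] x
  by (simp add: cycles_on_def orbit_fixpoint)

text \<open>The new cycle \<open>{x}\<close> is absorbed by the cycle of \<open>b\<close>, so the
  gain from inserting \<open>x\<close> and the loss from joining cancel. Multiplying by the
  transposition on the left or on the right gives conjugate permutations, hence the same
  count.\<close>

lemma card_cycles_on_insert_transpose:
  assumes p: "p permutes A" "finite A" and x: "x \<notin> A" and b: "b \<in> A"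
  shows "card (cycles_on (transpose x b \<circ> p) (insert x A)) = card (cycles_on p A)"
proof -
  have p': "p permutes insert x A" using p(1) by (rule permutes_imp_permutes_insert)
  have px: "p x = x" using permutes_not_in[OF p(1) x] .
  have "orbit p x \<noteq> orbit p b"
    using self_in_orbit[OF p, of b] x b by (metis orbit_fixpoint px singletonD)
  hence "Suc (card (cycles_on (p \<circ> transpose x b) (insert x A))) = card (cycles_on p (insert x A))"
    using card_cycles_on_join[OF p'] b p(2) by simp
  moreover have "card (cycles_on (transpose x b \<circ> p) (insert x A)) =
      card (cycles_on (p \<circ> transpose x b) (insert x A))"
  proof (rule card_cycles_on_conj_perm)
    show "p \<circ> transpose x b permutes insert x A"
      using p' b by (intro permutes_compose permutes_swap_id) auto
    show "transpose x b permutes insert x A" using b by (intro permutes_swap_id) auto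
  qed (use p(2) in \<open>auto simp: fun_eq_iff\<close>)
  ultimately show ?thesis using card_cycles_on_insert[OF p x] by simp
qed

text \<open>A permutation of \<open>insert x A\<close> is a permutation of \<open>A\<close> followed
  by a transposition of \<open>x\<close> and \<open>b\<close>. The choice \<open>b = x\<close>
  creates a new cycle and gives a factor \<open>y\<close>; each of the other \<open>card A\<close>
  choices leaves the number of cycles unchanged.\<close>

lemma sum_cycles_power:
  fixes y :: "'b :: comm_ring_1"
  assumes "finite A"
  shows "(\<Sum>p | p permutes A. y ^ card (cycles_on p A)) = pochhammer y (card A)"
  using assms
proof induction
  case empty
  then show ?case by (simp add: cycles_on_def)
next
  case (insert x A)
  have "(\<Sum>p | p permutes insert x A. y ^ card (cycles_on p (insert x A))) =
     (\<Sum>b\<in>insert x A. \<Sum>q | q permutes A. y ^ card (cycles_on (transpose x b \<circ> q) (insert x A)))"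
    using insert by (intro sum_over_permutations_insert)
  also have "\<dots> = (\<Sum>q | q permutes A. y ^ Suc (card (cycles_on q A))) +
      (\<Sum>b\<in>A. \<Sum>q | q permutes A. y ^ card (cycles_on q A))"
    using insert
    by (subst sum.insert)
       (auto simp: card_cycles_on_insert card_cycles_on_insert_transpose intro!: arg_cong2[of _ _ _ _ "(+)"] sum.cong)
  also have "\<dots> = (y + of_nat (card A)) * pochhammer y (card A)"
    using insert by (simp add: sum_distrib_left[symmetric] algebra_simps)
  finally show ?case using insert by (simp add: pochhammer_Suc mult.commute)
qed

text \<open>The parity of the number of cycles becomes multiplicative up to a constant; this allows
  \<open>(-1) ^ card (cycles_on p A)\<close> to be carried across products of permutations.\<close>

lemma sign_cycles:
  assumes "finite A" "p permutes A"
  shows "(-1) ^ card (cycles_on p A) = (-1) ^ card A * sign p"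
  using assms
proof (induction arbitrary: p rule: finite_induct)
  case empty
  then show ?case by (simp add: cycles_on_def)
next
  case (insert x A)
  define b where "b = p x"
  define q where "q = transpose x b \<circ> p"
  have q: "b \<in> insert x A" "q permutes A" "p = transpose x b \<circ> q"
    using permutes_in_image[OF insert.prems, of x] permutes_insert_lemma[OF insert.prems]
    by (auto simp: b_def q_def fun_eq_iff)
  have qp: "permutation q" using q insert permutation_permutes by blast
  show ?case
  proof (cases "b = x")
    case True
    then show ?thesis using insert q by (simp add: card_cycles_on_insert)
  next
    case False
    hence "sign p = - sign q" using q qp by (simp add: sign_compose permutation_swap_id sign_swap_id)
    moreover have "card (cycles_on p (insert x A)) = card (cycles_on q A)"
      unfolding q(3) using q False insert by (intro card_cycles_on_insert_transpose) auto
    ultimately show ?thesis using insert q(2) by simp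
  qed
qed

section \<open>Alternating sums over unions of cycles\<close>

lemma sum_Pow_card:
  fixes f :: "nat \<Rightarrow> 'b :: comm_ring_1"
  assumes "finite S"
  shows "(\<Sum>Z\<in>Pow S. f (card Z)) = (\<Sum>i\<le>card S. of_nat (card S choose i) * f i)"
proof -
  have "(\<Sum>Z\<in>Pow S. f (card Z)) = (\<Sum>i\<in>{..card S}. \<Sum>Z\<in>{Z\<in>Pow S. card Z = i}. f (card Z))"
    using assms by (intro sum.group[symmetric]) (auto intro: card_mono)
  also have "\<dots> = (\<Sum>i\<le>card S. of_nat (card S choose i) * f i)"
  proof (rule sum.cong[OF refl])
    fix i
    have "(\<Sum>Z\<in>{Z\<in>Pow S. card Z = i}. f (card Z)) = of_nat (card {Z\<in>Pow S. card Z = i}) * f i" by simp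
    thus "(\<Sum>Z\<in>{Z\<in>Pow S. card Z = i}. f (card Z)) = of_nat (card S choose i) * f i"
      using n_subsets[OF assms, of i] by simp
  qed
  finally show ?thesis .
qed

lemma sum_Pow_alternating:
  assumes "finite S"
  shows "(\<Sum>Z\<in>Pow S. (-1) ^ card Z) = (if S = {} then 1 else 0 :: 'b :: comm_ring_1)"
proof -
  have "(\<Sum>Z\<in>Pow S. (-1) ^ card Z) = (\<Sum>i\<le>card S. of_nat (card S choose i) * (-1 :: 'b) ^ i)"
    by (rule sum_Pow_card[OF assms])
  also have "\<dots> = (-1 + 1) ^ card S" by (subst binomial_ring) simp
  finally show ?thesis using assms by (auto simp: power_0_left)
qed

text \<open>An invariant set contains the whole cycle of each of its elements. Allowing a subset
  \<open>S\<close> of the cycles makes it possible to forbid the cycle of a given dart, and to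
  select edges when the lemma is applied to an involution.\<close>

lemma bij_betw_Union_cycles:
  assumes c: "c permutes D" "finite D" and S: "S \<subseteq> cycles_on c D"
  shows "bij_betw Union (Pow S) {A. A \<subseteq> \<Union>S \<and> c ` A = A}"
    and "\<And>Z. Z \<subseteq> S \<Longrightarrow> cycles_on c (\<Union>Z) = Z"
proof -
  have D: "\<Union> (cycles_on c D) = D" by (rule Union_cycles_on[OF c])
  have orb: "orbit c x \<subseteq> A" if "x \<in> A" "c ` A = A" for x A
  proof
    fix y assume "y \<in> orbit c x" thus "y \<in> A" by induction (use that in auto)
  qed
  show cU: "cycles_on c (\<Union>Z) = Z" if "Z \<subseteq> S" for Z
    unfolding cycles_on_def
  proof (intro set_eqI iffI)
    fix u assume "u \<in> orbit c ` \<Union>Z"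
    then obtain x z where x: "x \<in> z" "z \<in> Z" "u = orbit c x" by blast
    hence "z = orbit c x" using cycles_on_eq_if_in_orbit[OF c, of z x] that S by auto
    thus "u \<in> Z" using x by simp
  next
    fix u assume u: "u \<in> Z"
    hence "u \<in> cycles_on c D" using that S by blast
    then obtain x where "u = orbit c x" by (auto simp: cycles_on_def)
    moreover have "x \<in> orbit c x" by (rule self_in_orbit[OF c])
    ultimately show "u \<in> orbit c ` \<Union>Z" using u by blast
  qed
  show "bij_betw Union (Pow S) {A. A \<subseteq> \<Union>S \<and> c ` A = A}"
  proof (rule bij_betwI[where g = "cycles_on c"])
    show "Union \<in> Pow S \<rightarrow> {A. A \<subseteq> \<Union>S \<and> c ` A = A}"
    proof
      fix Z assume "Z \<in> Pow S"
      hence Z: "Z \<subseteq> S" by simp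
      have sub: "c ` \<Union>Z \<subseteq> \<Union>Z"
      proof
        fix y assume "y \<in> c ` \<Union>Z"
        then obtain x z where x: "x \<in> z" "z \<in> Z" "y = c x" by blast
        hence "z = orbit c x" using cycles_on_eq_if_in_orbit[OF c, of z x] Z S by auto
        thus "y \<in> \<Union>Z" using x orbit.base[of c x] by blast
      qed
      have "\<Union>Z \<subseteq> D" using Z S D by blast
      hence "finite (\<Union>Z)" using c(2) finite_subset by blast
      hence "c ` \<Union>Z = \<Union>Z" using sub permutes_inj_on[OF c(1)] by (metis endo_inj_surj)
      thus "\<Union>Z \<in> {A. A \<subseteq> \<Union>S \<and> c ` A = A}" using Z by blast
    qed
  next
    show "cycles_on c \<in> {A. A \<subseteq> \<Union>S \<and> c ` A = A} \<rightarrow> Pow S"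
    proof
      fix A assume A: "A \<in> {A. A \<subseteq> \<Union>S \<and> c ` A = A}"
      have "orbit c x \<in> S" if "x \<in> A" for x
      proof -
        have "x \<in> \<Union>S" using A that by blast
        then obtain z where "z \<in> S" "x \<in> z" by blast
        thus ?thesis using cycles_on_eq_if_in_orbit[OF c, of z x] S by auto
      qed
      thus "cycles_on c A \<in> Pow S" by (auto simp: cycles_on_def)
    qed
  next
    fix A assume "A \<in> {A. A \<subseteq> \<Union>S \<and> c ` A = A}"
    thus "\<Union> (cycles_on c A) = A"
      unfolding cycles_on_def using orb[of _ A] self_in_orbit[OF c] by blast
  qed (use cU in auto)
qed

text \<open>An invariant set without \<open>d\<close> misses the whole cycle of \<open>d\<close>, so
  it is a union of some of the other cycles. The alternating sum over subsets of these is 0 unless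
  there are none.\<close>

lemma sum_invariant_subsets:
  assumes c: "c permutes D" "finite D" and d: "d \<in> D"
  shows "(\<Sum>A | A \<subseteq> D - {d} \<and> c ` A = A. (-1) ^ card (cycles_on c A)) =
    (if card (cycles_on c D) = 1 then 1 else 0 :: 'b :: comm_ring_1)"
proof -
  define S where "S = cycles_on c D - {orbit c d}"
  have S: "S \<subseteq> cycles_on c D" by (auto simp: S_def)
  have "\<Union>S = D - orbit c d"
    using Union_cycles_on[OF c] cycles_on_eq_if_in_orbit[OF c] orbit_in_cycles_on[OF d]
    unfolding S_def by blast
  moreover have "A \<subseteq> D - orbit c d" if "A \<subseteq> D - {d}" "c ` A = A" for A
  proof -
    have "x \<notin> A" if "x \<in> orbit c d" for x
    proof
      assume "x \<in> A"
      have "y \<in> A" if "y \<in> orbit c x" for y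
        using that by induction (use \<open>c ` A = A\<close> \<open>x \<in> A\<close> in auto)
      moreover have "d \<in> orbit c x"
        using orbit_eq[OF c that] self_in_orbit[OF c] by metis
      ultimately show False using \<open>A \<subseteq> D - {d}\<close> by blast
    qed
    thus ?thesis using that by blast
  qed
  ultimately have "{A. A \<subseteq> D - {d} \<and> c ` A = A} = {A. A \<subseteq> \<Union>S \<and> c ` A = A}"
    using self_in_orbit[OF c, of d] by auto
  hence "(\<Sum>A | A \<subseteq> D - {d} \<and> c ` A = A. (-1 :: 'b) ^ card (cycles_on c A)) =
      (\<Sum>A | A \<subseteq> \<Union>S \<and> c ` A = A. (-1) ^ card (cycles_on c A))" by simp
  also have "\<dots> = (\<Sum>Z\<in>Pow S. (-1) ^ card (cycles_on c (\<Union>Z)))"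
    by (rule sum.reindex_bij_betw[symmetric, OF bij_betw_Union_cycles(1)[OF c S]])
  also have "\<dots> = (\<Sum>Z\<in>Pow S. (-1) ^ card Z)"
    by (intro sum.cong refl) (simp add: bij_betw_Union_cycles(2)[OF c S])
  also have "\<dots> = (if S = {} then 1 else 0)"
    by (rule sum_Pow_alternating) (simp add: finite_cycles_on c S_def)
  also have "S = {} \<longleftrightarrow> card (cycles_on c D) = 1"
  proof
    assume "S = {}"
    hence "cycles_on c D = {orbit c d}" using orbit_in_cycles_on[OF d] unfolding S_def by blast
    thus "card (cycles_on c D) = 1" by simp
  next
    assume "card (cycles_on c D) = 1"
    then obtain z where "cycles_on c D = {z}" using card_1_singletonE by blast
    thus "S = {}" using orbit_in_cycles_on[OF d, of c] by (auto simp: S_def)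
  qed
  finally show ?thesis .
qed


section \<open>Long cycles as an alternating sum over invariant subsets\<close>

definition fpf_involutions :: "'a set \<Rightarrow> ('a \<Rightarrow> 'a) set" where
  "fpf_involutions D = {\<alpha>. \<alpha> permutes D \<and> (\<forall>d\<in>D. \<alpha> d \<noteq> d \<and> \<alpha> (\<alpha> d) = d)}"

lemma permutes_commute:
  assumes "p permutes A" "q permutes B" "A \<inter> B = {}"
  shows "p \<circ> q = q \<circ> p"
proof
  fix x
  show "(p \<circ> q) x = (q \<circ> p) x"
  proof (cases "x \<in> A")
    case True
    hence "p x \<notin> B" "x \<notin> B" using permutes_in_image[OF assms(1)] assms(3) by blast+
    thus ?thesis using permutes_not_in[OF assms(2)] by simp
  next
    case False
    moreover have "q x \<notin> A"
    proof (cases "x \<in> B")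
      case True
      hence "q x \<in> B" using permutes_in_image[OF assms(2)] by simp
      thus ?thesis using assms(3) by blast
    next
      case False
      thus ?thesis using permutes_not_in[OF assms(2)] \<open>x \<notin> A\<close> by simp
    qed
    ultimately show ?thesis using permutes_not_in[OF assms(1)] by simp
  qed
qed

lemma restrict_id_comp:
  assumes "c permutes D" "A \<subseteq> D" "c ` A = A"
  shows "restrict_id c A permutes A" "restrict_id c (D - A) permutes D - A"
    "restrict_id c A \<circ> restrict_id c (D - A) = c"
proof -
  have inj: "inj_on c E" for E using permutes_inj[OF assms(1)] inj_on_subset by blast
  show "restrict_id c A permutes A"
    by (intro permutes_restrict_id) (simp add: bij_betw_def inj assms)
  have *: "c ` (D - A) = D - A"
    using assms permutes_image[OF assms(1)] image_set_diff[OF permutes_inj[OF assms(1)]] by simp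
  show "restrict_id c (D - A) permutes D - A"
    by (intro permutes_restrict_id) (simp add: bij_betw_def inj *)
  show "restrict_id c A \<circ> restrict_id c (D - A) = c"
  proof
    fix x
    show "(restrict_id c A \<circ> restrict_id c (D - A)) x = c x"
    proof (cases "x \<in> D - A")
      case True
      hence "c x \<notin> A" using * by blast
      thus ?thesis using True by simp
    next
      case False
      then show ?thesis using permutes_not_in[OF assms(1)] assms(2) by (cases "x \<in> A") auto
    qed
  qed
qed

lemma comp_permutes_disjoint:
  assumes "p permutes A" "q permutes B" "A \<inter> B = {}"
  shows "p \<circ> q permutes A \<union> B" "\<And>x. x \<in> A \<Longrightarrow> (p \<circ> q) x = p x" "\<And>x. x \<in> B \<Longrightarrow> (p \<circ> q) x = q x"
proof -
  show "p \<circ> q permutes A \<union> B"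
    using assms by (intro permutes_compose) (auto intro: permutes_subset)
  show "(p \<circ> q) x = p x" if "x \<in> A" for x
  proof -
    have "x \<notin> B" using that assms(3) by blast
    thus ?thesis using permutes_not_in[OF assms(2)] by simp
  qed
  show "(p \<circ> q) x = q x" if "x \<in> B" for x
  proof -
    have "q x \<notin> A" using that permutes_in_image[OF assms(2)] assms(3) by blast
    thus ?thesis using permutes_not_in[OF assms(1)] by simp
  qed
qed

lemma bij_betw_comp_permutes:
  assumes "A \<subseteq> D"
  shows "bij_betw (\<lambda>(p, q). p \<circ> q) ({p. p permutes A} \<times> {q. q permutes D - A})
    {c. c permutes D \<and> c ` A = A}"
proof (rule bij_betwI[where g = "\<lambda>c. (restrict_id c A, restrict_id c (D - A))"])
  have disj: "A \<inter> (D - A) = {}" and un: "A \<union> (D - A) = D" using assms by auto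
  show "(\<lambda>(p, q). p \<circ> q) \<in> {p. p permutes A} \<times> {q. q permutes D - A} \<rightarrow> {c. c permutes D \<and> c ` A = A}"
  proof clarify
    fix p q assume pq: "p permutes A" "q permutes D - A"
    note comp = comp_permutes_disjoint[OF pq disj]
    have "(p \<circ> q) ` A = p ` A" by (rule image_cong[OF refl]) (rule comp(2))
    thus "p \<circ> q permutes D \<and> (p \<circ> q) ` A = A"
      using comp(1) un permutes_image[OF pq(1)] by simp
  qed
  show "(\<lambda>c. (restrict_id c A, restrict_id c (D - A)))
      \<in> {c. c permutes D \<and> c ` A = A} \<rightarrow> {p. p permutes A} \<times> {q. q permutes D - A}"
    using restrict_id_comp[OF _ assms] by auto
  show "(case (restrict_id c A, restrict_id c (D - A)) of (p, q) \<Rightarrow> p \<circ> q) = c"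
    if "c \<in> {c. c permutes D \<and> c ` A = A}" for c
    using restrict_id_comp(3)[OF _ assms] that by simp
  fix pq assume "pq \<in> {p. p permutes A} \<times> {q. q permutes D - A}"
  then obtain p q where pq: "pq = (p, q)" "p permutes A" "q permutes D - A" by auto
  note comp = comp_permutes_disjoint[OF pq(2,3) disj]
  have "restrict_id (p \<circ> q) A = p"
    using comp(2) permutes_not_in[OF pq(2)] by (auto simp: restrict_id_def simp del: comp_apply)
  moreover have "restrict_id (p \<circ> q) (D - A) = q"
    using comp(3) permutes_not_in[OF pq(3)] by (auto simp: restrict_id_def simp del: comp_apply)
  ultimately show "(restrict_id (case pq of (p, q) \<Rightarrow> p \<circ> q) A,
      restrict_id (case pq of (p, q) \<Rightarrow> p \<circ> q) (D - A)) = pq"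
    using pq(1) by simp
qed

text \<open>The contribution of one set \<open>A\<close> to the alternating sum: a permutation that
  preserves \<open>A\<close> is written as \<open>p \<circ> q\<close>, and only the cycles of
  \<open>p\<close> carry a sign.\<close>

definition split_sum :: "('a \<Rightarrow> 'a) \<Rightarrow> 'a set \<Rightarrow> real \<Rightarrow> 'a set \<Rightarrow> real" where
  "split_sum \<alpha> D x A = (\<Sum>p | p permutes A. \<Sum>q | q permutes D - A.
     (-1) ^ card (cycles_on p A) * x ^ card (cycles_on (p \<circ> q \<circ> \<alpha>) D))"

lemma sum_long_cycles_eq_split_sum:
  fixes x :: real
  assumes D: "finite D" "d \<in> D"
  shows "(\<Sum>c | c permutes D \<and> card (cycles_on c D) = 1. x ^ card (cycles_on (c \<circ> \<alpha>) D)) =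
    (\<Sum>A\<in>Pow (D - {d}). split_sum \<alpha> D x A)"
proof -
  have fin: "finite {c. c permutes D}" using D finite_permutations by blast
  have "(\<Sum>c | c permutes D \<and> card (cycles_on c D) = 1. x ^ card (cycles_on (c \<circ> \<alpha>) D)) =
      (\<Sum>c | c permutes D. (if card (cycles_on c D) = 1 then 1 else 0) * x ^ card (cycles_on (c \<circ> \<alpha>) D))"
    using fin by (intro sum.mono_neutral_cong_left) auto
  also have "\<dots> = (\<Sum>c | c permutes D. \<Sum>A\<in>{A \<in> Pow (D - {d}). c ` A = A}.
      (-1) ^ card (cycles_on c A) * x ^ card (cycles_on (c \<circ> \<alpha>) D))"
  proof (rule sum.cong[OF refl])
    fix c assume c: "c \<in> {c. c permutes D}"
    have "{A. A \<subseteq> D - {d} \<and> c ` A = A} = {A \<in> Pow (D - {d}). c ` A = A}" by auto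
    thus "(if card (cycles_on c D) = 1 then 1 else 0) * x ^ card (cycles_on (c \<circ> \<alpha>) D) =
        (\<Sum>A\<in>{A \<in> Pow (D - {d}). c ` A = A}. (-1) ^ card (cycles_on c A) * x ^ card (cycles_on (c \<circ> \<alpha>) D))"
      using sum_invariant_subsets[of c D d, where 'b = real] c D
      by (simp add: sum_distrib_right[symmetric])
  qed
  also have "\<dots> = (\<Sum>A\<in>Pow (D - {d}). \<Sum>c\<in>{c \<in> {c. c permutes D}. c ` A = A}.
      (-1) ^ card (cycles_on c A) * x ^ card (cycles_on (c \<circ> \<alpha>) D))"
    using D fin by (intro sum.swap_restrict) auto
  also have "\<dots> = (\<Sum>A\<in>Pow (D - {d}). split_sum \<alpha> D x A)"
  proof (rule sum.cong[OF refl])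
    fix A assume "A \<in> Pow (D - {d})"
    hence A: "A \<subseteq> D" by auto
    have eq: "cycles_on (p \<circ> q) A = cycles_on p A" if "p permutes A" "q permutes D - A" for p q
    proof (rule cycles_on_cong)
      fix y assume "y \<in> A"
      thus "(p \<circ> q) y = p y" using comp_permutes_disjoint(2)[OF that] by blast
      thus "(p \<circ> q) y \<in> A" using permutes_in_image[OF that(1)] \<open>y \<in> A\<close> by simp
    qed
    have "(\<Sum>c\<in>{c \<in> {c. c permutes D}. c ` A = A}.
        (-1) ^ card (cycles_on c A) * x ^ card (cycles_on (c \<circ> \<alpha>) D)) =
      (\<Sum>pq\<in>{p. p permutes A} \<times> {q. q permutes D - A}.
        (-1) ^ card (cycles_on ((\<lambda>(p, q). p \<circ> q) pq) A) *
        x ^ card (cycles_on ((\<lambda>(p, q). p \<circ> q) pq \<circ> \<alpha>) D))"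
      unfolding mem_Collect_eq by (rule sum.reindex_bij_betw[OF bij_betw_comp_permutes[OF A], symmetric])
    also have "\<dots> = (\<Sum>(p, q)\<in>{p. p permutes A} \<times> {q. q permutes D - A}.
        (-1) ^ card (cycles_on p A) * x ^ card (cycles_on (p \<circ> q \<circ> \<alpha>) D))"
      by (intro sum.cong refl) (auto simp: eq)
    finally show "(\<Sum>c\<in>{c \<in> {c. c permutes D}. c ` A = A}.
        (-1) ^ card (cycles_on c A) * x ^ card (cycles_on (c \<circ> \<alpha>) D)) = split_sum \<alpha> D x A"
      by (simp add: split_sum_def sum.cartesian_product)
  qed
  finally show ?thesis .
qed

text \<open>Let \<open>\<tau>'\<close> exchange \<open>a\<close> and \<open>a'\<close>, and let
  \<open>\<tau>\<close> exchange their partners. As \<open>\<alpha>\<close> carries one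
  transposition to the other, passing from \<open>(p, q)\<close> to
  \<open>(p \<circ> \<tau>', \<tau> \<circ> q)\<close> conjugates
  \<open>p \<circ> q \<circ> \<alpha>\<close> by \<open>\<tau>\<close>. The power of
  \<open>x\<close> stays, the sign of \<open>p\<close> flips, and the sum equals its own
  negative.\<close>

lemma split_sum_eq_0:
  assumes D: "finite D" and A: "A \<subseteq> D" and \<alpha>: "\<alpha> \<in> fpf_involutions D"
    and a: "a \<in> A" "a' \<in> A" "a \<noteq> a'" "\<alpha> a \<notin> A" "\<alpha> a' \<notin> A"
  shows "split_sum \<alpha> D x A = 0"
proof -
  define \<tau> where "\<tau> = transpose (\<alpha> a) (\<alpha> a')"
  define \<tau>' where "\<tau>' = transpose a a'"
  have \<alpha>p: "\<alpha> permutes D" and inv: "\<And>d. d \<in> D \<Longrightarrow> \<alpha> (\<alpha> d) = d"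
    using \<alpha> by (auto simp: fpf_involutions_def)
  have bD: "\<alpha> a \<in> D - A" "\<alpha> a' \<in> D - A" using permutes_in_image[OF \<alpha>p] a A by blast+
  have \<tau>: "\<tau> permutes D - A" unfolding \<tau>_def using bD by (rule permutes_swap_id)
  have \<tau>': "\<tau>' permutes A" unfolding \<tau>'_def using a by (intro permutes_swap_id)
  have \<tau>D: "\<tau> permutes D" using \<tau> by (rule permutes_subset) auto
  have \<alpha>\<tau>: "\<alpha> \<circ> \<tau> = \<tau>' \<circ> \<alpha>"
  proof
    fix y
    have "y = \<alpha> a \<longleftrightarrow> \<alpha> y = a" "y = \<alpha> a' \<longleftrightarrow> \<alpha> y = a'"
      using inv a A permutes_inj[OF \<alpha>p] by (metis injD subset_iff)+
    thus "(\<alpha> \<circ> \<tau>) y = (\<tau>' \<circ> \<alpha>) y"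
      using inv a A by (auto simp: \<tau>_def \<tau>'_def transpose_def)
  qed
  have cyc: "card (cycles_on ((p \<circ> \<tau>') \<circ> (\<tau> \<circ> q) \<circ> \<alpha>) D) = card (cycles_on (p \<circ> q \<circ> \<alpha>) D)"
    if p: "p permutes A" and q: "q permutes D - A" for p q
  proof (rule card_cycles_on_conj_perm)
    have "p \<circ> q permutes A \<union> (D - A)" using comp_permutes_disjoint(1)[OF p q] by blast
    moreover have "A \<union> (D - A) = D" using A by blast
    ultimately show "p \<circ> q \<circ> \<alpha> permutes D" using permutes_compose[OF \<alpha>p] by metis
    have 1: "\<tau> \<circ> p = p \<circ> \<tau>" and 2: "q \<circ> \<tau>' = \<tau>' \<circ> q" and 3: "\<tau> \<circ> \<tau>' = \<tau>' \<circ> \<tau>"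
      using permutes_commute[OF \<tau> p] permutes_commute[OF q \<tau>'] permutes_commute[OF \<tau> \<tau>'] by blast+
    have "p \<circ> \<tau>' \<circ> (\<tau> \<circ> q) \<circ> \<alpha> \<circ> \<tau> = p \<circ> \<tau>' \<circ> \<tau> \<circ> q \<circ> (\<alpha> \<circ> \<tau>)" by (simp add: o_assoc)
    also have "\<dots> = p \<circ> \<tau>' \<circ> \<tau> \<circ> (q \<circ> \<tau>') \<circ> \<alpha>" unfolding \<alpha>\<tau> by (simp add: o_assoc)
    also have "\<dots> = p \<circ> \<tau>' \<circ> (\<tau> \<circ> \<tau>') \<circ> q \<circ> \<alpha>" unfolding 2 by (simp add: o_assoc)
    also have "\<dots> = p \<circ> (\<tau>' \<circ> \<tau>') \<circ> \<tau> \<circ> q \<circ> \<alpha>" unfolding 3 by (simp add: o_assoc)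
    also have "\<dots> = \<tau> \<circ> (p \<circ> q \<circ> \<alpha>)" by (simp add: \<tau>'_def o_assoc 1)
    finally show "\<tau> \<circ> (p \<circ> q \<circ> \<alpha>) = p \<circ> \<tau>' \<circ> (\<tau> \<circ> q) \<circ> \<alpha> \<circ> \<tau>" by simp
  qed (use D \<tau>D in auto)
  have sgn: "(-1) ^ card (cycles_on (p \<circ> \<tau>') A) = - ((-1 :: real) ^ card (cycles_on p A))"
    if p: "p permutes A" for p
  proof -
    have fA: "finite A" using A D finite_subset by blast
    have "permutation p" "permutation \<tau>'" using p \<tau>' fA permutation_permutes by blast+
    hence "sign (p \<circ> \<tau>') = - sign p" using a(3) by (simp add: sign_compose \<tau>'_def sign_swap_id)
    hence "(-1) ^ card (cycles_on (p \<circ> \<tau>') A) = - ((-1) ^ card (cycles_on p A) :: int)"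
      using sign_cycles[OF fA p] sign_cycles[OF fA permutes_compose[OF \<tau>' p]] by simp
    hence "real_of_int ((-1) ^ card (cycles_on (p \<circ> \<tau>') A)) = real_of_int (- ((-1) ^ card (cycles_on p A)))"
      by simp
    thus ?thesis by simp
  qed
  have "split_sum \<alpha> D x A = (\<Sum>p | p permutes A. \<Sum>q | q permutes D - A.
     (-1) ^ card (cycles_on (p \<circ> \<tau>') A) * x ^ card (cycles_on ((p \<circ> \<tau>') \<circ> (\<tau> \<circ> q) \<circ> \<alpha>) D))"
    unfolding split_sum_def
    by (subst sum_permutations_compose_right[OF \<tau>'], subst setum_permutations_compose_left[OF \<tau>]) simp
  also have "\<dots> = - split_sum \<alpha> D x A"
    unfolding split_sum_def sum_negf[symmetric]
    by (intro sum.cong refl) (simp add: cyc sgn)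
  finally show ?thesis by simp
qed

text \<open>By parity, \<open>(-1)\<close> to the number of cycles of \<open>p\<close> is
  \<open>sign \<alpha>\<close> times the same expression for \<open>p \<circ> \<alpha>\<close>. Sign
  and power of \<open>x\<close> then combine to a power of \<open>- x\<close>, the double sum
  factors, and multiplication by \<open>\<alpha>\<close> or \<open>\<beta>\<close> merely permutes
  the range of summation.\<close>

lemma sum_signed_cycles_factor:
  fixes x :: real
  assumes "finite A" "finite B" "A \<inter> B = {}" and \<alpha>: "\<alpha> permutes A" and \<beta>: "\<beta> permutes B"
  shows "(\<Sum>p | p permutes A. \<Sum>q | q permutes B.
       (-1) ^ card (cycles_on p A) * x ^ card (cycles_on ((p \<circ> \<alpha>) \<circ> (q \<circ> \<beta>)) (A \<union> B))) =
    sign \<alpha> * pochhammer (- x) (card A) * pochhammer x (card B)"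
proof -
  have sgn: "(-1) ^ card (cycles_on p A) = real_of_int (sign \<alpha>) * (-1) ^ card (cycles_on (p \<circ> \<alpha>) A)"
    if p: "p permutes A" for p
  proof -
    have "permutation p" "permutation \<alpha>" using p \<alpha> assms(1) permutation_permutes by blast+
    hence "sign (p \<circ> \<alpha>) = sign p * sign \<alpha>" by (simp add: sign_compose)
    hence "(-1) ^ card (cycles_on p A) = sign \<alpha> * (-1) ^ card (cycles_on (p \<circ> \<alpha>) A)"
      using sign_cycles[OF assms(1) p] sign_cycles[OF assms(1) permutes_compose[OF \<alpha> p]]
      by (simp add: algebra_simps)
    hence "real_of_int ((-1) ^ card (cycles_on p A)) = real_of_int (sign \<alpha> * (-1) ^ card (cycles_on (p \<circ> \<alpha>) A))"
      by simp
    thus ?thesis by simp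
  qed
  have "(\<Sum>p | p permutes A. \<Sum>q | q permutes B.
       (-1) ^ card (cycles_on p A) * x ^ card (cycles_on ((p \<circ> \<alpha>) \<circ> (q \<circ> \<beta>)) (A \<union> B))) =
      (\<Sum>p | p permutes A. \<Sum>q | q permutes B.
       sign \<alpha> * ((- x) ^ card (cycles_on (p \<circ> \<alpha>) A) * x ^ card (cycles_on (q \<circ> \<beta>) B)))"
  proof (intro sum.cong refl)
    fix p q assume p: "p \<in> {p. p permutes A}" and q: "q \<in> {q. q permutes B}"
    have "card (cycles_on ((p \<circ> \<alpha>) \<circ> (q \<circ> \<beta>)) (A \<union> B)) =
        card (cycles_on (p \<circ> \<alpha>) A) + card (cycles_on (q \<circ> \<beta>) B)"
      using p q assms by (intro card_cycles_on_Un permutes_compose) auto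
    thus "(-1) ^ card (cycles_on p A) * x ^ card (cycles_on ((p \<circ> \<alpha>) \<circ> (q \<circ> \<beta>)) (A \<union> B)) =
       sign \<alpha> * ((- x) ^ card (cycles_on (p \<circ> \<alpha>) A) * x ^ card (cycles_on (q \<circ> \<beta>) B))"
      using sgn p by (simp add: power_add power_minus[of x])
  qed
  also have "\<dots> = sign \<alpha> * ((\<Sum>p | p permutes A. (- x) ^ card (cycles_on (p \<circ> \<alpha>) A)) *
      (\<Sum>q | q permutes B. x ^ card (cycles_on (q \<circ> \<beta>) B)))"
    by (subst sum_product) (simp only: sum_distrib_left)
  also have "(\<Sum>p | p permutes A. (- x) ^ card (cycles_on (p \<circ> \<alpha>) A)) = pochhammer (- x) (card A)"
    using sum_cycles_power[OF assms(1), of "- x"]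
      sum_permutations_compose_right[OF \<alpha>, of "\<lambda>p. (- x) ^ card (cycles_on p A)"] by simp
  also have "(\<Sum>q | q permutes B. x ^ card (cycles_on (q \<circ> \<beta>) B)) = pochhammer x (card B)"
    using sum_cycles_power[OF assms(2), of x]
      sum_permutations_compose_right[OF \<beta>, of "\<lambda>p. x ^ card (cycles_on p B)"] by simp
  finally show ?thesis by (simp only: mult.assoc)
qed


section \<open>The Harer--Zagier polynomials\<close>

text \<open>
  The polynomial \<open>p\<close> in \<open>u\<close> stands for the form \<open>\<Sum> p\<^sub>i u\<^sup>i w\<^bsup>d-i\<^esup>\<close> of degree \<open>d\<close>, and \<open>Phi\<close> is the umbral map
  sending powers of \<open>u\<close> and \<open>w\<close> to rising factorials of \<open>-x\<close> and \<open>x\<close>. Its virtue is that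
  multiplication by \<open>w + u\<close> becomes multiplication by the degree.
\<close>

definition Phi :: "real \<Rightarrow> nat \<Rightarrow> real poly \<Rightarrow> real" where
  "Phi x d p = (\<Sum>i\<le>d. coeff p i * (pochhammer (- x) i * pochhammer x (d - i)))"

lemma Phi_add: "Phi x d (p + q) = Phi x d p + Phi x d q"
  and Phi_diff: "Phi x d (p - q) = Phi x d p - Phi x d q"
  and Phi_smult: "Phi x d (smult c p) = c * Phi x d p"
  by (simp_all add: Phi_def sum.distrib sum_subtractf sum_distrib_left algebra_simps)

lemma Phi_numeral: "Phi x d (numeral k * p) = numeral k * Phi x d p"
  using Phi_smult[of x d "numeral k" p] by (simp add: numeral_poly)

lemma Phi_sum: "Phi x d (\<Sum>i\<in>I. f i) = (\<Sum>i\<in>I. Phi x d (f i))"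
  by (simp add: Phi_def coeff_sum sum_distrib_right sum.swap[of _ I])

lemma Phi_monom:
  assumes "i \<le> d"
  shows "Phi x d (monom c i) = c * (pochhammer (- x) i * pochhammer x (d - i))"
proof -
  have "Phi x d (monom c i) =
      (\<Sum>j\<le>d. if j = i then c * (pochhammer (- x) i * pochhammer x (d - i)) else 0)"
    unfolding Phi_def by (intro sum.cong refl) auto
  thus ?thesis using assms by simp
qed

lemma Phi_Suc:
  assumes "degree p \<le> d"
  shows "Phi x (Suc d) p = (\<Sum>i\<le>d. coeff p i * (pochhammer (- x) i * pochhammer x (d - i)) * (x + real d - real i))"
    and "Phi x (Suc d) (pCons 0 p) =
      (\<Sum>i\<le>d. coeff p i * (pochhammer (- x) i * pochhammer x (d - i)) * (real i - x))"
proof -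
  have "coeff p (Suc d) = 0" using assms by (intro coeff_eq_0) simp
  hence "Phi x (Suc d) p = (\<Sum>i\<le>d. coeff p i * (pochhammer (- x) i * pochhammer x (Suc d - i)))"
    by (simp add: Phi_def)
  also have "\<dots> = (\<Sum>i\<le>d. coeff p i * (pochhammer (- x) i * pochhammer x (d - i)) * (x + real d - real i))"
    by (intro sum.cong refl) (simp add: Suc_diff_le pochhammer_Suc of_nat_diff algebra_simps)
  finally show "Phi x (Suc d) p = (\<Sum>i\<le>d. coeff p i * (pochhammer (- x) i * pochhammer x (d - i)) * (x + real d - real i))" .
  have "Phi x (Suc d) (pCons 0 p) = (\<Sum>i\<le>d. coeff p i * (pochhammer (- x) (Suc i) * pochhammer x (d - i)))"
    unfolding Phi_def by (subst sum.atMost_Suc_shift) simp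
  also have "\<dots> = (\<Sum>i\<le>d. coeff p i * (pochhammer (- x) i * pochhammer x (d - i)) * (real i - x))"
    by (intro sum.cong refl) (simp add: pochhammer_Suc algebra_simps)
  finally show "Phi x (Suc d) (pCons 0 p) =
      (\<Sum>i\<le>d. coeff p i * (pochhammer (- x) i * pochhammer x (d - i)) * (real i - x))" .
qed

text \<open>Raising the degree by \<open>w\<close> or by \<open>u\<close> adds the last factor
  \<open>x + d - i\<close> or \<open>i - x\<close> to a rising factorial; their sum is
  \<open>d\<close>, independently of \<open>i\<close>.\<close>

lemma Phi_one_plus:
  assumes "degree p \<le> d"
  shows "Phi x (Suc d) ([:1, 1:] * p) = real d * Phi x d p"
proof -
  have "[:1, 1:] * p = p + pCons 0 p" by simp
  hence "Phi x (Suc d) ([:1, 1:] * p) = Phi x (Suc d) p + Phi x (Suc d) (pCons 0 p)"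
    by (simp add: Phi_add)
  also have "\<dots> = (\<Sum>i\<le>d. real d * (coeff p i * (pochhammer (- x) i * pochhammer x (d - i))))"
    unfolding Phi_Suc[OF assms] sum.distrib[symmetric]
    by (intro sum.cong refl) (simp add: algebra_simps)
  also have "\<dots> = real d * Phi x d p" by (simp add: Phi_def sum_distrib_left)
  finally show ?thesis .
qed

text \<open>Here the two new factors differ by \<open>2 x + d - 2 i\<close>. The index
  \<open>i\<close> is produced by the operator \<open>u d/du\<close>, which explains
  \<open>pCons 0 (pderiv p)\<close>.\<close>

lemma Phi_one_minus:
  assumes "degree p \<le> d"
  shows "Phi x (Suc d) ([:1, -1:] * p) =
    2 * x * Phi x d p + Phi x d (smult (real d) p - smult 2 (pCons 0 (pderiv p)))"
proof -
  have coeff_pderiv': "coeff (pCons 0 (pderiv p)) i = real i * coeff p i" for i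
    by (cases i) (simp_all add: coeff_pderiv)
  have "[:1, -1:] * p = p - pCons 0 p" by simp
  hence "Phi x (Suc d) ([:1, -1:] * p) = Phi x (Suc d) p - Phi x (Suc d) (pCons 0 p)"
    by (simp only: Phi_diff)
  also have "\<dots> = (\<Sum>i\<le>d. 2 * x * (coeff p i * (pochhammer (- x) i * pochhammer x (d - i))) +
      (real d * coeff p i - 2 * (real i * coeff p i)) * (pochhammer (- x) i * pochhammer x (d - i)))"
    unfolding Phi_Suc[OF assms] sum_subtractf[symmetric]
    by (intro sum.cong refl) (simp add: algebra_simps)
  also have "\<dots> = 2 * x * Phi x d p + Phi x d (smult (real d) p - smult 2 (pCons 0 (pderiv p)))"
    unfolding Phi_def sum.distrib sum_distrib_left coeff_diff coeff_smult coeff_pderiv' by simp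
  finally show ?thesis .
qed

text \<open>This is \<open>m!\<close> times the coefficient of \<open>y\<^sup>m\<close> in \<open>((1 + y) / (1 - y))\<^sup>x\<close>.\<close>

definition hz_poly :: "real \<Rightarrow> nat \<Rightarrow> real" where
  "hz_poly x m = Phi x m ([:1, -1:] ^ m)"

lemma hz_poly_0 [simp]: "hz_poly x 0 = 1"
  by (simp add: hz_poly_def Phi_def)

lemma hz_poly_1 [simp]: "hz_poly x (Suc 0) = 2 * x"
  by (simp add: hz_poly_def Phi_def)

lemma degree_linear_power_le: "degree ([:a, b:] ^ m :: real poly) \<le> m"
  using degree_power_le[of "[:a, b:]" m] by (auto intro: order_trans split: if_splits)

text \<open>This is \<open>(1 - y^2) f' = 2 x f\<close> on coefficients. With
  \<open>r = w - u\<close> and \<open>d = m + 1\<close>, the correction term of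
  \<open>Phi_one_minus\<close> is \<open>d r^d + 2 d u r^(d-1) = d r^(d-1) (r + 2 u)\<close>, and
  \<open>r + 2 u = w + u\<close> is removed by \<open>Phi_one_plus\<close>.\<close>

lemma hz_poly_rec:
  "hz_poly x (Suc (Suc m)) = 2 * x * hz_poly x (Suc m) + real (Suc m) * real m * hz_poly x m"
proof -
  let ?r = "[:1, -1:] :: real poly"
  have "smult (real (Suc m)) (?r ^ Suc m) - smult 2 (pCons 0 (pderiv (?r ^ Suc m))) =
      smult (real (Suc m)) ([:1, 1:] * ?r ^ m)"
  proof -
    have 1: "?r ^ Suc m = ?r ^ m - pCons 0 (?r ^ m)" and 2: "[:1, 1:] * ?r ^ m = ?r ^ m + pCons 0 (?r ^ m)"
      by simp_all
    have "pderiv (?r ^ Suc m) = smult (- real (Suc m)) (?r ^ m)"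
      unfolding pderiv_power_Suc by (simp add: pderiv_pCons)
    hence 3: "pCons 0 (pderiv (?r ^ Suc m)) = smult (- real (Suc m)) (pCons 0 (?r ^ m))"
      by simp
    show ?thesis
      unfolding 2 3 unfolding 1
      by (rule poly_eqI) (simp add: coeff_pCons algebra_simps split: nat.split)
  qed
  hence "hz_poly x (Suc (Suc m)) = 2 * x * hz_poly x (Suc m) +
      Phi x (Suc m) (smult (real (Suc m)) ([:1, 1:] * ?r ^ m))"
    using Phi_one_minus[OF degree_linear_power_le, of x "Suc m" 1 "-1"]
    unfolding hz_poly_def power_Suc[of ?r "Suc m"] by simp
  thus ?thesis
    using Phi_one_plus[OF degree_linear_power_le, of x m 1 "-1"] 
    unfolding Phi_smult hz_poly_def by simp
qed

text \<open>The factors \<open>w + u\<close> are peeled off one at a time; each contributes the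
  degree of what remains, which gives \<open>b\<close>, \<open>b + 1\<close>, up to
  \<open>b + a - 1\<close>.\<close>

lemma Phi_mixed:
  "Phi x (a + b) ([:1, 1:] ^ a * [:1, -1:] ^ b) = pochhammer (real b) a * hz_poly x b"
proof (induction a)
  case 0
  then show ?case by (simp add: hz_poly_def)
next
  case (Suc a)
  have "degree ([:1, 1:] ^ a * [:1, -1:] ^ b :: real poly) \<le> a + b"
    by (intro order_trans[OF degree_mult_le] add_mono degree_linear_power_le)
  from Phi_one_plus[OF this, of x] Suc show ?case
    by (simp add: pochhammer_Suc mult.assoc del: mult_pCons_left)
qed

text \<open>The right-hand side is the shape of a sum over unions of \<open>i\<close> out of
  \<open>k\<close> edges, each edge contributing two darts and a sign, with \<open>e\<close>
  counting an extra dart on a crossing edge. The left-hand side is the form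
  \<open>u^e (w^2 - u^2)^k\<close>, filled up by powers of \<open>w\<close> to degree
  \<open>d\<close>.\<close>

lemma Phi_binomial:
  assumes "2 * k + e \<le> d"
  shows "Phi x d (monom 1 e * ([:1, 1:] * [:1, -1:]) ^ k) =
    (\<Sum>i\<le>k. real (k choose i) * ((-1) ^ i *
       (pochhammer (- x) (2 * i + e) * pochhammer x (d - (2 * i + e)))))"
proof -
  have "[:1, 1:] * [:1, -1:] = monom (-1 :: real) 2 + 1"
    by (simp add: monom_altdef numeral_2_eq_2 one_pCons)
  hence "monom 1 e * ([:1, 1:] * [:1, -1:] :: real poly) ^ k =
      monom 1 e * (\<Sum>i\<le>k. of_nat (k choose i) * monom (-1) 2 ^ i * 1 ^ (k - i))"
    by (simp only: binomial_ring)
  also have "\<dots> = (\<Sum>i\<le>k. monom (real (k choose i) * (-1) ^ i) (2 * i + e))"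
    by (simp add: sum_distrib_left monom_power of_nat_monom mult_monom algebra_simps)
  finally have "Phi x d (monom 1 e * ([:1, 1:] * [:1, -1:]) ^ k) =
     (\<Sum>i\<le>k. Phi x d (monom (real (k choose i) * (-1) ^ i) (2 * i + e)))"
    by (simp only: Phi_sum)
  also have "\<dots> = (\<Sum>i\<le>k. real (k choose i) * ((-1) ^ i *
       (pochhammer (- x) (2 * i + e) * pochhammer x (d - (2 * i + e)))))"
    using assms by (intro sum.cong refl) (subst Phi_monom, auto)
  finally show ?thesis .
qed

lemma pochhammer_of_nat_Suc: "pochhammer (real (Suc b)) a = fact (a + b) / fact b"
proof (induction a)
  case (Suc a)
  have "pochhammer (real (Suc b)) (Suc a) = fact (a + b) / fact b * (real (Suc b) + real a)"
    by (simp only: pochhammer_Suc Suc)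
  also have "\<dots> = fact (Suc a + b) / fact b" by (simp add: algebra_simps)
  finally show ?case .
qed simp

text \<open>The three terms come from the sets without crossing edge, from those crossed by the edge
  of \<open>d\<close> only, and from those crossed by one of the other edges. With
  \<open>w = 1\<close>, both \<open>w\<close> and \<open>u\<close> are half the sum or difference of
  \<open>[:1, 1:]\<close> and \<open>[:1, -1:]\<close>, so everything becomes a combination of
  products covered by \<open>Phi_mixed\<close>.\<close>

lemma hz_sum_identity:
  assumes "n \<ge> 1"
  shows "x * Phi x (2 * n) (([:1, 1:] * [:1, -1:]) ^ (n - 1)) +
      Phi x (2 * n) (monom 1 1 * ([:1, 1:] * [:1, -1:]) ^ (n - 1)) +
      real (2 * n - 2) * Phi x (2 * n) (monom 1 1 * ([:1, 1:] * [:1, -1:]) ^ (n - 2)) =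
    x * (fact (2 * n - 1) / (2 * fact (n + 1)) * hz_poly x (n + 1))"
proof (cases "n = 1")
  \<comment> \<open>The coefficient \<open>2 * n - 2\<close> vanishes here, so the truncated
    exponent \<open>n - 2\<close> does no harm.\<close>
  case True
  have "Phi x 2 1 = x * (x + 1)" "Phi x 2 (monom 1 1) = - x * x"
    using Phi_monom[of 0 2 x 1] Phi_monom[of 1 2 x 1]
    by (simp_all add: numeral_2_eq_2 pochhammer_Suc flip: one_poly_eq_simps(1))
  thus ?thesis using True by (simp add: numeral_2_eq_2 hz_poly_rec algebra_simps)
next
  case False
  then obtain k where k: "n = k + 2" using assms by (metis add.commute le_Suc_ex One_nat_def Suc_1 Suc_leI le_neq_implies_less)
  define s where "s = ([:1, 1:] :: real poly)"
  define r where "r = ([:1, -1:] :: real poly)"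
  define u where "u = (monom 1 1 :: real poly)"
  define W where "W = (\<lambda>a b. Phi x (a + b) (s ^ a * r ^ b))"
  have sr: "s + r = 2" and su: "s - r = 2 * u"
    by (simp_all add: s_def r_def u_def monom_altdef numeral_poly)
  have "Phi x (2 * n) (s ^ a * r ^ b) = W a b" if "a + b = 2 * n" for a b
    using that by (simp add: W_def)
  from this[of "k+3" "k+1"] this[of "k+2" "k+2"] this[of "k+1" "k+3"] this[of "k+4" k] this[of k "k+4"]
  have WW: "Phi x (2 * n) (s ^ (k+3) * r ^ (k+1)) = W (k+3) (k+1)"
    "Phi x (2 * n) (s ^ (k+2) * r ^ (k+2)) = W (k+2) (k+2)"
    "Phi x (2 * n) (s ^ (k+1) * r ^ (k+3)) = W (k+1) (k+3)"
    "Phi x (2 * n) (s ^ (k+4) * r ^ k) = W (k+4) k"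
    "Phi x (2 * n) (s ^ k * r ^ (k+4)) = W k (k+4)"
    unfolding k by simp_all
  have four: "(4 :: real poly) = 2 * 2" and sixteen: "(16 :: real poly) = 2 * (2 * (2 * 2))"
    by (simp_all add: numeral_poly)
  \<comment> \<open>As \<open>s + r = 2\<close>, the factor \<open>(s + r)^2\<close> raises the
    degree from \<open>2 * n - 2\<close> to \<open>2 * n\<close> at the cost of the constant
    4.\<close>
  have "4 * (s * r) ^ (k + 1) = (s + r)\<^sup>2 * (s * r) ^ (k + 1)" using sr by simp
  also have "\<dots> = s ^ (k+3) * r ^ (k+1) + 2 * (s ^ (k+2) * r ^ (k+2)) + s ^ (k+1) * r ^ (k+3)"
    by (simp add: power2_eq_square power_mult_distrib power_add eval_nat_numeral algebra_simps)
  finally have "Phi x (2 * n) (4 * ((s * r) ^ (k + 1))) =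
      Phi x (2 * n) (s ^ (k+3) * r ^ (k+1) + 2 * (s ^ (k+2) * r ^ (k+2)) + s ^ (k+1) * r ^ (k+3))"
    by (simp only:)
  hence 1: "4 * Phi x (2 * n) ((s * r) ^ (k + 1)) = W (k+3) (k+1) + 2 * W (k+2) (k+2) + W (k+1) (k+3)"
    by (simp only: Phi_numeral Phi_add Phi_diff WW)
  have "4 * (u * (s * r) ^ (k + 1)) = (2 * u) * 2 * (s * r) ^ (k + 1)"
    unfolding four by (simp only: mult.assoc mult.commute mult.left_commute)
  also have "\<dots> = (s - r) * (s + r) * (s * r) ^ (k + 1)"
    by (simp only: su sr)
  also have "\<dots> = s ^ (k+3) * r ^ (k+1) - s ^ (k+1) * r ^ (k+3)"
    by (simp add: power2_eq_square power_mult_distrib power_add eval_nat_numeral algebra_simps)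
  finally have "Phi x (2 * n) (4 * (u * (s * r) ^ (k + 1))) =
      Phi x (2 * n) (s ^ (k+3) * r ^ (k+1) - s ^ (k+1) * r ^ (k+3))"
    by (simp only:)
  hence 2: "4 * Phi x (2 * n) (u * (s * r) ^ (k + 1)) = W (k+3) (k+1) - W (k+1) (k+3)"
    by (simp only: Phi_numeral Phi_add Phi_diff WW)
  \<comment> \<open>The degree \<open>2 * n\<close> is reached by \<open>2 u = s - r\<close> and
    three factors \<open>s + r = 2\<close>, hence the constant 16.\<close>
  have "16 * (u * (s * r) ^ k) = (2 * u) * 2 * 2 * 2 * (s * r) ^ k"
    unfolding sixteen by (simp only: mult.assoc mult.commute mult.left_commute)
  also have "\<dots> = (s - r) * (s + r) * (s + r) * (s + r) * (s * r) ^ k"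
    by (simp only: su sr)
  also have "\<dots> = s ^ (k+4) * r ^ k + 2 * (s ^ (k+3) * r ^ (k+1)) -
      2 * (s ^ (k+1) * r ^ (k+3)) - s ^ k * r ^ (k+4)"
    by (simp add: power2_eq_square power_mult_distrib power_add eval_nat_numeral algebra_simps)
  finally have "Phi x (2 * n) (16 * (u * (s * r) ^ k)) =
      Phi x (2 * n) (s ^ (k+4) * r ^ k + 2 * (s ^ (k+3) * r ^ (k+1)) -
      2 * (s ^ (k+1) * r ^ (k+3)) - s ^ k * r ^ (k+4))"
    by (simp only:)
  hence 3: "16 * Phi x (2 * n) (u * (s * r) ^ k) =
      W (k+4) k + 2 * W (k+3) (k+1) - 2 * W (k+1) (k+3) - W k (k+4)"
    by (simp only: Phi_numeral Phi_add Phi_diff WW)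
  define A where "A = hz_poly x k"
  define B where "B = hz_poly x (k+1)"
  define F :: real where "F = fact (2 * k + 3) / fact k"
  have H2: "hz_poly x (k+2) = 2 * x * B + real (k+1) * real k * A"
    using hz_poly_rec[of x k] by (simp add: A_def B_def)
  have H3: "hz_poly x (k+3) = 2 * x * hz_poly x (k+2) + real (k+2) * real (k+1) * B"
    using hz_poly_rec[of x "k+1"] by (simp add: B_def numeral_3_eq_3)
  have H4: "hz_poly x (k+4) = 2 * x * hz_poly x (k+3) + real (k+3) * real (k+2) * hz_poly x (k+2)"
    using hz_poly_rec[of x "k+2"] by (simp add: eval_nat_numeral)
  \<comment> \<open>The rising factorial starts at \<open>k\<close>, one factor before those of
    \<open>F\<close>. It vanishes for \<open>k = 0\<close>, where the quotient of factorials has no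
    meaning.\<close>
  have W0: "W (k+4) k = real k * F * A"
  proof (cases k)
    case 0
    then show ?thesis by (simp add: W_def s_def r_def Phi_mixed pochhammer_0_left)
  next
    case (Suc j)
    then show ?thesis
      using Phi_mixed[of x "k+4" k] pochhammer_of_nat_Suc[of j "k+4"]
      by (simp add: W_def s_def r_def F_def A_def eval_nat_numeral del: of_nat_Suc)
  qed
  define K where "K = real k"
  have K: "K + 1 \<noteq> 0" "K + 2 \<noteq> 0" "K + 3 \<noteq> 0" unfolding K_def by linarith+
  have P: "pochhammer (real (b + 1)) a = F * (fact k / fact b)" if "a + b = 2 * k + 3" for a b
    using pochhammer_of_nat_Suc[of b a] that by (simp add: F_def)
  have fact: "fact (k + 1) = (K + 1) * fact k" "fact (k + 2) = (K + 1) * (K + 2) * fact k"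
      "fact (k + 3) = (K + 1) * (K + 2) * (K + 3) * fact k"
    by (simp_all add: K_def numeral_3_eq_3 numeral_2_eq_2 algebra_simps)
  have R: "fact k / fact (k + 1) = 1 / (K + 1)" "fact k / fact (k + 2) = 1 / ((K + 1) * (K + 2))"
      "fact k / fact (k + 3) = 1 / ((K + 1) * (K + 2) * (K + 3))"
    unfolding fact by simp_all
  have "pochhammer (real (k + 1)) (k + 3) = F"
    using P[of "k + 3" k] by simp
  hence W1: "W (k+3) (k+1) = F * B"
    by (simp only: W_def s_def r_def Phi_mixed B_def)
  have "pochhammer (real (k + 1 + 1)) (k + 2) = F * (fact k / fact (k + 1))"
    by (rule P) simp
  hence "pochhammer (real (k + 1 + 1)) (k + 2) = F / (K + 1)" by (simp only: R times_divide_eq_right mult_1_right)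
  hence "pochhammer (real (k + 2)) (k + 2) = F / (K + 1)" by (simp only: add.assoc one_add_one)
  hence W2: "W (k+2) (k+2) = F * (hz_poly x (k+2) / (K + 1))"
    by (simp only: W_def s_def r_def Phi_mixed times_divide_eq_left times_divide_eq_right)
  have "pochhammer (real (k + 2 + 1)) (k + 1) = F * (fact k / fact (k + 2))"
    by (rule P) simp
  hence "pochhammer (real (k + 2 + 1)) (k + 1) = F / ((K + 1) * (K + 2))" by (simp only: R times_divide_eq_right mult_1_right)
  moreover have "k + 2 + 1 = k + 3" by simp
  ultimately have "pochhammer (real (k + 3)) (k + 1) = F / ((K + 1) * (K + 2))" by metis
  hence W3: "W (k+1) (k+3) = F * (hz_poly x (k+3) / ((K + 1) * (K + 2)))"
    by (simp only: W_def s_def r_def Phi_mixed times_divide_eq_left times_divide_eq_right)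
  have "pochhammer (real (k + 3 + 1)) k = F * (fact k / fact (k + 3))"
    by (rule P) simp
  hence "pochhammer (real (k + 3 + 1)) k = F / ((K + 1) * (K + 2) * (K + 3))" by (simp only: R times_divide_eq_right mult_1_right)
  moreover have "k + 3 + 1 = k + 4" by simp
  ultimately have "pochhammer (real (k + 4)) k = F / ((K + 1) * (K + 2) * (K + 3))" by metis
  hence W4: "W k (k+4) = F * (hz_poly x (k+4) / ((K + 1) * (K + 2) * (K + 3)))"
    by (simp only: W_def s_def r_def Phi_mixed times_divide_eq_left times_divide_eq_right)
  have "x * Phi x (2 * n) ((s * r) ^ (k + 1)) + Phi x (2 * n) (u * (s * r) ^ (k + 1)) +
      2 * (K + 1) * Phi x (2 * n) (u * (s * r) ^ k) =
    x * (W (k+3) (k+1) + 2 * W (k+2) (k+2) + W (k+1) (k+3)) / 4 + (W (k+3) (k+1) - W (k+1) (k+3)) / 4 +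
      2 * (K + 1) * (W (k+4) k + 2 * W (k+3) (k+1) - 2 * W (k+1) (k+3) - W k (k+4)) / 16"
    unfolding 1[symmetric] 2[symmetric] 3[symmetric] by simp
  also have "\<dots> = F * (x * (B + 2 * (hz_poly x (k+2) / (K + 1)) + hz_poly x (k+3) / ((K + 1) * (K + 2))) / 4 +
      (B - hz_poly x (k+3) / ((K + 1) * (K + 2))) / 4 +
      2 * (K + 1) * (K * A + 2 * B - 2 * (hz_poly x (k+3) / ((K + 1) * (K + 2))) -
        hz_poly x (k+4) / ((K + 1) * (K + 2) * (K + 3))) / 16)"
    unfolding W0 W1 W2 W3 W4 K_def[symmetric] by (simp add: algebra_simps)
  \<comment> \<open>By the recurrence all values of \<open>hz_poly\<close> are expressed through
    \<open>A\<close> and \<open>B\<close>; what remains is a rational identity in \<open>x\<close>,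
    \<open>K\<close>, \<open>A\<close> and \<open>B\<close>.\<close>
  also have "\<dots> = F * (x * hz_poly x (k+3) / (2 * (K + 1) * (K + 2) * (K + 3)))"
  proof -
    have H2': "hz_poly x (k+2) = 2 * x * B + (K + 1) * K * A" using H2 by (simp add: K_def algebra_simps)
    have H3': "hz_poly x (k+3) = 2 * x * hz_poly x (k+2) + (K + 2) * (K + 1) * B"
      using H3 by (simp add: K_def algebra_simps)
    have H4': "hz_poly x (k+4) = 2 * x * hz_poly x (k+3) + (K + 3) * (K + 2) * hz_poly x (k+2)"
      using H4 by (simp add: K_def algebra_simps)
    show ?thesis
      unfolding H4' unfolding H3' unfolding H2' using K by (simp add: divide_simps) algebra
  qed
  also have "\<dots> = x * (fact (2 * n - 1) / (2 * fact (n + 1)) * hz_poly x (n + 1))"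
  proof -
    have "2 * n - 1 = 2 * k + 3" "n + 1 = k + 3" using k by simp_all
    thus ?thesis unfolding F_def by (simp only: fact) (simp add: ac_simps, simp add: algebra_simps)
  qed
  finally have main: "x * Phi x (2 * n) ((s * r) ^ (k + 1)) + Phi x (2 * n) (u * (s * r) ^ (k + 1)) +
      2 * (K + 1) * Phi x (2 * n) (u * (s * r) ^ k) =
    x * (fact (2 * n - 1) / (2 * fact (n + 1)) * hz_poly x (n + 1))" .
  have "n - 1 = k + 1" "n - 2 = k" "real (2 * n - 2) = 2 * (K + 1)" using k by (simp_all add: K_def)
  thus ?thesis using main unfolding s_def r_def u_def by (simp only:)
qed


section \<open>Long cycles multiplied by a fixed-point free involution\<close>

lemma orbit_involution:
  assumes "\<alpha> (\<alpha> d) = d"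
  shows "orbit \<alpha> d = {d, \<alpha> d}"
proof
  show "orbit \<alpha> d \<subseteq> {d, \<alpha> d}"
  proof
    fix y assume "y \<in> orbit \<alpha> d" thus "y \<in> {d, \<alpha> d}" by induction (use assms in auto)
  qed
  show "{d, \<alpha> d} \<subseteq> orbit \<alpha> d"
    using orbit.base[of \<alpha> d] orbit.step[OF orbit.base[of \<alpha> d]] assms by simp
qed

lemma card_cycles_involution:
  assumes "finite Z" and Z: "\<And>d. d \<in> Z \<Longrightarrow> \<alpha> d \<in> Z \<and> \<alpha> d \<noteq> d \<and> \<alpha> (\<alpha> d) = d"
  shows "2 * card (cycles_on \<alpha> Z) = card Z"
proof -
  have cyc: "cycles_on \<alpha> Z = (\<lambda>d. {d, \<alpha> d}) ` Z"
    unfolding cycles_on_def by (intro image_cong refl orbit_involution) (use Z in auto)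
  have "\<Union> (cycles_on \<alpha> Z) = Z" using Z by (auto simp: cyc)
  moreover have "2 * card (cycles_on \<alpha> Z) = card (\<Union> (cycles_on \<alpha> Z))"
  proof (rule card_partition)
    show "finite (cycles_on \<alpha> Z)" by (simp add: cyc assms(1))
    show "finite (\<Union> (cycles_on \<alpha> Z))" by (simp add: cyc assms(1))
    fix c assume "c \<in> cycles_on \<alpha> Z"
    then obtain d where d: "d \<in> Z" "c = {d, \<alpha> d}" by (auto simp: cyc)
    hence "\<alpha> d \<noteq> d" using Z by blast
    thus "card c = 2" using d by auto
    fix c' assume "c' \<in> cycles_on \<alpha> Z" "c \<noteq> c'"
    then obtain d' where d': "d' \<in> Z" "c' = {d', \<alpha> d'}" by (auto simp: cyc)
    have "c = c'" if "e \<in> c" "e \<in> c'" for e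
    proof -
      have "c = {e, \<alpha> e}" using that(1) d Z[OF d(1)] by (auto simp: insert_commute)
      moreover have "c' = {e, \<alpha> e}" using that(2) d' Z[OF d'(1)] by (auto simp: insert_commute)
      ultimately show ?thesis by simp
    qed
    thus "c \<inter> c' = {}" using \<open>c \<noteq> c'\<close> by blast
  qed
  ultimately show ?thesis by simp
qed

lemma fpf_involutions_D:
  assumes "\<alpha> \<in> fpf_involutions D"
  shows "\<alpha> permutes D" "\<And>d. d \<in> D \<Longrightarrow> \<alpha> d \<in> D" "\<And>d. d \<in> D \<Longrightarrow> \<alpha> d \<noteq> d"
    "\<And>d. d \<in> D \<Longrightarrow> \<alpha> (\<alpha> d) = d"
proof -
  show "\<alpha> permutes D" using assms by (simp add: fpf_involutions_def)
  thus "\<alpha> d \<in> D" if "d \<in> D" for d using permutes_in_image that by metis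
qed (use assms in \<open>auto simp: fpf_involutions_def\<close>)

lemma card_cycles_invariant:
  assumes D: "finite D" and \<alpha>: "\<alpha> \<in> fpf_involutions D" and A: "A \<subseteq> D" "\<alpha> ` A = A"
  shows "2 * card (cycles_on \<alpha> A) = card A"
proof (rule card_cycles_involution)
  show "finite A" using A(1) D by (rule finite_subset)
  fix d assume d: "d \<in> A"
  hence "\<alpha> d \<in> A" using A(2) by blast
  moreover have "d \<in> D" using d A(1) by blast
  ultimately show "\<alpha> d \<in> A \<and> \<alpha> d \<noteq> d \<and> \<alpha> (\<alpha> d) = d" using fpf_involutions_D[OF \<alpha>] by blast
qed

lemma restrict_fpf_involution:
  assumes "\<alpha> \<in> fpf_involutions D" "A \<subseteq> D" "\<alpha> ` A = A"
  shows "restrict_id \<alpha> A \<in> fpf_involutions A"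
proof -
  have "restrict_id \<alpha> A permutes A"
    using restrict_id_comp(1) assms fpf_involutions_D(1) by metis
  moreover have "\<alpha> d \<in> A" if "d \<in> A" for d using assms(3) that by blast
  ultimately show ?thesis
    using assms(2) fpf_involutions_D[OF assms(1)] unfolding fpf_involutions_def by auto
qed

lemma sign_fpf_involution:
  assumes "finite A" "\<beta> \<in> fpf_involutions A" "card A = 2 * i"
  shows "sign \<beta> = (-1) ^ i"
proof -
  note \<beta> = fpf_involutions_D[OF assms(2)]
  have "2 * card (cycles_on \<beta> A) = card A"
    by (rule card_cycles_involution[OF assms(1)]) (use \<beta> in auto)
  thus ?thesis using sign_cycles[OF assms(1) \<beta>(1)] assms(3) by simp
qed

text \<open>Without crossing edges \<open>\<alpha>\<close> splits into an involution of
  \<open>A\<close> and one of the complement. The part on \<open>A\<close> commutes with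
  \<open>q\<close>, so the double sum factors; \<open>(-1) ^ i\<close> is the sign of a product of
  \<open>i\<close> disjoint transpositions.\<close>

lemma split_sum_0_boundary:
  assumes D: "finite D" and \<alpha>: "\<alpha> \<in> fpf_involutions D"
    and A: "A \<subseteq> D" "\<alpha> ` A = A" "card A = 2 * i"
  shows "split_sum \<alpha> D x A = (-1) ^ i * pochhammer (- x) (2 * i) * pochhammer x (card D - 2 * i)"
proof -
  define \<beta> where "\<beta> = restrict_id \<alpha> A"
  define \<gamma> where "\<gamma> = restrict_id \<alpha> (D - A)"
  note r = restrict_id_comp[OF fpf_involutions_D(1)[OF \<alpha>] A(1,2), folded \<beta>_def \<gamma>_def]
  have fA: "finite A" using A D finite_subset by blast
  have sgn: "sign \<beta> = (-1) ^ i"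
    using sign_fpf_involution[OF fA _ A(3)] restrict_fpf_involution[OF \<alpha> A(1,2)] by (simp add: \<beta>_def)
  have eq: "p \<circ> q \<circ> \<alpha> = (p \<circ> \<beta>) \<circ> (q \<circ> \<gamma>)" if "q permutes D - A" for p q
  proof -
    have "p \<circ> q \<circ> \<alpha> = p \<circ> (q \<circ> \<beta>) \<circ> \<gamma>" by (simp only: r(3)[symmetric] o_assoc)
    also have "q \<circ> \<beta> = \<beta> \<circ> q" using permutes_commute[OF that r(1)] by blast
    finally show ?thesis by (simp only: o_assoc)
  qed
  have un: "A \<union> (D - A) = D" using A by blast
  have "split_sum \<alpha> D x A = (\<Sum>p | p permutes A. \<Sum>q | q permutes D - A.
       (-1) ^ card (cycles_on p A) * x ^ card (cycles_on ((p \<circ> \<beta>) \<circ> (q \<circ> \<gamma>)) (A \<union> (D - A))))"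
    unfolding split_sum_def by (intro sum.cong refl) (simp only: mem_Collect_eq eq un)
  also have "\<dots> = sign \<beta> * pochhammer (- x) (card A) * pochhammer x (card (D - A))"
    using D fA r by (intro sum_signed_cycles_factor) auto
  finally show ?thesis using A D fA by (simp add: card_Diff_subset sgn)
qed

text \<open>Apart from the transposition of \<open>a\<close> and \<open>\<alpha> a\<close>, the
  involution splits along \<open>insert a A\<close> and its complement. That transposition joins two
  cycles lying on different sides, so one cycle is lost; the factor \<open>x\<close> restores
  it.\<close>

lemma split_sum_1_boundary:
  assumes D: "finite D" and \<alpha>: "\<alpha> \<in> fpf_involutions D" and a: "a \<in> D"
    and A: "A \<subseteq> D - {a, \<alpha> a}" "\<alpha> ` A = A" "card A = 2 * i"
  shows "x * split_sum \<alpha> D x (insert a A) =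
    (-1) ^ i * pochhammer (- x) (2 * i + 1) * pochhammer x (card D - (2 * i + 1))"
proof -
  define b where "b = \<alpha> a"
  define D' where "D' = D - {a, b}"
  define \<alpha>' where "\<alpha>' = restrict_id \<alpha> D'"
  define \<beta> where "\<beta> = restrict_id \<alpha>' A"
  define \<gamma> where "\<gamma> = restrict_id \<alpha>' (D' - A)"
  define B where "B = insert a A"
  note \<alpha>D = fpf_involutions_D[OF \<alpha>]
  have b: "b \<in> D" "b \<noteq> a" "\<alpha> b = a" using \<alpha>D a by (auto simp: b_def)
  have "\<alpha> ` D' = \<alpha> ` D - \<alpha> ` {a, b}"
    unfolding D'_def by (rule image_set_diff[OF permutes_inj[OF \<alpha>D(1)]])
  also have "\<dots> = D'" using permutes_image[OF \<alpha>D(1)] b by (auto simp: D'_def b_def)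
  finally have D': "\<alpha> ` D' = D'" "D' \<subseteq> D" by (auto simp: D'_def)
  have AD': "A \<subseteq> D'" using A by (simp add: D'_def b_def)
  have \<alpha>': "\<alpha>' \<in> fpf_involutions D'"
    unfolding \<alpha>'_def using \<alpha> D' by (intro restrict_fpf_involution)
  have "\<alpha>' ` A = \<alpha> ` A" using AD' by (intro image_cong) (auto simp: \<alpha>'_def)
  hence \<alpha>'A: "\<alpha>' ` A = A" using A by simp
  note r = restrict_id_comp[OF fpf_involutions_D(1)[OF \<alpha>'] AD' \<alpha>'A, folded \<beta>_def \<gamma>_def]
  have fA: "finite A" using finite_subset[OF AD' finite_subset[OF D'(2) D]] .
  have sgn: "sign \<beta> = (-1) ^ i"
    using sign_fpf_involution[OF fA _ A(3)] restrict_fpf_involution[OF \<alpha>' AD' \<alpha>'A]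
    by (simp add: \<beta>_def)
  have \<beta>B: "\<beta> permutes B" by (rule permutes_subset[OF r(1)]) (auto simp: B_def)
  have \<gamma>B: "\<gamma> permutes D - B"
    by (rule permutes_subset[OF r(2)]) (auto simp: B_def D'_def)
  have \<alpha>eq: "\<alpha> = \<beta> \<circ> \<gamma> \<circ> transpose a b"
  proof
    fix y
    show "\<alpha> y = (\<beta> \<circ> \<gamma> \<circ> transpose a b) y"
      unfolding r(3) using b permutes_not_in[OF \<alpha>D(1)]
      by (cases "y \<in> D'") (auto simp: \<alpha>'_def D'_def b_def transpose_def restrict_id_def)
  qed
  have BD: "B \<union> (D - B) = D" "a \<in> B" "b \<notin> B" using a AD' b by (auto simp: B_def D'_def)
  have fB: "finite B" "finite (D - B)" using fA D by (auto simp: B_def)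
  have eq: "x * x ^ card (cycles_on (p \<circ> q \<circ> \<alpha>) D) = x ^ card (cycles_on ((p \<circ> \<beta>) \<circ> (q \<circ> \<gamma>)) (B \<union> (D - B)))"
    if pq: "p permutes B" "q permutes D - B" for p q
  proof -
    define \<rho> where "\<rho> = (p \<circ> \<beta>) \<circ> (q \<circ> \<gamma>)"
    have comm: "q \<circ> \<beta> = \<beta> \<circ> q" using permutes_commute[OF pq(2) \<beta>B] by blast
    have "p \<circ> q \<circ> \<alpha> = p \<circ> (q \<circ> \<beta>) \<circ> \<gamma> \<circ> transpose a b" unfolding \<alpha>eq by (simp only: o_assoc)
    hence 1: "p \<circ> q \<circ> \<alpha> = \<rho> \<circ> transpose a b" unfolding comm by (simp only: o_assoc \<rho>_def)
    have pB: "p \<circ> \<beta> permutes B" and qB: "q \<circ> \<gamma> permutes D - B"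
      by (rule permutes_compose[OF \<beta>B pq(1)], rule permutes_compose[OF \<gamma>B pq(2)])
    have disj: "B \<inter> (D - B) = {}" by blast
    have \<rho>: "\<rho> permutes D" using comp_permutes_disjoint(1)[OF pB qB disj] BD(1) by (simp add: \<rho>_def)
    have \<rho>B: "\<rho> y \<in> B" if "y \<in> B" for y
      using comp_permutes_disjoint(2)[OF pB qB disj that] permutes_in_image[OF pB] that
      by (simp add: \<rho>_def)
    have "y \<in> B" if "y \<in> orbit \<rho> a" for y
      using that by (induction rule: orbit.induct) (use \<rho>B BD in auto)
    hence "orbit \<rho> a \<noteq> orbit \<rho> b" using self_in_orbit[OF \<rho> D, of b] BD(3) by blast
    note join = card_cycles_on_join[OF \<rho> D a b(1) this]
    show ?thesis
      unfolding 1 BD(1) \<rho>_def[symmetric] join[symmetric] by simp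
  qed
  have "x * split_sum \<alpha> D x B = (\<Sum>p | p permutes B. \<Sum>q | q permutes D - B.
       (-1) ^ card (cycles_on p B) * x ^ card (cycles_on ((p \<circ> \<beta>) \<circ> (q \<circ> \<gamma>)) (B \<union> (D - B))))"
    unfolding split_sum_def sum_distrib_left
    by (intro sum.cong refl) (simp only: mem_Collect_eq eq[symmetric] mult.left_commute)
  also have "\<dots> = sign \<beta> * pochhammer (- x) (card B) * pochhammer x (card (D - B))"
    using fB \<beta>B \<gamma>B by (intro sum_signed_cycles_factor) auto
  also have "card B = 2 * i + 1" using A fA by (auto simp: B_def)
  also have "card (D - B) = card D - (2 * i + 1)"
    using \<open>card B = 2 * i + 1\<close> fB(1) BD(1) by (subst card_Diff_subset) auto
  finally show ?thesis by (simp add: sgn B_def)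
qed

text \<open>An invariant set is a union of edges with two darts each, so its size only depends on
  how many edges of \<open>S\<close> are chosen.\<close>

lemma sum_over_invariant:
  fixes f :: "nat \<Rightarrow> real"
  assumes D: "finite D" and \<alpha>: "\<alpha> \<in> fpf_involutions D" and S: "S \<subseteq> cycles_on \<alpha> D"
  shows "(\<Sum>A | A \<subseteq> \<Union>S \<and> \<alpha> ` A = A. f (card A)) =
    (\<Sum>i\<le>card S. real (card S choose i) * f (2 * i))"
proof -
  note \<alpha>D = fpf_involutions_D[OF \<alpha>]
  note bij = bij_betw_Union_cycles[OF \<alpha>D(1) D S]
  have fS: "finite S" using S D finite_cycles_on finite_subset by metis
  have US: "\<Union>S \<subseteq> D" using S Union_cycles_on[OF \<alpha>D(1) D] by blast
  have "(\<Sum>A | A \<subseteq> \<Union>S \<and> \<alpha> ` A = A. f (card A)) = (\<Sum>Z\<in>Pow S. f (card (\<Union>Z)))"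
    by (rule sum.reindex_bij_betw[symmetric, OF bij(1)])
  also have "\<dots> = (\<Sum>Z\<in>Pow S. f (2 * card Z))"
  proof (rule sum.cong[OF refl])
    fix Z assume Z: "Z \<in> Pow S"
    hence inv: "\<alpha> ` \<Union>Z = \<Union>Z" using bij_betwE[OF bij(1)] by blast
    have "\<Union>Z \<subseteq> D" using Z US by blast
    hence "2 * card (cycles_on \<alpha> (\<Union>Z)) = card (\<Union>Z)"
      using card_cycles_invariant[OF D \<alpha> _ inv] by blast
    thus "f (card (\<Union>Z)) = f (2 * card Z)" using bij(2) Z by simp
  qed
  also have "\<dots> = (\<Sum>i\<le>card S. real (card S choose i) * f (2 * i))"
    by (rule sum_Pow_card[OF fS])
  finally show ?thesis .
qed

theorem sum_long_cycles:
  fixes x :: real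
  assumes D: "finite D" "card D = 2 * n" "n \<ge> 1" and \<alpha>: "\<alpha> \<in> fpf_involutions D" and x: "x \<noteq> 0"
  shows "(\<Sum>c | c permutes D \<and> card (cycles_on c D) = 1. x ^ card (cycles_on (c \<circ> \<alpha>) D)) =
    fact (2 * n - 1) / (2 * fact (n + 1)) * hz_poly x (n + 1)"
proof -
  note \<alpha>D = fpf_involutions_D[OF \<alpha>]
  define E where "E = cycles_on \<alpha> D"
  have orb: "orbit \<alpha> a = {a, \<alpha> a}" if "a \<in> D" for a
    by (rule orbit_involution) (rule \<alpha>D(4)[OF that])
  have cE: "card E = n" using card_cycles_involution[of D \<alpha>] \<alpha>D D by (auto simp: E_def)
  have fE: "finite E" using D finite_cycles_on by (auto simp: E_def)
  obtain d where d: "d \<in> D" using D by (metis card.empty ex_in_conv mult_is_0 not_one_le_zero zero_neq_numeral)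
  have UE: "\<Union>(E - F) = D - \<Union>F" if "F \<subseteq> E" for F
  proof -
    have "\<Union>E = D" using Union_cycles_on[OF \<alpha>D(1) D(1)] by (simp add: E_def)
    moreover have "c = c'" if "c \<in> E" "c' \<in> E" "y \<in> c" "y \<in> c'" for c c' y
      using cycles_on_eq_if_in_orbit[OF \<alpha>D(1) D(1)] that by (metis E_def)
    ultimately show ?thesis using \<open>F \<subseteq> E\<close> by blast
  qed
  define \<phi> where "\<phi> = (\<lambda>i. pochhammer (- x) i * pochhammer x (2 * n - i))"
  \<comment> \<open>These are the darts of \<open>A\<close> on crossing edges. By
    \<open>split_sum_eq_0\<close> only sets with at most one of them contribute, which leaves
    \<open>S0\<close> and the families \<open>S1 a\<close>.\<close>
  define J where "J = (\<lambda>A. {a \<in> A. \<alpha> a \<notin> A})"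
  define S0 where "S0 = {A \<in> Pow (D - {d}). J A = {}}"
  define S1 where "S1 = (\<lambda>a. {A \<in> Pow (D - {d}). J A = {a}})"
  have fin: "finite (Pow (D - {d}))" using D by simp
  have inv_iff: "J A = {} \<longleftrightarrow> \<alpha> ` A = A" if "A \<subseteq> D" for A
  proof
    assume "J A = {}"
    hence "\<alpha> ` A \<subseteq> A" by (auto simp: J_def)
    moreover have "finite A" using that D(1) finite_subset by blast
    ultimately show "\<alpha> ` A = A" using permutes_inj_on[OF \<alpha>D(1)] by (metis endo_inj_surj)
  qed (auto simp: J_def)
  \<comment> \<open>An invariant set that avoids \<open>d\<close> also avoids
    \<open>\<alpha> d\<close>, so \<open>n - 1\<close> edges are free.\<close>
  have sum0: "(\<Sum>A\<in>S0. split_sum \<alpha> D x A) =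
      (\<Sum>i\<le>n - 1. real (n - 1 choose i) * ((-1) ^ i * \<phi> (2 * i)))"
  proof -
    define S where "S = E - {orbit \<alpha> d}"
    have S: "S \<subseteq> cycles_on \<alpha> D" "card S = n - 1"
      using fE cE d orbit_in_cycles_on[OF d, of \<alpha>] by (auto simp: S_def E_def)
    have US: "\<Union>S = D - {d, \<alpha> d}"
      using UE[of "{orbit \<alpha> d}"] orbit_in_cycles_on[OF d, of \<alpha>] orb[OF d] by (simp add: S_def E_def)
    have "S0 = {A. A \<subseteq> \<Union>S \<and> \<alpha> ` A = A}"
    proof (intro set_eqI iffI)
      fix A assume "A \<in> S0"
      hence A: "A \<subseteq> D - {d}" "\<alpha> ` A = A" using inv_iff[of A] by (auto simp: S0_def)
      moreover have "\<alpha> d \<notin> A" using A(1) imageI[of "\<alpha> d" A \<alpha>] \<alpha>D(4)[OF d] by (auto simp: A(2))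
      ultimately show "A \<in> {A. A \<subseteq> \<Union>S \<and> \<alpha> ` A = A}" by (auto simp: US)
    next
      fix A assume "A \<in> {A. A \<subseteq> \<Union>S \<and> \<alpha> ` A = A}"
      thus "A \<in> S0" using inv_iff[of A] by (auto simp: US S0_def)
    qed
    hence "(\<Sum>A\<in>S0. split_sum \<alpha> D x A) =
       (\<Sum>A | A \<subseteq> \<Union>S \<and> \<alpha> ` A = A. (-1) ^ (card A div 2) * \<phi> (card A))"
    proof (rule sum.cong)
      fix A assume "A \<in> {A. A \<subseteq> \<Union>S \<and> \<alpha> ` A = A}"
      hence A: "A \<subseteq> D" "\<alpha> ` A = A" using US by auto
      have "card A = 2 * card (cycles_on \<alpha> A)"
        by (rule card_cycles_invariant[OF D(1) \<alpha> A, symmetric])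
      from split_sum_0_boundary[OF D(1) \<alpha> A this, of x]
      show "split_sum \<alpha> D x A = (-1) ^ (card A div 2) * \<phi> (card A)"
        by (simp add: \<phi>_def D(2) \<open>card A = 2 * card (cycles_on \<alpha> A)\<close> mult.assoc)
    qed
    also have "\<dots> = (\<Sum>i\<le>card S. real (card S choose i) * ((-1) ^ (2 * i div 2) * \<phi> (2 * i)))"
      by (rule sum_over_invariant[OF D(1) \<alpha> S(1)])
    finally show ?thesis by (simp add: S(2))
  qed
  have sum1: "x * (\<Sum>A\<in>S1 a. split_sum \<alpha> D x A) =
      (\<Sum>i\<le>m. real (m choose i) * ((-1) ^ i * \<phi> (2 * i + 1)))"
    if a: "a \<in> D - {d}" and m: "m = (if a = \<alpha> d then n - 1 else n - 2)" for a m
  proof -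
    define S where "S = E - {orbit \<alpha> d, orbit \<alpha> a}"
    have aD: "a \<in> D" and ad: "a \<noteq> d" using a by auto
    have oE: "orbit \<alpha> d \<in> E" "orbit \<alpha> a \<in> E" using d aD orbit_in_cycles_on by (auto simp: E_def)
    have "orbit \<alpha> d = orbit \<alpha> a \<longleftrightarrow> a = \<alpha> d"
      using orb[OF d] orb[OF aD] ad \<alpha>D(4)[OF d] by auto
    hence S: "S \<subseteq> cycles_on \<alpha> D" "card S = m"
      using fE cE oE m by (auto simp: S_def E_def card_Diff_subset)
    have US: "\<Union>S = D - {d, \<alpha> d, a, \<alpha> a}"
      using UE[of "{orbit \<alpha> d, orbit \<alpha> a}"] oE orb[OF d] orb[OF aD] by (auto simp: S_def)
    have ins: "bij_betw (insert a) {A. A \<subseteq> \<Union>S \<and> \<alpha> ` A = A} (S1 a)"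
    proof (rule bij_betwI[where g = "\<lambda>A. A - {a}"])
      show "insert a \<in> {A. A \<subseteq> \<Union>S \<and> \<alpha> ` A = A} \<rightarrow> S1 a"
      proof
        fix A assume "A \<in> {A. A \<subseteq> \<Union>S \<and> \<alpha> ` A = A}"
        hence A: "A \<subseteq> D - {d, \<alpha> d, a, \<alpha> a}" "\<alpha> ` A = A" using US by auto
        have "J (insert a A) = {a}" using A \<alpha>D(3)[OF aD] by (auto simp: J_def)
        thus "insert a A \<in> S1 a" using A a by (auto simp: S1_def)
      qed
      show "(\<lambda>A. A - {a}) \<in> S1 a \<rightarrow> {A. A \<subseteq> \<Union>S \<and> \<alpha> ` A = A}"
      proof
        fix A assume "A \<in> S1 a"
        hence A: "A \<subseteq> D - {d}" "J A = {a}" by (auto simp: S1_def)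
        have aA: "a \<in> A" "\<alpha> a \<notin> A" using A(2) by (auto simp: J_def)
        have cl: "\<alpha> y \<in> A - {a}" if "y \<in> A - {a}" for y
        proof -
          have "\<alpha> y \<in> A" using that A(2) by (auto simp: J_def)
          moreover have "\<alpha> y \<noteq> a" using aA(2) that \<alpha>D(4)[of y] A(1) by auto
          ultimately show ?thesis by blast
        qed
        hence "J (A - {a}) = {}" by (auto simp: J_def)
        hence inv: "\<alpha> ` (A - {a}) = A - {a}" using inv_iff[of "A - {a}"] A(1) by auto
        have "\<alpha> d \<notin> A - {a}" using cl[of "\<alpha> d"] \<alpha>D(4)[OF d] A(1) by auto
        hence "A - {a} \<subseteq> \<Union>S" unfolding US using A(1) aA by blast
        thus "A - {a} \<in> {A. A \<subseteq> \<Union>S \<and> \<alpha> ` A = A}" using inv by simp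
      qed
      show "insert a A - {a} = A" if "A \<in> {A. A \<subseteq> \<Union>S \<and> \<alpha> ` A = A}" for A
        using that US by auto
      show "insert a (A - {a}) = A" if "A \<in> S1 a" for A
        using that by (auto simp: S1_def J_def)
    qed
    have "x * (\<Sum>A\<in>S1 a. split_sum \<alpha> D x A) =
        (\<Sum>A | A \<subseteq> \<Union>S \<and> \<alpha> ` A = A. x * split_sum \<alpha> D x (insert a A))"
      by (simp only: sum_distrib_left sum.reindex_bij_betw[symmetric, OF ins])
    also have "\<dots> = (\<Sum>A | A \<subseteq> \<Union>S \<and> \<alpha> ` A = A. (-1) ^ (card A div 2) * \<phi> (card A + 1))"
    proof (rule sum.cong[OF refl])
      fix A assume "A \<in> {A. A \<subseteq> \<Union>S \<and> \<alpha> ` A = A}"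
      hence A: "A \<subseteq> D - {a, \<alpha> a}" "\<alpha> ` A = A" using US by auto
      hence AD: "A \<subseteq> D" by blast
      have c: "card A = 2 * card (cycles_on \<alpha> A)"
        by (rule card_cycles_invariant[OF D(1) \<alpha> AD A(2), symmetric])
      show "x * split_sum \<alpha> D x (insert a A) = (-1) ^ (card A div 2) * \<phi> (card A + 1)"
        unfolding split_sum_1_boundary[OF D(1) \<alpha> aD A c, of x]
        unfolding \<phi>_def D(2) c by (simp add: mult.assoc)
    qed
    also have "\<dots> = (\<Sum>i\<le>card S. real (card S choose i) * ((-1) ^ (2 * i div 2) * \<phi> (2 * i + 1)))"
      by (rule sum_over_invariant[OF D(1) \<alpha> S(1)])
    finally show ?thesis by (simp add: S(2))
  qed
  have split: "(\<Sum>A\<in>Pow (D - {d}). split_sum \<alpha> D x A) =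
      (\<Sum>A\<in>S0. split_sum \<alpha> D x A) + (\<Sum>a\<in>D - {d}. \<Sum>A\<in>S1 a. split_sum \<alpha> D x A)"
  proof -
    have fS: "finite S0" "finite (S1 a)" for a using fin by (auto simp: S0_def S1_def)
    have "(\<Sum>A\<in>Pow (D - {d}). split_sum \<alpha> D x A) =
        (\<Sum>A\<in>S0 \<union> (\<Union>a\<in>D - {d}. S1 a). split_sum \<alpha> D x A)"
    proof (rule sum.mono_neutral_right[OF fin])
      show "S0 \<union> (\<Union>a\<in>D - {d}. S1 a) \<subseteq> Pow (D - {d})" by (auto simp: S0_def S1_def)
      show "\<forall>A\<in>Pow (D - {d}) - (S0 \<union> (\<Union>a\<in>D - {d}. S1 a)). split_sum \<alpha> D x A = 0"
      proof
        fix A assume A: "A \<in> Pow (D - {d}) - (S0 \<union> (\<Union>a\<in>D - {d}. S1 a))"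
        hence "J A \<noteq> {}" by (auto simp: S0_def)
        then obtain a where a: "a \<in> J A" by blast
        hence "a \<in> D - {d}" using A by (auto simp: J_def)
        hence "J A \<noteq> {a}" using A by (auto simp: S1_def)
        then obtain a' where a': "a' \<in> J A" "a \<noteq> a'" using a by blast
        show "split_sum \<alpha> D x A = 0"
          by (rule split_sum_eq_0[OF D(1) _ \<alpha>, of _ a a']) (use a a' A in \<open>auto simp: J_def\<close>)
      qed
    qed
    also have "\<dots> = (\<Sum>A\<in>S0. split_sum \<alpha> D x A) + (\<Sum>A\<in>(\<Union>a\<in>D - {d}. S1 a). split_sum \<alpha> D x A)"
      using fS D by (intro sum.union_disjoint) (auto simp: S0_def S1_def)
    also have "(\<Sum>A\<in>(\<Union>a\<in>D - {d}. S1 a). split_sum \<alpha> D x A) = (\<Sum>a\<in>D - {d}. \<Sum>A\<in>S1 a. split_sum \<alpha> D x A)"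
      using fS D by (intro sum.UNION_disjoint) (auto simp: S1_def)
    finally show ?thesis .
  qed
  define T where "T = (\<lambda>m e. \<Sum>i\<le>m. real (m choose i) * ((-1) ^ i * \<phi> (2 * i + e)))"
  have \<alpha>d: "\<alpha> d \<in> D - {d}" using \<alpha>D d by auto
  have "x * (\<Sum>a\<in>D - {d}. \<Sum>A\<in>S1 a. split_sum \<alpha> D x A) =
      (\<Sum>a\<in>D - {d}. x * (\<Sum>A\<in>S1 a. split_sum \<alpha> D x A))"
    by (rule sum_distrib_left)
  also have "\<dots> = (\<Sum>a\<in>D - {d}. T (if a = \<alpha> d then n - 1 else n - 2) 1)"
    unfolding T_def by (intro sum.cong refl) (rule sum1, auto)
  \<comment> \<open>Besides \<open>\<alpha> d\<close> there are \<open>2 * n - 2\<close> darts in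
    \<open>D - {d}\<close>, all with the same contribution.\<close>
  also have "\<dots> = T (n - 1) 1 + (\<Sum>a\<in>D - {d} - {\<alpha> d}. T (n - 2) 1)"
    using D(1) \<alpha>d by (subst sum.remove[of _ "\<alpha> d"]) auto
  also have "(\<Sum>a\<in>D - {d} - {\<alpha> d}. T (n - 2) 1) = real (2 * n - 2) * T (n - 2) 1"
    using D d \<alpha>d by simp
  finally have "x * (\<Sum>c | c permutes D \<and> card (cycles_on c D) = 1. x ^ card (cycles_on (c \<circ> \<alpha>) D)) =
      x * T (n - 1) 0 + T (n - 1) 1 + real (2 * n - 2) * T (n - 2) 1"
    unfolding sum_long_cycles_eq_split_sum[OF D(1) d] split sum0 distrib_left
    by (simp add: T_def)
  also have "T (n - 1) 0 = Phi x (2 * n) (([:1, 1:] * [:1, -1:]) ^ (n - 1))"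
    using Phi_binomial[of "n - 1" 0 "2 * n" x] by (simp add: T_def \<phi>_def del: mult_pCons_left mult_pCons_right)
  also have "T (n - 1) 1 = Phi x (2 * n) (monom 1 1 * ([:1, 1:] * [:1, -1:]) ^ (n - 1))"
    unfolding T_def \<phi>_def using D(3) by (intro Phi_binomial[symmetric]) auto
  also have "T (n - 2) 1 = Phi x (2 * n) (monom 1 1 * ([:1, 1:] * [:1, -1:]) ^ (n - 2))"
    unfolding T_def \<phi>_def using D(3) by (intro Phi_binomial[symmetric]) auto
  also note hz_sum_identity[OF D(3), of x]
  finally show ?thesis by (simp only: mult_left_cancel[OF x])
qed


section \<open>Partitions into odd parts\<close>

text \<open>For a partition of \<open>g\<close> into \<open>t\<close> parts,
  \<open>(2 * g + t)!\<close> times this weight is the number of permutations with one cycle of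
  length \<open>2 * i + 1\<close> for each part \<open>i\<close>: the denominator is the order of
  the centralizer.\<close>

definition part_weight :: "nat multiset \<Rightarrow> real" where
  "part_weight \<gamma> = 1 / (\<Prod>i\<in>set_mset \<gamma>. fact (count \<gamma> i) * (2 * real i + 1) ^ count \<gamma> i)"

text \<open>The coefficient of \<open>u^t y^(2g+t)\<close> in
  \<open>exp (u (artanh y - y))\<close>.\<close>

definition partition_sum :: "nat \<Rightarrow> nat \<Rightarrow> real" where
  "partition_sum g t = (\<Sum>\<gamma>\<in>partitions_with_parts g t. part_weight \<gamma>)"

lemma sum_mset_count_nat: "(\<Sum>i\<in>set_mset \<gamma>. count \<gamma> i * i) = \<Sum>\<^sub># (\<gamma> :: nat multiset)"
proof (induction \<gamma>)
  case (add x \<gamma>)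
  have "(\<Sum>i\<in>set_mset (add_mset x \<gamma>). count (add_mset x \<gamma>) i * i) =
      (\<Sum>i\<in>insert x (set_mset \<gamma>). count \<gamma> i * i + (if i = x then x else 0))"
    by (intro sum.cong) auto
  also have "\<dots> = (\<Sum>i\<in>insert x (set_mset \<gamma>). count \<gamma> i * i) + x"
    by (simp add: sum.distrib)
  also have "(\<Sum>i\<in>insert x (set_mset \<gamma>). count \<gamma> i * i) = (\<Sum>i\<in>set_mset \<gamma>. count \<gamma> i * i)"
    by (rule sum.mono_neutral_right) (auto simp: not_in_iff)
  finally show ?case using add by simp
qed simp

lemma part_weight_add_mset:
  "part_weight \<gamma> = real (Suc (count \<gamma> i)) * (2 * real i + 1) * part_weight (add_mset i \<gamma>)"
proof -
  define w where "w = (\<lambda>\<gamma> j. fact (count \<gamma> j) * (2 * real j + 1) ^ count \<gamma> j :: real)"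
  define S where "S = set_mset \<gamma> - {i}"
  have S: "finite S" "i \<notin> S" by (auto simp: S_def)
  have "(\<Prod>j\<in>set_mset \<gamma>. w \<gamma> j) = (\<Prod>j\<in>insert i S. w \<gamma> j)"
    by (rule prod.mono_neutral_left) (auto simp: S_def w_def not_in_iff)
  moreover have "set_mset (add_mset i \<gamma>) = insert i S" by (auto simp: S_def)
  moreover have "(\<Prod>j\<in>S. w (add_mset i \<gamma>) j) = (\<Prod>j\<in>S. w \<gamma> j)"
    using S by (intro prod.cong) (auto simp: w_def)
  moreover have "w (add_mset i \<gamma>) i = real (Suc (count \<gamma> i)) * (2 * real i + 1) * w \<gamma> i"
    by (simp add: w_def algebra_simps)
  moreover have "real (Suc (count \<gamma> i)) * (2 * real i + 1) \<noteq> 0" by (simp add: add_eq_0_iff)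
  moreover have "part_weight \<delta> = 1 / (\<Prod>j\<in>set_mset \<delta>. w \<delta> j)" for \<delta>
    by (simp add: part_weight_def w_def)
  ultimately show ?thesis using S by simp
qed

lemma partitions_with_parts_0: "partitions_with_parts g 0 = (if g = 0 then {{#}} else {})"
  by (auto simp: partitions_with_parts_def)

lemma partitions_with_parts_empty: "g < t \<Longrightarrow> partitions_with_parts g t = {}"
proof -
  have "size \<gamma> \<le> sum_mset \<gamma>" if "0 \<notin># \<gamma>" for \<gamma> :: "nat multiset"
    using that by (induction \<gamma>) auto
  thus "g < t \<Longrightarrow> partitions_with_parts g t = {}" by (fastforce simp: partitions_with_parts_def)
qed

lemma add_mset_in_partitions:
  "add_mset i \<gamma> \<in> partitions_with_parts g (Suc t) \<longleftrightarrow>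
    1 \<le> i \<and> i \<le> g \<and> \<gamma> \<in> partitions_with_parts (g - i) t"
  by (auto simp: partitions_with_parts_def)

lemma finite_partitions_with_parts: "finite (partitions_with_parts g t)"
proof (induction t arbitrary: g)
  case 0
  then show ?case by (simp add: partitions_with_parts_0)
next
  case (Suc t)
  have "partitions_with_parts g (Suc t) \<subseteq> (\<Union>i\<in>{1..g}. add_mset i ` partitions_with_parts (g - i) t)"
  proof
    fix \<gamma> assume \<gamma>: "\<gamma> \<in> partitions_with_parts g (Suc t)"
    hence "\<gamma> \<noteq> {#}" by (auto simp: partitions_with_parts_def)
    then obtain i \<delta> where "\<gamma> = add_mset i \<delta>" using multiset_cases by blast
    thus "\<gamma> \<in> (\<Union>i\<in>{1..g}. add_mset i ` partitions_with_parts (g - i) t)"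
      using \<gamma> add_mset_in_partitions by auto
  qed
  thus ?case using Suc by (meson finite_UN_I finite_atLeastAtMost finite_imageI finite_subset)
qed

lemma partition_sum_g_0: "partition_sum g 0 = (if g = 0 then 1 else 0)"
  by (simp add: partition_sum_def partitions_with_parts_0 part_weight_def)

lemma partition_sum_eq_0: "g < t \<Longrightarrow> partition_sum g t = 0"
  by (simp add: partition_sum_def partitions_with_parts_empty)

text \<open>Marking one of the parts of a partition, a part \<open>i\<close> being counted with weight \<open>2i + 1\<close>.\<close>

lemma partition_sum_rec:
  "real (2 * g + Suc t) * partition_sum g (Suc t) = (\<Sum>i=1..g. partition_sum (g - i) t)"
proof -
  let ?P = "partitions_with_parts g (Suc t)"
  have "real (2 * g + Suc t) * partition_sum g (Suc t) = (\<Sum>\<gamma>\<in>?P. real (2 * g + Suc t) * part_weight \<gamma>)"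
    by (simp add: partition_sum_def sum_distrib_left)
  also have "\<dots> = (\<Sum>\<gamma>\<in>?P. \<Sum>i | i \<in> {1..g} \<and> i \<in># \<gamma>. part_weight (\<gamma> - {#i#}))"
  proof (rule sum.cong[OF refl])
    fix \<gamma> assume \<gamma>: "\<gamma> \<in> ?P"
    have set: "{i. i \<in> {1..g} \<and> i \<in># \<gamma>} = set_mset \<gamma>"
    proof -
      have "i \<in> {1..g}" if "i \<in># \<gamma>" for i
        using \<gamma> that add_mset_in_partitions[of i "\<gamma> - {#i#}" g t] by simp
      thus ?thesis by blast
    qed
    \<comment> \<open>Deleting one copy of \<open>i\<close> multiplies the weight by
      \<open>count \<gamma> i * (2 * i + 1)\<close>. Over the distinct parts these factors add up to
      twice the sum of \<open>\<gamma>\<close> plus its number of parts.\<close>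
    have "(\<Sum>i | i \<in> {1..g} \<and> i \<in># \<gamma>. part_weight (\<gamma> - {#i#})) =
        (\<Sum>i\<in>set_mset \<gamma>. real (count \<gamma> i) * (2 * real i + 1) * part_weight \<gamma>)"
      unfolding set
    proof (rule sum.cong[OF refl])
      fix i assume i: "i \<in># \<gamma>"
      have "Suc (count (\<gamma> - {#i#}) i) = count \<gamma> i" using i by (simp add: count_greater_zero_iff)
      thus "part_weight (\<gamma> - {#i#}) = real (count \<gamma> i) * (2 * real i + 1) * part_weight \<gamma>"
        using part_weight_add_mset[of "\<gamma> - {#i#}" i] i by simp
    qed
    also have "\<dots> = (2 * real (\<Sum>i\<in>set_mset \<gamma>. count \<gamma> i * i) + real (\<Sum>i\<in>set_mset \<gamma>. count \<gamma> i)) * part_weight \<gamma>"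
      by (simp add: sum_distrib_left sum_distrib_right sum.distrib algebra_simps)
    also have "(\<Sum>i\<in>set_mset \<gamma>. count \<gamma> i * i) = g"
      using \<gamma> by (simp add: partitions_with_parts_def sum_mset_count_nat)
    also have "(\<Sum>i\<in>set_mset \<gamma>. count \<gamma> i) = Suc t"
      using \<gamma> by (simp add: partitions_with_parts_def size_multiset_overloaded_eq)
    finally show "real (2 * g + Suc t) * part_weight \<gamma> =
        (\<Sum>i | i \<in> {1..g} \<and> i \<in># \<gamma>. part_weight (\<gamma> - {#i#}))" by simp
  qed
  also have "\<dots> = (\<Sum>i=1..g. \<Sum>\<gamma> | \<gamma> \<in> ?P \<and> i \<in># \<gamma>. part_weight (\<gamma> - {#i#}))"
    by (rule sum.swap_restrict) (simp_all add: finite_partitions_with_parts)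
  also have "\<dots> = (\<Sum>i=1..g. partition_sum (g - i) t)"
  proof (rule sum.cong[OF refl])
    fix i assume i: "i \<in> {1..g}"
    have rm: "\<gamma> - {#i#} \<in> partitions_with_parts (g - i) t" if "\<gamma> \<in> ?P" "i \<in># \<gamma>" for \<gamma>
      using add_mset_in_partitions[of i "\<gamma> - {#i#}" g t] that by simp
    show "(\<Sum>\<gamma> | \<gamma> \<in> ?P \<and> i \<in># \<gamma>. part_weight (\<gamma> - {#i#})) = partition_sum (g - i) t"
      unfolding partition_sum_def
      by (rule sum.reindex_bij_witness[where i = "add_mset i" and j = "\<lambda>\<gamma>. \<gamma> - {#i#}"])
         (use i add_mset_in_partitions rm in auto)
  qed
  finally show ?thesis .
qed

text \<open>On the right of \<open>partition_sum_rec\<close>, the sum for \<open>Suc g\<close> is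
  the sum for \<open>g\<close> with one more term, \<open>i = 1\<close>; so the recurrence over all
  smaller values collapses to two terms.\<close>

lemma partition_sum_two_term:
  "real (2 * Suc g + Suc t) * partition_sum (Suc g) (Suc t) =
    partition_sum g t + real (2 * g + Suc t) * partition_sum g (Suc t)"
proof -
  have "(\<Sum>i=1..Suc g. partition_sum (Suc g - i) t) = (\<Sum>i=0..g. partition_sum (g - i) t)"
    by (rule sum.reindex_bij_witness[where i = Suc and j = "\<lambda>i. i - 1"]) auto
  also have "\<dots> = partition_sum g t + (\<Sum>i=1..g. partition_sum (g - i) t)"
    by (subst sum.atLeast_Suc_atMost) simp_all
  finally show ?thesis
    unfolding partition_sum_rec .
qed

text \<open>The coefficient of \<open>(2x)\<^sup>v y\<^bsup>v+2g\<^esup>\<close> in \<open>exp(2x artanh y)\<close>, where \<open>exp(2xy)\<close> has been split off.\<close>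

definition opart_coeff :: "nat \<Rightarrow> nat \<Rightarrow> real" where
  "opart_coeff g v = (\<Sum>t\<le>v. partition_sum g t / fact (v - t))"

lemma opart_coeff_0: "opart_coeff 0 v = 1 / fact v"
proof -
  have "opart_coeff 0 v = (\<Sum>t\<le>v. if t = 0 then 1 / fact v else 0)"
    unfolding opart_coeff_def by (intro sum.cong refl) (auto simp: partition_sum_g_0 partition_sum_eq_0)
  thus ?thesis by simp
qed

lemma opart_coeff_g_0: "opart_coeff g 0 = (if g = 0 then 1 else 0)"
  by (simp add: opart_coeff_def partition_sum_g_0)

text \<open>The factor is split as \<open>(w + 1 - t) + (2 * g + t)\<close>: the first part shortens
  the factorial, the second is the one that \<open>partition_sum_two_term\<close> absorbs.\<close>

lemma opart_coeff_split:
  "real (Suc w + 2 * g) * opart_coeff g (Suc w) =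
    opart_coeff g w + (\<Sum>t\<le>w. real (2 * g + Suc t) * partition_sum g (Suc t) / fact (w - t))"
proof -
  have "real (Suc w + 2 * g) * opart_coeff g (Suc w) =
      (\<Sum>t\<le>Suc w. real (Suc w - t) * partition_sum g t / fact (Suc w - t)) +
      (\<Sum>t\<le>Suc w. real (2 * g + t) * partition_sum g t / fact (Suc w - t))"
    unfolding opart_coeff_def sum_distrib_left sum.distrib[symmetric]
    by (intro sum.cong refl) (auto simp: of_nat_diff add_divide_distrib[symmetric] algebra_simps)
  also have "(\<Sum>t\<le>Suc w. real (Suc w - t) * partition_sum g t / fact (Suc w - t)) = opart_coeff g w"
    unfolding opart_coeff_def sum.atMost_Suc
    by (simp, intro sum.cong refl) (auto simp: Suc_diff_le divide_simps)
  also have "(\<Sum>t\<le>Suc w. real (2 * g + t) * partition_sum g t / fact (Suc w - t)) =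
      (\<Sum>t\<le>w. real (2 * g + Suc t) * partition_sum g (Suc t) / fact (w - t))"
    by (subst sum.atMost_Suc_shift) (simp add: partition_sum_g_0)
  finally show ?thesis .
qed

text \<open>The coefficient of \<open>(2x)^v\<close> in the recurrence that stems from
  \<open>(1 - y^2) f' = 2 x f\<close>; the case \<open>v = 0\<close> stands for a vanishing
  coefficient at exponent \<open>-1\<close>.\<close>

lemma opart_coeff_Suc:
  "real (v + 2 * Suc g) * opart_coeff (Suc g) v =
    (if v = 0 then 0 else opart_coeff (Suc g) (v - 1)) + real (v + 2 * g) * opart_coeff g v"
proof (cases v)
  case 0
  then show ?thesis by (simp add: opart_coeff_g_0)
next
  case (Suc w)
  have "(\<Sum>t\<le>w. real (2 * Suc g + Suc t) * partition_sum (Suc g) (Suc t) / fact (w - t)) =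
      opart_coeff g w + (\<Sum>t\<le>w. real (2 * g + Suc t) * partition_sum g (Suc t) / fact (w - t))"
    unfolding partition_sum_two_term opart_coeff_def by (simp add: add_divide_distrib sum.distrib)
  thus ?thesis
    using opart_coeff_split[of w g] opart_coeff_split[of w "Suc g"] Suc by simp
qed

text \<open>Both sides satisfy the same three-term recurrence and agree for \<open>m = 0\<close> and
  \<open>m = 1\<close>; the induction therefore carries two consecutive values. The generous range
  \<open>g \<le> m\<close> with a guard inside keeps the index shifts uniform.\<close>

lemma hz_poly_eq:
  "hz_poly x m = fact m * (\<Sum>g\<le>m. if 2 * g \<le> m then opart_coeff g (m - 2 * g) * (2 * x) ^ (m - 2 * g) else 0)"
proof -
  define y where "y = 2 * x"
  define F where "F = (\<lambda>m g. if 2 * g \<le> m then opart_coeff g (m - 2 * g) * y ^ (m - 2 * g) else 0)"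
  define h where "h = (\<lambda>m. \<Sum>g\<le>m. F m g)"
  have rec: "real (Suc (Suc m)) * h (Suc (Suc m)) = y * h (Suc m) + real m * h m" for m
  proof -
    have F0: "real (Suc k) * F (Suc k) 0 = y * F k 0" for k
      by (simp add: F_def opart_coeff_0)
    have FS: "real (Suc (Suc m)) * F (Suc (Suc m)) (Suc g) = y * F (Suc m) (Suc g) + real m * F m g" for g
    proof (cases "2 * g \<le> m")
      case True
      define v where "v = m - 2 * g"
      have m: "m = v + 2 * g" using True by (simp add: v_def)
      have "real (v + 2 * Suc g) * F (Suc (Suc m)) (Suc g) =
          (real (v + 2 * Suc g) * opart_coeff (Suc g) v) * y ^ v"
        by (simp add: F_def m)
      also have "\<dots> = y * F (Suc m) (Suc g) + real m * F m g"
      proof (cases v)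
        case 0
        then show ?thesis unfolding opart_coeff_Suc by (simp add: F_def m)
      next
        case (Suc w)
        then show ?thesis unfolding opart_coeff_Suc by (simp add: F_def m algebra_simps)
      qed
      finally show ?thesis by (simp add: m)
    next
      case False
      thus ?thesis by (simp add: F_def)
    qed
    have "h (Suc (Suc m)) = F (Suc (Suc m)) 0 + (\<Sum>g\<le>m. F (Suc (Suc m)) (Suc g))"
    proof -
      \<comment> \<open>The summand at \<open>g = Suc (Suc m)\<close> fails the guard, so the range
        may be cut before it is shifted.\<close>
      have "h (Suc (Suc m)) = (\<Sum>g\<le>Suc m. F (Suc (Suc m)) g)" by (simp add: h_def F_def)
      also have "\<dots> = F (Suc (Suc m)) 0 + (\<Sum>g\<le>m. F (Suc (Suc m)) (Suc g))"
        by (rule sum.atMost_Suc_shift)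
      finally show ?thesis .
    qed
    hence "real (Suc (Suc m)) * h (Suc (Suc m)) = y * F (Suc m) 0 +
        (\<Sum>g\<le>m. y * F (Suc m) (Suc g) + real m * F m g)"
      unfolding F0[symmetric] FS[symmetric] by (simp only: distrib_left sum_distrib_left)
    also have "\<dots> = y * (F (Suc m) 0 + (\<Sum>g\<le>m. F (Suc m) (Suc g))) + real m * h m"
      by (simp only: distrib_left sum_distrib_left sum.distrib h_def add.assoc)
    also have "F (Suc m) 0 + (\<Sum>g\<le>m. F (Suc m) (Suc g)) = h (Suc m)"
      unfolding h_def by (rule sum.atMost_Suc_shift[symmetric])
    finally show ?thesis .
  qed
  have "hz_poly x m = fact m * h m \<and> hz_poly x (Suc m) = fact (Suc m) * h (Suc m)"
  proof (induction m)
    case 0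
    then show ?case by (simp add: h_def F_def opart_coeff_0 y_def)
  next
    case (Suc m)
    have "fact (Suc (Suc m)) * h (Suc (Suc m)) = fact (Suc m) * (real (Suc (Suc m)) * h (Suc (Suc m)))"
      by (simp only: fact_Suc[of "Suc m"] of_nat_mult of_nat_fact ac_simps of_nat_id)
    also have "\<dots> = y * (fact (Suc m) * h (Suc m)) + real (Suc m) * real m * (fact m * h m)"
      unfolding rec by (simp add: algebra_simps)
    finally show ?case using Suc hz_poly_rec[of x m] by (simp add: y_def)
  qed
  thus ?thesis unfolding h_def F_def y_def by (rule conjunct1)
qed


section \<open>Counting unicellular maps\<close>

text \<open>The partner of a fixed dart can be any of the \<open>2 * n + 1\<close> others, and the
  rest is an involution of two darts fewer. The value is the double factorial of odd numbers,
  written with factorials.\<close>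

lemma card_fpf_involutions:
  assumes "finite D" "card D = 2 * n"
  shows "real (card (fpf_involutions D)) = fact (2 * n) / (2 ^ n * fact n)"
  using assms
proof (induction n arbitrary: D)
  case 0
  then show ?case by (simp add: fpf_involutions_def)
next
  case (Suc n)
  then obtain x where x: "x \<in> D" by fastforce
  have bij: "bij_betw (\<lambda>\<alpha>. (\<alpha> x, restrict_id \<alpha> (D - {x, \<alpha> x}))) (fpf_involutions D)
      (SIGMA y:D - {x}. fpf_involutions (D - {x, y}))"
  proof (rule bij_betwI[where g = "\<lambda>(y, \<beta>). \<beta> \<circ> transpose x y"])
    have *: "restrict_id \<alpha> (D - {x, \<alpha> x}) \<in> fpf_involutions (D - {x, \<alpha> x})"
      if \<alpha>: "\<alpha> \<in> fpf_involutions D" for \<alpha>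
    proof (rule restrict_fpf_involution[OF \<alpha>])
      note \<alpha>D = fpf_involutions_D[OF \<alpha>]
      have "\<alpha> ` (D - {x, \<alpha> x}) = \<alpha> ` D - \<alpha> ` {x, \<alpha> x}"
        by (rule image_set_diff[OF permutes_inj[OF \<alpha>D(1)]])
      also have "\<dots> = D - {x, \<alpha> x}" using permutes_image[OF \<alpha>D(1)] \<alpha>D(4)[OF x] by auto
      finally show "\<alpha> ` (D - {x, \<alpha> x}) = D - {x, \<alpha> x}" .
    qed auto
    thus "(\<lambda>\<alpha>. (\<alpha> x, restrict_id \<alpha> (D - {x, \<alpha> x})))
        \<in> fpf_involutions D \<rightarrow> (SIGMA y:D - {x}. fpf_involutions (D - {x, y}))"
      using fpf_involutions_D[of _ D] x by auto
    show "(\<lambda>(y, \<beta>). \<beta> \<circ> transpose x y)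
        \<in> (SIGMA y:D - {x}. fpf_involutions (D - {x, y})) \<rightarrow> fpf_involutions D"
    proof
      fix z assume "z \<in> (SIGMA y:D - {x}. fpf_involutions (D - {x, y}))"
      then obtain y \<beta> where z: "z = (y, \<beta>)" "y \<in> D" "y \<noteq> x" "\<beta> \<in> fpf_involutions (D - {x, y})" by auto
      note \<beta>D = fpf_involutions_D[OF z(4)]
      have \<beta>x: "\<beta> x = x" "\<beta> y = y" using permutes_not_in[OF \<beta>D(1)] by auto
      have "\<beta> \<circ> transpose x y permutes D"
        using x z by (intro permutes_compose[OF permutes_swap_id] permutes_subset[OF \<beta>D(1)]) auto
      moreover have "(\<beta> \<circ> transpose x y) d \<noteq> d \<and> (\<beta> \<circ> transpose x y) ((\<beta> \<circ> transpose x y) d) = d"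
        if d: "d \<in> D" for d
      proof (cases "d = x \<or> d = y")
        case True
        then show ?thesis using \<beta>x z(3) by auto
      next
        case False
        hence "d \<in> D - {x, y}" using d by blast
        then show ?thesis using \<beta>D(2-4)[of d] by (auto simp: transpose_def)
      qed
      ultimately show "(\<lambda>(y, \<beta>). \<beta> \<circ> transpose x y) z \<in> fpf_involutions D"
        by (simp add: z(1) fpf_involutions_def)
    qed
    show "(\<lambda>(y, \<beta>). \<beta> \<circ> transpose x y) (\<alpha> x, restrict_id \<alpha> (D - {x, \<alpha> x})) = \<alpha>"
      if "\<alpha> \<in> fpf_involutions D" for \<alpha>
    proof -
      note \<alpha>D = fpf_involutions_D[OF that]
      show ?thesis
        using \<alpha>D(3,4)[OF x] permutes_not_in[OF \<alpha>D(1)]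
        by (auto simp: fun_eq_iff transpose_def restrict_id_def)
    qed
    fix z assume "z \<in> (SIGMA y:D - {x}. fpf_involutions (D - {x, y}))"
    then obtain y \<beta> where z: "z = (y, \<beta>)" "y \<in> D" "y \<noteq> x" "\<beta> \<in> fpf_involutions (D - {x, y})" by auto
    note \<beta>D = fpf_involutions_D[OF z(4)]
    have \<beta>x: "\<beta> x = x" "\<beta> y = y" using permutes_not_in[OF \<beta>D(1)] by auto
    have "restrict_id (\<beta> \<circ> transpose x y) (D - {x, y}) = \<beta>"
      using permutes_not_in[OF \<beta>D(1)] by (auto simp: fun_eq_iff restrict_id_def transpose_def)
    thus "((case z of (y, \<beta>) \<Rightarrow> \<beta> \<circ> transpose x y) x,
        restrict_id (case z of (y, \<beta>) \<Rightarrow> \<beta> \<circ> transpose x y)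
         (D - {x, (case z of (y, \<beta>) \<Rightarrow> \<beta> \<circ> transpose x y) x})) = z"
      using z(1) \<beta>x by simp
  qed
  have fin: "finite (fpf_involutions E)" if "finite E" for E :: "'a set"
    using finite_permutations[OF that] by (rule finite_subset[rotated]) (auto simp: fpf_involutions_def)
  have "card (D - {x, y}) = 2 * n" if "y \<in> D - {x}" for y
    using that x Suc.prems by (subst card_Diff_subset) auto
  hence IH: "real (card (fpf_involutions (D - {x, y}))) = fact (2 * n) / (2 ^ n * fact n)" if "y \<in> D - {x}" for y
    using that Suc.IH[of "D - {x, y}"] Suc.prems by simp
  have "real (card (fpf_involutions D)) = (\<Sum>y\<in>D - {x}. real (card (fpf_involutions (D - {x, y}))))"
    using bij_betw_same_card[OF bij] Suc.prems fin by simp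
  also have "\<dots> = real (2 * n + 1) * (fact (2 * n) / (2 ^ n * fact n))"
    using x Suc.prems by (simp add: IH)
  also have "\<dots> = (real (2 * n + 2) * (real (2 * n + 1) * fact (2 * n))) / (real (2 * n + 2) * (2 ^ n * fact n))"
    by (subst mult_divide_mult_cancel_left) simp_all
  also have "real (2 * n + 2) * (real (2 * n + 1) * fact (2 * n)) = fact (2 * Suc n)"
    by (simp add: algebra_simps)
  also have "real (2 * n + 2) * (2 ^ n * fact n) = 2 ^ Suc n * fact (Suc n)"
    by (simp add: algebra_simps)
  finally show ?case .
qed

text \<open>Coefficients of \<open>sum_long_cycles\<close> are compared as polynomials in
  \<open>x\<close>. Only exponents \<open>n + 1 - 2 * h\<close> occur, in accordance with the parity
  in Euler's formula.\<close>

lemma card_long_cycles: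
  assumes D: "finite D" "card D = 2 * n" "n \<ge> 1" and \<alpha>: "\<alpha> \<in> fpf_involutions D" and g: "2 * g \<le> n + 1"
  shows "real (card {c. c permutes D \<and> card (cycles_on c D) = 1 \<and> card (cycles_on (c \<circ> \<alpha>) D) = n + 1 - 2 * g}) =
    fact (2 * n - 1) / 2 * 2 ^ (n + 1 - 2 * g) * opart_coeff g (n + 1 - 2 * g)"
proof -
  define C where "C = {c. c permutes D \<and> card (cycles_on c D) = 1}"
  define cyc where "cyc = (\<lambda>c. card (cycles_on (c \<circ> \<alpha>) D))"
  define K :: real where "K = fact (2 * n - 1) / 2"
  define p where "p = (\<Sum>c\<in>C. monom (1 :: real) (cyc c))"
  define q where "q = (\<Sum>h\<le>n + 1. if 2 * h \<le> n + 1
     then monom (K * 2 ^ (n + 1 - 2 * h) * opart_coeff h (n + 1 - 2 * h)) (n + 1 - 2 * h) else 0)"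
  have finC: "finite C" using D(1) finite_permutations[of D] by (auto simp: C_def)
  have eq: "poly p x = poly q x" if "x \<noteq> 0" for x
  proof -
    have "poly p x = (\<Sum>c | c permutes D \<and> card (cycles_on c D) = 1. x ^ card (cycles_on (c \<circ> \<alpha>) D))"
      by (simp add: p_def poly_sum poly_monom C_def cyc_def)
    also have "\<dots> = fact (2 * n - 1) / (2 * fact (n + 1)) * hz_poly x (n + 1)"
      by (rule sum_long_cycles[OF D \<alpha> that])
    also have "\<dots> = K * (\<Sum>g\<le>n + 1. if 2 * g \<le> n + 1
        then opart_coeff g (n + 1 - 2 * g) * (2 * x) ^ (n + 1 - 2 * g) else 0)"
      unfolding hz_poly_eq K_def by simp
    also have "\<dots> = poly q x"
      unfolding q_def poly_sum sum_distrib_left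
      by (intro sum.cong refl) (auto simp: poly_monom power_mult_distrib)
    finally show ?thesis .
  qed
  \<comment> \<open>The identity is available for \<open>x \<noteq> 0\<close> only; after
    multiplication by the variable both sides also agree at 0, and polynomials with equal values are
    equal.\<close>
  have "poly (monom 1 1 * p) = poly (monom 1 1 * q)"
  proof
    fix x show "poly (monom 1 1 * p) x = poly (monom 1 1 * q) x"
      using eq[of x] by (cases "x = 0") (simp_all add: poly_monom)
  qed
  hence "p = q" by (simp add: poly_eq_poly_eq_iff)
  have "real (card {c \<in> C. cyc c = n + 1 - 2 * g}) = coeff p (n + 1 - 2 * g)"
    using finC by (simp add: p_def coeff_sum Int_def flip: sum.inter_filter)
  also have "\<dots> = (\<Sum>h\<le>n + 1. if h = g then K * 2 ^ (n + 1 - 2 * h) * opart_coeff h (n + 1 - 2 * h) else 0)"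
    unfolding \<open>p = q\<close> q_def coeff_sum using g by (intro sum.cong refl) auto
  also have "\<dots> = K * 2 ^ (n + 1 - 2 * g) * opart_coeff g (n + 1 - 2 * g)"
    using g by simp
  finally show ?thesis by (simp add: C_def cyc_def K_def conj_assoc)
qed

section \<open>Unicellular maps and their isomorphism classes\<close>

definition relabel :: "('a \<Rightarrow> 'a) \<Rightarrow> ('a \<Rightarrow> 'a) \<times> ('a \<Rightarrow> 'a) \<times> 'a \<Rightarrow> ('a \<Rightarrow> 'a) \<times> ('a \<Rightarrow> 'a) \<times> 'a" where
  "relabel \<pi> = (\<lambda>(\<alpha>, \<sigma>, r). (\<pi> \<circ> \<alpha> \<circ> inv \<pi>, \<pi> \<circ> \<sigma> \<circ> inv \<pi>, \<pi> r))"

text \<open>With a single face, iterating \<open>\<sigma> \<circ> \<alpha>\<close> already reaches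
  every dart, so connectivity is automatic. Euler's formula with \<open>n\<close> edges and one face
  then fixes the number of vertices.\<close>

lemma unicellular_maps_iff:
  assumes "n \<ge> 1"
  shows "(\<alpha>, \<sigma>, r) \<in> unicellular_maps g n \<longleftrightarrow>
    \<alpha> \<in> fpf_involutions {..<2 * n} \<and> \<sigma> permutes {..<2 * n} \<and> r < 2 * n \<and>
    card (cycles_on (\<sigma> \<circ> \<alpha>) {..<2 * n}) = 1 \<and> card (cycles_on \<sigma> {..<2 * n}) + 2 * g = n + 1"
proof -
  let ?D = "{..<2 * n}"
  have conn: "(d, e) \<in> {(x, y). y = \<alpha> x \<or> y = \<sigma> x}\<^sup>*"
    if \<alpha>: "\<alpha> permutes ?D" and \<sigma>: "\<sigma> permutes ?D" and 1: "card (cycles_on (\<sigma> \<circ> \<alpha>) ?D) = 1"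
      and d: "d < 2 * n" "e < 2 * n" for d e
  proof -
    let ?R = "{(x, y). y = \<alpha> x \<or> y = \<sigma> x}"
    have p: "\<sigma> \<circ> \<alpha> permutes ?D" by (rule permutes_compose[OF \<alpha> \<sigma>])
    obtain z where z: "cycles_on (\<sigma> \<circ> \<alpha>) ?D = {z}" using 1 card_1_singletonE by blast
    have "orbit (\<sigma> \<circ> \<alpha>) d = orbit (\<sigma> \<circ> \<alpha>) e"
      using orbit_in_cycles_on[of d ?D "\<sigma> \<circ> \<alpha>"] orbit_in_cycles_on[of e ?D "\<sigma> \<circ> \<alpha>"] d z by auto
    hence "e \<in> orbit (\<sigma> \<circ> \<alpha>) d" using self_in_orbit[OF p] by blast
    thus "(d, e) \<in> ?R\<^sup>*"
    proof (induction rule: orbit.induct)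
      case base
      have "(d, \<alpha> d) \<in> ?R" "(\<alpha> d, (\<sigma> \<circ> \<alpha>) d) \<in> ?R" by auto
      thus ?case by (meson r_into_rtrancl rtrancl_into_rtrancl)
    next
      case (step y)
      have "(y, \<alpha> y) \<in> ?R" "(\<alpha> y, (\<sigma> \<circ> \<alpha>) y) \<in> ?R" by auto
      thus ?case using step by (meson rtrancl_into_rtrancl)
    qed
  qed
  have cyc\<alpha>: "card (cycles_on \<alpha> ?D) = n" if "\<alpha> \<in> fpf_involutions ?D"
    using card_cycles_involution[of ?D \<alpha>] fpf_involutions_D[OF that] by simp
  have "(\<alpha>, \<sigma>, r) \<in> unicellular_maps g n \<longleftrightarrow>
      \<alpha> \<in> fpf_involutions ?D \<and> \<sigma> permutes ?D \<and> r < 2 * n \<and>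
      (\<forall>d<2 * n. \<forall>e<2 * n. (d, e) \<in> {(x, y). y = \<alpha> x \<or> y = \<sigma> x}\<^sup>*) \<and>
      card (cycles_on (\<sigma> \<circ> \<alpha>) ?D) = 1 \<and>
      int (card (cycles_on \<sigma> ?D)) - int (card (cycles_on \<alpha> ?D)) + 1 = 2 - 2 * int g"
    unfolding unicellular_maps_def rooted_maps_def fpf_involutions_def by auto
  also have "\<dots> \<longleftrightarrow> \<alpha> \<in> fpf_involutions ?D \<and> \<sigma> permutes ?D \<and> r < 2 * n \<and>
      card (cycles_on (\<sigma> \<circ> \<alpha>) ?D) = 1 \<and> card (cycles_on \<sigma> ?D) + 2 * g = n + 1"
  proof (cases "\<alpha> \<in> fpf_involutions ?D \<and> \<sigma> permutes ?D")
    case True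
    hence "(int (card (cycles_on \<sigma> ?D)) - int (card (cycles_on \<alpha> ?D)) + 1 = 2 - 2 * int g) \<longleftrightarrow>
        card (cycles_on \<sigma> ?D) + 2 * g = n + 1"
      using cyc\<alpha> by simp linarith
    moreover have "\<alpha> permutes ?D" using True fpf_involutions_D(1) by blast
    ultimately show ?thesis using conn True by blast
  qed blast
  finally show ?thesis .
qed

lemma relabel_unicellular:
  assumes n: "n \<ge> 1" and \<pi>: "\<pi> permutes {..<2 * n}" and M: "M \<in> unicellular_maps g n"
  shows "relabel \<pi> M \<in> unicellular_maps g n"
proof -
  let ?D = "{..<2 * n}"
  obtain \<alpha> \<sigma> r where M': "M = (\<alpha>, \<sigma>, r)" by (cases M) auto
  from M have *: "\<alpha> \<in> fpf_involutions ?D" "\<sigma> permutes ?D" "r < 2 * n"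
      "card (cycles_on (\<sigma> \<circ> \<alpha>) ?D) = 1" "card (cycles_on \<sigma> ?D) + 2 * g = n + 1"
    unfolding M' unicellular_maps_iff[OF n] by auto
  note \<alpha>D = fpf_involutions_D[OF *(1)]
  have inv: "inv \<pi> permutes ?D" using \<pi> by (rule permutes_inv)
  have cj: "\<pi> \<circ> p \<circ> inv \<pi> permutes ?D \<and> card (cycles_on (\<pi> \<circ> p \<circ> inv \<pi>) ?D) = card (cycles_on p ?D)"
    if p: "p permutes ?D" for p
  proof
    show "\<pi> \<circ> p \<circ> inv \<pi> permutes ?D"
      using p \<pi> inv by (metis permutes_compose o_assoc)
    show "card (cycles_on (\<pi> \<circ> p \<circ> inv \<pi>) ?D) = card (cycles_on p ?D)"
      by (rule card_cycles_on_conj_perm[OF p _ \<pi>]) (auto simp: fun_eq_iff permutes_inverses(2)[OF \<pi>])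
  qed
  have "\<pi> \<circ> \<alpha> \<circ> inv \<pi> \<in> fpf_involutions ?D"
  proof -
    have "(\<pi> \<circ> \<alpha> \<circ> inv \<pi>) d \<noteq> d \<and> (\<pi> \<circ> \<alpha> \<circ> inv \<pi>) ((\<pi> \<circ> \<alpha> \<circ> inv \<pi>) d) = d" if "d \<in> ?D" for d
    proof -
      have "inv \<pi> d \<in> ?D" using permutes_in_image[OF inv] that by blast
      from \<alpha>D(3,4)[OF this] show ?thesis
        using permutes_inverses[OF \<pi>] by (metis comp_apply)
    qed
    thus ?thesis using cj[OF \<alpha>D(1)] by (simp add: fpf_involutions_def)
  qed
  moreover have "(\<pi> \<circ> \<sigma> \<circ> inv \<pi>) \<circ> (\<pi> \<circ> \<alpha> \<circ> inv \<pi>) = \<pi> \<circ> (\<sigma> \<circ> \<alpha>) \<circ> inv \<pi>"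
    by (simp add: fun_eq_iff permutes_inverses(2)[OF \<pi>])
  moreover have "\<pi> r < 2 * n" using permutes_in_image[OF \<pi>] *(3) by blast
  ultimately show ?thesis
    using cj[OF *(2)] cj[OF permutes_compose[OF \<alpha>D(1) *(2)]] *
    unfolding M' relabel_def prod.case unicellular_maps_iff[OF n] by simp
qed

lemma map_iso_iff_relabel:
  "(M, M') \<in> map_iso n \<longleftrightarrow> (\<exists>\<pi>. \<pi> permutes {..<2 * n} \<and> M' = relabel \<pi> M)"
proof -
  obtain \<alpha> \<sigma> r \<alpha>' \<sigma>' r' where M: "M = (\<alpha>, \<sigma>, r)" "M' = (\<alpha>', \<sigma>', r')" by (cases M, cases M') auto
  have "\<pi> \<circ> p = q \<circ> \<pi> \<longleftrightarrow> q = \<pi> \<circ> p \<circ> inv \<pi>" if \<pi>: "\<pi> permutes {..<2 * n}" for \<pi> p q :: "nat \<Rightarrow> nat"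
  proof
    assume "\<pi> \<circ> p = q \<circ> \<pi>"
    hence "\<pi> \<circ> p \<circ> inv \<pi> = q \<circ> (\<pi> \<circ> inv \<pi>)" by (simp add: o_assoc)
    thus "q = \<pi> \<circ> p \<circ> inv \<pi>" using permutes_inv_o(1)[OF \<pi>] by simp
  next
    assume "q = \<pi> \<circ> p \<circ> inv \<pi>"
    thus "\<pi> \<circ> p = q \<circ> \<pi>" using permutes_inverses(2)[OF \<pi>] by (simp add: fun_eq_iff)
  qed
  thus ?thesis unfolding M map_iso_def relabel_def by auto
qed

text \<open>
  An automorphism fixing the root commutes with the single face cycle, hence is the identity:
  every isomorphism class consists of \<open>(2n)!\<close> labelled maps.
\<close>

lemma inj_on_relabel:
  assumes n: "n \<ge> 1" and M: "M \<in> unicellular_maps g n"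
  shows "inj_on (\<lambda>\<pi>. relabel \<pi> M) {\<pi>. \<pi> permutes {..<2 * n}}"
proof
  let ?D = "{..<2 * n}"
  fix \<pi> \<rho> assume \<pi>: "\<pi> \<in> {\<pi>. \<pi> permutes ?D}" and \<rho>: "\<rho> \<in> {\<pi>. \<pi> permutes ?D}"
    and eq: "relabel \<pi> M = relabel \<rho> M"
  obtain \<alpha> \<sigma> r where M': "M = (\<alpha>, \<sigma>, r)" by (cases M) auto
  from M have *: "\<alpha> permutes ?D" "\<sigma> permutes ?D" "r < 2 * n" "card (cycles_on (\<sigma> \<circ> \<alpha>) ?D) = 1"
    unfolding M' unicellular_maps_iff[OF n] using fpf_involutions_D(1) by auto
  from eq have e: "\<pi> \<circ> \<alpha> \<circ> inv \<pi> = \<rho> \<circ> \<alpha> \<circ> inv \<rho>" "\<pi> \<circ> \<sigma> \<circ> inv \<pi> = \<rho> \<circ> \<sigma> \<circ> inv \<rho>" "\<pi> r = \<rho> r"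
    by (auto simp: M' relabel_def)
  have tr: "\<pi> (p y) = \<rho> (p y)" if "\<pi> \<circ> p \<circ> inv \<pi> = \<rho> \<circ> p \<circ> inv \<rho>" "\<pi> y = \<rho> y" for p y
  proof -
    have "\<pi> (p y) = (\<pi> \<circ> p \<circ> inv \<pi>) (\<pi> y)" using permutes_inverses(2)[of \<pi> ?D y] \<pi> by simp
    also have "\<dots> = (\<rho> \<circ> p \<circ> inv \<rho>) (\<rho> y)" using that by simp
    also have "\<dots> = \<rho> (p y)" using permutes_inverses(2)[of \<rho> ?D y] \<rho> by simp
    finally show ?thesis .
  qed
  have orb: "\<pi> y = \<rho> y" if "y \<in> orbit (\<sigma> \<circ> \<alpha>) r" for y
    using that by (induction rule: orbit.induct) (use tr[OF e(1)] tr[OF e(2)] e(3) in auto)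
  have p: "\<sigma> \<circ> \<alpha> permutes ?D" by (rule permutes_compose[OF *(1,2)])
  obtain z where z: "cycles_on (\<sigma> \<circ> \<alpha>) ?D = {z}" using *(4) card_1_singletonE by blast
  hence "z = orbit (\<sigma> \<circ> \<alpha>) r" using orbit_in_cycles_on[of r ?D "\<sigma> \<circ> \<alpha>"] *(3) by auto
  hence D: "orbit (\<sigma> \<circ> \<alpha>) r = ?D" using Union_cycles_on[OF p] z by auto
  show "\<pi> = \<rho>"
  proof
    fix y show "\<pi> y = \<rho> y"
      using orb[of y] permutes_not_in[of \<pi> ?D y] permutes_not_in[of \<rho> ?D y] \<pi> \<rho>
      unfolding D by (cases "y \<in> ?D") auto
  qed
qed

lemma finite_unicellular_maps: "n \<ge> 1 \<Longrightarrow> finite (unicellular_maps g n)"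
  by (rule finite_subset[of _ "{p. p permutes {..<2 * n}} \<times> {p. p permutes {..<2 * n}} \<times> {..<2 * n}"])
     (auto simp: unicellular_maps_def rooted_maps_def finite_permutations)

lemma fact_times_eps:
  assumes n: "n \<ge> 1"
  shows "fact (2 * n) * eps g n = card (unicellular_maps g n)"
proof -
  define U where "U = unicellular_maps g n"
  define R where "R = map_iso n \<inter> U \<times> U"
  let ?P = "{\<pi>. \<pi> permutes {..<2 * n}}"
  have R_iff: "(M, M') \<in> R \<longleftrightarrow> M \<in> U \<and> (\<exists>\<pi>. \<pi> permutes {..<2 * n} \<and> M' = relabel \<pi> M)" for M M'
  proof -
    have "(M, M') \<in> R \<longleftrightarrow> (M, M') \<in> map_iso n \<and> M \<in> U \<and> M' \<in> U" unfolding R_def by blast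
    thus ?thesis
      using relabel_unicellular[OF n, of _ M g, folded U_def] map_iso_iff_relabel[of M M' n] by blast
  qed
  have comp: "relabel \<rho> (relabel \<pi> M) = relabel (\<rho> \<circ> \<pi>) M"
    if "\<pi> permutes {..<2 * n}" "\<rho> permutes {..<2 * n}" for \<pi> \<rho> and M :: rooted_cmap
    using that by (cases M) (simp add: relabel_def o_inv_distrib permutes_bij o_assoc)
  have rid: "relabel id M = M" for M :: rooted_cmap by (cases M) (simp add: relabel_def)
  have equiv: "equiv U R"
  proof (rule equivI)
    show "R \<subseteq> U \<times> U" by (auto simp: R_def)
    show "refl_on U R"
      using rid by (auto simp: refl_on_def R_iff intro!: exI[of _ id])
    show "sym R"
    proof (rule symI)
      fix M M' assume MM': "(M, M') \<in> R"
      then obtain \<pi> where \<pi>: "\<pi> permutes {..<2 * n}" "M' = relabel \<pi> M" using R_iff by blast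
      have "relabel (inv \<pi>) M' = M"
        unfolding \<pi>(2) comp[OF \<pi>(1) permutes_inv[OF \<pi>(1)]] permutes_inv_o(2)[OF \<pi>(1)] by (rule rid)
      moreover have "M' \<in> U" using MM' by (auto simp: R_def)
      ultimately show "(M', M) \<in> R" using permutes_inv[OF \<pi>(1)] R_iff by metis
    qed
    show "trans R"
    proof (rule transI)
      fix M M' M'' assume "(M, M') \<in> R" "(M', M'') \<in> R"
      then obtain \<pi> \<rho> where "M \<in> U" "\<pi> permutes {..<2 * n}" "M' = relabel \<pi> M"
          "\<rho> permutes {..<2 * n}" "M'' = relabel \<rho> M'" using R_iff by blast
      thus "(M, M'') \<in> R" using comp permutes_compose R_iff by metis
    qed
  qed
  have finU: "finite U" using finite_unicellular_maps[OF n] by (simp add: U_def)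
  have "fact (2 * n) * card (U // R) = card (\<Union> (U // R))"
  proof (rule card_partition)
    show "finite (U // R)"
      by (rule finite_quotient[OF finU]) (auto simp: R_def)
    show "finite (\<Union> (U // R))" using finU Union_quotient[OF equiv] by simp
    show "card c = fact (2 * n)" if "c \<in> U // R" for c
    proof -
      from that obtain M where M: "M \<in> U" "c = R `` {M}" by (rule quotientE)
      have "c = (\<lambda>\<pi>. relabel \<pi> M) ` ?P" 
        unfolding M(2) by (rule set_eqI) (unfold Image_singleton_iff R_iff, use M(1) in blast)
      thus ?thesis
        using inj_on_relabel[OF n, of M g] M(1) by (simp add: card_image card_permutations U_def)
    qed
    show "c \<inter> c' = {}" if "c \<in> U // R" "c' \<in> U // R" "c \<noteq> c'" for c c'
      using quotient_disj[OF equiv that(1,2)] that(3) by blast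
  qed
  thus ?thesis using n Union_quotient[OF equiv] by (simp add: eps_def U_def R_def)
qed

text \<open>A map is given by its edges \<open>\<alpha>\<close>, its face cycle
  \<open>c = \<sigma> \<circ> \<alpha>\<close> and one of \<open>2 * n\<close> roots. As
  \<open>\<alpha>\<close> is an involution, \<open>\<sigma> = c \<circ> \<alpha>\<close>, so the
  cycles of \<open>c \<circ> \<alpha>\<close> are the vertices.\<close>

lemma card_unicellular_maps:
  assumes n: "n \<ge> 1" and g: "2 * g \<le> n + 1"
  shows "card (unicellular_maps g n) = (\<Sum>\<alpha>\<in>fpf_involutions {..<2 * n}. 2 * n *
    card {c. c permutes {..<2 * n} \<and> card (cycles_on c {..<2 * n}) = 1 \<and>
      card (cycles_on (c \<circ> \<alpha>) {..<2 * n}) = n + 1 - 2 * g})"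
proof -
  let ?D = "{..<2 * n}"
  define X where "X = (\<lambda>\<alpha>. {c. c permutes ?D \<and> card (cycles_on c ?D) = 1 \<and>
      card (cycles_on (c \<circ> \<alpha>) ?D) = n + 1 - 2 * g})"
  have invo: "\<alpha> \<circ> \<alpha> = id" if "\<alpha> \<in> fpf_involutions ?D" for \<alpha>
  proof
    fix d show "(\<alpha> \<circ> \<alpha>) d = id d"
      using fpf_involutions_D(4)[OF that, of d] permutes_not_in[OF fpf_involutions_D(1)[OF that], of d]
      by (cases "d \<in> ?D") auto
  qed
  have "bij_betw (\<lambda>(\<alpha>, c, r). (\<alpha>, c \<circ> \<alpha>, r)) (SIGMA \<alpha>:fpf_involutions ?D. X \<alpha> \<times> ?D) (unicellular_maps g n)"
  proof (rule bij_betwI[where g = "\<lambda>(\<alpha>, \<sigma>, r). (\<alpha>, \<sigma> \<circ> \<alpha>, r)"])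
    show "(\<lambda>(\<alpha>, c, r). (\<alpha>, c \<circ> \<alpha>, r)) \<in> (SIGMA \<alpha>:fpf_involutions ?D. X \<alpha> \<times> ?D) \<rightarrow> unicellular_maps g n"
    proof clarify
      fix \<alpha> c r assume \<alpha>: "\<alpha> \<in> fpf_involutions ?D" and c: "c \<in> X \<alpha>" and r: "r < 2 * n"
      have "c \<circ> \<alpha> \<circ> \<alpha> = c" using invo[OF \<alpha>] by (simp only: o_assoc[symmetric] comp_id)
      thus "(\<alpha>, c \<circ> \<alpha>, r) \<in> unicellular_maps g n"
        unfolding unicellular_maps_iff[OF n]
        using \<alpha> c r g permutes_compose[OF fpf_involutions_D(1)[OF \<alpha>]] by (auto simp: X_def)
    qed
    show "(\<lambda>(\<alpha>, \<sigma>, r). (\<alpha>, \<sigma> \<circ> \<alpha>, r)) \<in> unicellular_maps g n \<rightarrow> (SIGMA \<alpha>:fpf_involutions ?D. X \<alpha> \<times> ?D)"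
    proof clarify
      fix \<alpha> \<sigma> r assume M: "(\<alpha>, \<sigma>, r) \<in> unicellular_maps g n"
      hence \<alpha>: "\<alpha> \<in> fpf_involutions ?D" unfolding unicellular_maps_iff[OF n] by blast
      have "\<sigma> \<circ> \<alpha> \<circ> \<alpha> = \<sigma>" using invo[OF \<alpha>] by (simp only: o_assoc[symmetric] comp_id)
      thus "\<alpha> \<in> fpf_involutions ?D \<and> (\<sigma> \<circ> \<alpha>, r) \<in> X \<alpha> \<times> ?D"
        using M permutes_compose[OF fpf_involutions_D(1)[OF \<alpha>], of \<sigma>]
        unfolding unicellular_maps_iff[OF n] by (auto simp: X_def)
    qed
    fix z assume "z \<in> (SIGMA \<alpha>:fpf_involutions ?D. X \<alpha> \<times> ?D)"
    then obtain \<alpha> c r where z: "z = (\<alpha>, c, r)" "\<alpha> \<in> fpf_involutions ?D" by auto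
    show "(case case z of (\<alpha>, c, r) \<Rightarrow> (\<alpha>, c \<circ> \<alpha>, r) of (\<alpha>, \<sigma>, r) \<Rightarrow> (\<alpha>, \<sigma> \<circ> \<alpha>, r)) = z"
      using invo[OF z(2)] z(1) by (simp only: prod.case o_assoc[symmetric] comp_id)
  next
    fix z assume z: "z \<in> unicellular_maps g n"
    obtain \<alpha> \<sigma> r where z': "z = (\<alpha>, \<sigma>, r)" by (cases z) auto
    hence "\<alpha> \<in> fpf_involutions ?D" using z unicellular_maps_iff[OF n] by blast
    from invo[OF this] show "(case case z of (\<alpha>, \<sigma>, r) \<Rightarrow> (\<alpha>, \<sigma> \<circ> \<alpha>, r) of (\<alpha>, c, r) \<Rightarrow> (\<alpha>, c \<circ> \<alpha>, r)) = z"
      unfolding z' by (simp only: prod.case o_assoc[symmetric] comp_id)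
  qed
  hence "card (unicellular_maps g n) = card (SIGMA \<alpha>:fpf_involutions ?D. X \<alpha> \<times> ?D)"
    by (rule bij_betw_same_card[symmetric])
  also have "\<dots> = (\<Sum>\<alpha>\<in>fpf_involutions ?D. card (X \<alpha> \<times> ?D))"
  proof (rule card_SigmaI)
    show "finite (fpf_involutions ?D)"
      by (rule finite_subset[of _ "{p. p permutes ?D}"]) (auto simp: fpf_involutions_def finite_permutations)
    have "finite (X \<alpha>)" for \<alpha>
      by (rule finite_subset[of _ "{p. p permutes ?D}"]) (auto simp: X_def finite_permutations)
    thus "\<forall>\<alpha>\<in>fpf_involutions ?D. finite (X \<alpha> \<times> ?D)" by simp
  qed
  finally show ?thesis by (simp add: card_cartesian_product X_def mult.commute)
qed

theorem eps_formula:
  assumes n: "n \<ge> 1"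
  shows "real (eps g n) =
    (if 2 * g \<le> n + 1 then fact (2 * n) / (fact n * 2 ^ (2 * g)) * opart_coeff g (n + 1 - 2 * g) else 0)"
proof (cases "2 * g \<le> n + 1")
  case True
  define v where "v = n + 1 - 2 * g"
  have "fact (2 * n) * real (eps g n) = real (fact (2 * n) * eps g n)" by simp
  also have "\<dots> = (\<Sum>\<alpha>\<in>fpf_involutions {..<2 * n}. real (2 * n) *
      (fact (2 * n - 1) / 2 * 2 ^ v * opart_coeff g v))"
    unfolding fact_times_eps[OF n] card_unicellular_maps[OF n True] of_nat_sum of_nat_mult v_def
    by (intro sum.cong refl) (subst card_long_cycles, use n True in auto)
  also have "\<dots> = fact (2 * n) / (2 ^ n * fact n) * (real (2 * n) *
      (fact (2 * n - 1) / 2 * 2 ^ v * opart_coeff g v))"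
    by (simp add: card_fpf_involutions[of "{..<2 * n}" n])
  also have "real (2 * n) * (fact (2 * n - 1) / 2 * 2 ^ v * opart_coeff g v) =
      fact (2 * n) * (2 ^ v / 2 * opart_coeff g v)"
    using fact_reduce[of "2 * n", where 'a = real] n by simp
  finally have eps: "real (eps g n) = fact (2 * n) / fact n * opart_coeff g v * (2 ^ v / 2 / 2 ^ n)"
    by (simp add: field_simps)
  \<comment> \<open>Here \<open>2 ^ (2 * g)\<close> appears: it is what remains of the powers of
    \<open>2 x\<close>, the factor 1/2 in the sum over long cycles and the \<open>2 ^ n\<close> in
    the number of involutions.\<close>
  have "(2 :: real) ^ v * 2 ^ (2 * g) = 2 * 2 ^ n"
    using True by (simp add: v_def flip: power_add power_Suc)
  hence "2 ^ v / 2 / 2 ^ n = (1 :: real) / 2 ^ (2 * g)" by (simp add: field_simps)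
  thus ?thesis unfolding eps using True by (simp add: v_def)
next
  case False
  have "unicellular_maps g n = {}"
  proof -
    have "M \<notin> unicellular_maps g n" for M
      using False by (cases M) (simp add: unicellular_maps_iff[OF n])
    thus ?thesis by blast
  qed
  hence "fact (2 * n) * eps g n = 0" using fact_times_eps[OF n, of g] by simp
  thus ?thesis using False by simp
qed


section \<open>Powers of z / (1 - 4z)\<close>

text \<open>The expansion of \<open>z^m / (1 - 4z)^(m + 1/2)\<close>, which is what the monomial
  \<open>z^m\<close> of the Harer-Zagier polynomial contributes to \<open>C_series\<close>.\<close>

definition central_fps :: "nat \<Rightarrow> real fps" where
  "central_fps m = Abs_fps (\<lambda>n. if n < m then 0 else
     fact (2 * n) * fact m / (fact n * fact (n - m) * fact (2 * m)))"

abbreviation Q4 :: "real fps" where "Q4 \<equiv> 1 - 4 * fps_X"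

lemma Q4_nth_mult: "fps_nth (Q4 * f) n = fps_nth f n - (if n = 0 then 0 else 4 * fps_nth f (n - 1))"
  by (simp add: left_diff_distrib mult.assoc numeral_fps_const)

lemma Q4_nz: "Q4 \<noteq> 0" "fps_nth Q4 0 = 1"
  by (auto simp: fps_eq_iff numeral_fps_const intro!: exI[of _ 0])

lemma central_fps_Suc: "Q4 * central_fps (Suc m) = fps_X * central_fps m"
proof (rule fps_ext)
  fix n
  show "fps_nth (Q4 * central_fps (Suc m)) n = fps_nth (fps_X * central_fps m) n"
  proof (cases "n \<le> m")
    case True
    then show ?thesis unfolding Q4_nth_mult by (auto simp: central_fps_def)
  next
    case False
    then obtain j where n: "n = Suc (m + j)" by (metis add_Suc_right less_imp_Suc_add not_le)
    have f2: "fact (2 * Suc k) = 2 * (2 * real k + 1) * (real k + 1) * fact (2 * k)" for k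
      by (simp add: algebra_simps)
    show ?thesis
    proof (cases j)
      case 0
      show ?thesis unfolding Q4_nth_mult n 0
        by (simp add: central_fps_def)
    next
      case (Suc i)
      have "fps_nth (Q4 * central_fps (Suc m)) n =
          fact (2 * Suc (m + j)) * fact (Suc m) / (fact (Suc (m + j)) * fact (Suc i) * fact (2 * Suc m)) -
          4 * (fact (2 * (m + j)) * fact (Suc m) / (fact (m + j) * fact i * fact (2 * Suc m)))"
        unfolding Q4_nth_mult by (simp add: central_fps_def n Suc del: fact_Suc mult_Suc_right)
      also have "\<dots> = fact (2 * (m + j)) * fact m / (fact (m + j) * fact j * fact (2 * m))"
      proof -
        define a :: real where "a = fact (2 * (m + j))"
        define b :: real where "b = fact (m + j)"
        define c :: real where "c = fact i"
        define d :: real where "d = fact (2 * m)"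
        define e :: real where "e = fact m"
        have nz: "a \<noteq> 0" "b \<noteq> 0" "c \<noteq> 0" "d \<noteq> 0" "e \<noteq> 0"
          by (simp_all add: a_def b_def c_def d_def e_def)
        have pos: "real m + 1 \<noteq> 0" "2 * real m + 1 \<noteq> 0" "real m + real i + 2 \<noteq> 0" "real i + 1 \<noteq> 0"
          by linarith+
        have f: "fact (Suc m) = (real m + 1) * e" "fact (Suc (m + j)) = (real m + real i + 2) * b"
          "fact (Suc i) = (real i + 1) * c" "fact j = (real i + 1) * c"
          by (simp_all add: e_def b_def c_def Suc algebra_simps)
        show ?thesis
          unfolding f2 f a_def[symmetric] b_def[symmetric] c_def[symmetric] d_def[symmetric] e_def[symmetric]
          using nz pos by (simp add: Suc divide_simps) (simp add: algebra_simps)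
      qed
      also have "\<dots> = fps_nth (fps_X * central_fps m) n"
        by (simp add: central_fps_def n)
      finally show ?thesis .
    qed
  qed
qed

lemma central_fps_0_nth: "fps_nth (central_fps 0) n = fact (2 * n) / (fact n * fact n)"
  by (simp add: central_fps_def)

text \<open>The differential equation of \<open>(1 - 4z)^(-1/2)\<close>; on coefficients it is the
  ratio of consecutive central binomial coefficients.\<close>

lemma central_fps_0_deriv: "Q4 * fps_deriv (central_fps 0) = 2 * central_fps 0"
proof (rule fps_ext)
  fix n
  have f2: "fact (2 * Suc k) = 2 * (2 * real k + 1) * (real k + 1) * fact (2 * k)" for k
    by (simp add: algebra_simps)
  have D: "fps_nth (fps_deriv (central_fps 0)) k = 2 * (2 * real k + 1) * fps_nth (central_fps 0) k" for k
  proof -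
    have "real k + 1 \<noteq> 0" by linarith
    thus ?thesis
      unfolding fps_deriv_nth central_fps_0_nth Suc_eq_plus1[symmetric] f2
      by (simp add: divide_simps)
  qed
  show "fps_nth (Q4 * fps_deriv (central_fps 0)) n = fps_nth (2 * central_fps 0) n"
  proof (cases n)
    case 0
    then show ?thesis unfolding Q4_nth_mult D by (simp add: numeral_fps_const)
  next
    case (Suc k)
    have "real k + 1 \<noteq> 0" by linarith
    hence "fps_nth (central_fps 0) (Suc k) * (real k + 1) = 2 * (2 * real k + 1) * fps_nth (central_fps 0) k"
      unfolding central_fps_0_nth f2 by (simp add: divide_simps) (simp add: algebra_simps)
    thus ?thesis unfolding Q4_nth_mult D by (simp add: Suc numeral_fps_const algebra_simps)
  qed
qed

text \<open>By the differential equation the product has derivative 0, so it equals its constant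
  term.\<close>

lemma central_fps_0_square: "central_fps 0 * central_fps 0 * Q4 = 1"
proof -
  let ?S = "central_fps 0"
  have dQ: "fps_deriv Q4 = -4" by (simp add: numeral_fps_const)
  have "fps_deriv (?S * ?S * Q4) = 2 * ?S * (Q4 * fps_deriv ?S) + ?S * ?S * fps_deriv Q4"
    by (simp only: fps_deriv_mult) (simp add: algebra_simps)
  also have "\<dots> = 0" unfolding central_fps_0_deriv dQ by (simp add: algebra_simps)
  finally have "?S * ?S * Q4 = fps_const (fps_nth (?S * ?S * Q4) 0)"
    by (rule iffD1[OF fps_deriv_eq_0_iff])
  thus ?thesis by (simp add: central_fps_0_nth)
qed

text \<open>The inverse of \<open>central_fps 0\<close> squares to \<open>Q4\<close>, and its
  constant term 1 identifies it as the branch chosen by \<open>fps_radical\<close>.\<close>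

lemma central_fps_0_eq: "central_fps 0 = 1 / fps_radical root 2 Q4"
proof -
  have S0: "fps_nth (central_fps 0) 0 = 1" by (simp add: central_fps_0_nth)
  have I: "inverse (central_fps 0) * central_fps 0 = 1" using S0 by (intro inverse_mult_eq_1) simp
  have "(inverse (central_fps 0)) ^ Suc 1 = (inverse (central_fps 0)) ^ 2 * (central_fps 0 * central_fps 0 * Q4)"
    using central_fps_0_square by (simp add: numeral_2_eq_2)
  also have "\<dots> = (inverse (central_fps 0) * central_fps 0) ^ 2 * Q4"
    by (simp add: power2_eq_square algebra_simps)
  finally have "(inverse (central_fps 0)) ^ Suc 1 = Q4" by (simp add: I)
  hence "fps_radical root (Suc 1) Q4 = inverse (central_fps 0)"
    using radical_unique[of root 1 Q4 "inverse (central_fps 0)"] S0 by simp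
  hence "fps_radical root 2 Q4 = inverse (central_fps 0)" by (simp add: numeral_2_eq_2)
  thus ?thesis using I S0 by (simp add: fps_divide_unit fps_inverse_idempotent)
qed

lemma central_fps_eq: "central_fps m = 1 / fps_radical root 2 Q4 * (fps_X / Q4) ^ m"
proof (induction m)
  case 0
  then show ?case by (simp add: central_fps_0_eq)
next
  case (Suc m)
  have "central_fps (Suc m) = fps_X / Q4 * central_fps m"
  proof -
    have "fps_X / Q4 * central_fps m = inverse Q4 * (fps_X * central_fps m)"
      by (simp add: fps_divide_unit algebra_simps)
    also have "\<dots> = (inverse Q4 * Q4) * central_fps (Suc m)"
      unfolding central_fps_Suc[symmetric] by (simp only: mult.assoc)
    also have "inverse Q4 * Q4 = 1" by (intro inverse_mult_eq_1) (simp add: Q4_nz)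
    finally show ?thesis by simp
  qed
  thus ?case using Suc by (simp add: algebra_simps)
qed

lemma fps_of_poly_sum_monom_compose:
  fixes h :: "real fps"
  assumes "finite I" "fps_nth h 0 = 0"
  shows "fps_compose (fps_of_poly (\<Sum>i\<in>I. monom (c i) (e i))) h = (\<Sum>i\<in>I. fps_const (c i) * h ^ e i)"
proof -
  have "fps_compose (fps_of_poly (monom a k)) h = fps_const a * h ^ k" for a k
    using assms(2) by (simp add: fps_of_poly_monom fps_compose_mult_distrib fps_X_power_compose)
  thus ?thesis by (simp add: fps_of_poly_sum fps_compose_sum_distrib)
qed

lemma fps_X_div_Q4: "fps_nth (fps_X / Q4) 0 = 0" "fps_X / Q4 \<noteq> 0"
proof -
  have eq: "fps_X / Q4 = fps_X * inverse Q4" by (simp add: fps_divide_unit)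
  show "fps_nth (fps_X / Q4) 0 = 0" unfolding eq by simp
  have "fps_nth (fps_X * inverse Q4) 1 = 1" by simp
  thus "fps_X / Q4 \<noteq> 0" unfolding eq by (metis fps_zero_nth zero_neq_one)
qed

section \<open>Uniqueness of the Harer-Zagier polynomial\<close>

lemma is_K_star_unique:
  assumes "is_K_star g K" "is_K_star g K'"
  shows "K = K'"
proof -
  let ?h = "fps_X / Q4" and ?r = "1 / fps_radical root 2 Q4"
  have "?r * fps_compose (fps_of_poly K) ?h = ?r * fps_compose (fps_of_poly K') ?h"
    using assms by (simp add: is_K_star_def)
  moreover have "?r \<noteq> 0"
  proof -
    have "fps_nth (central_fps 0) 0 = 1" by (simp add: central_fps_0_nth)
    thus ?thesis unfolding central_fps_0_eq[symmetric] by (metis fps_zero_nth zero_neq_one)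
  qed
  ultimately have "fps_compose (fps_of_poly K) ?h = fps_compose (fps_of_poly K') ?h" by simp
  hence "fps_compose (fps_of_poly (K - K')) ?h = 0"
    by (simp add: fps_of_poly_diff fps_compose_sub_distrib)
  hence "fps_of_poly (K - K') = 0"
    using fps_X_div_Q4 by (simp add: fps_compose_eq_0_iff)
  thus ?thesis by simp
qed


section \<open>Plane trees\<close>

definition catalan_fps :: "real fps" where
  "catalan_fps = Abs_fps (\<lambda>n. fact (2 * n) / (fact n * fact (n + 1)))"

text \<open>Write \<open>S\<close> for \<open>central_fps 0\<close> and \<open>K\<close> for the
  Catalan series. Then \<open>1 - 2 z K\<close> and \<open>(1 - 4z) S\<close> have the same
  derivative \<open>-2 S\<close> and the same constant term. Squaring their equality and using
  \<open>S^2 (1 - 4z) = 1\<close> gives the quadratic equation after cancelling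
  \<open>4z\<close>.\<close>

lemma catalan_fps_eq: "catalan_fps = 1 + fps_X * (catalan_fps * catalan_fps)"
proof -
  let ?S = "central_fps 0" and ?K = catalan_fps
  have dK: "fps_deriv (fps_X * ?K) = ?S"
  proof (rule fps_ext)
    fix n
    have "real n + 1 \<noteq> 0" by linarith
    thus "fps_nth (fps_deriv (fps_X * ?K)) n = fps_nth ?S n"
      unfolding fps_deriv_nth central_fps_0_nth
      by (simp add: catalan_fps_def divide_simps)
  qed
  have dQ: "fps_deriv Q4 = -4" by (simp add: numeral_fps_const)
  have d2: "fps_deriv (2 * f) = 2 * fps_deriv f" for f :: "real fps" by (simp add: numeral_fps_const)
  have "fps_deriv (1 - 2 * (fps_X * ?K) - Q4 * ?S) = - (2 * ?S) - (Q4 * fps_deriv ?S + fps_deriv Q4 * ?S)"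
    by (simp only: fps_deriv_sub fps_deriv_mult[of Q4] d2 dK fps_deriv_1) simp
  also have "\<dots> = 0" unfolding central_fps_0_deriv dQ by (simp add: algebra_simps)
  finally have "1 - 2 * (fps_X * ?K) - Q4 * ?S = fps_const (fps_nth (1 - 2 * (fps_X * ?K) - Q4 * ?S) 0)"
    by (rule iffD1[OF fps_deriv_eq_0_iff])
  also have "fps_nth (1 - 2 * (fps_X * ?K) - Q4 * ?S) 0 = 0"
    by (simp add: central_fps_0_nth)
  finally have P: "1 - 2 * (fps_X * ?K) = Q4 * ?S" by (simp only: fps_const_0_eq_0 right_minus_eq)
  have "(1 - 2 * (fps_X * ?K)) * (1 - 2 * (fps_X * ?K)) = (?S * ?S * Q4) * Q4"
    unfolding P by (simp only: ac_simps)
  hence "(4 * fps_X) * ?K = (4 * fps_X) * (1 + fps_X * (?K * ?K))"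
    unfolding central_fps_0_square by (simp add: algebra_simps)
  moreover have "4 * fps_X \<noteq> (0 :: real fps)"
  proof
    assume "4 * fps_X = (0 :: real fps)"
    hence "fps_nth (4 * fps_X :: real fps) 1 = 0" by (simp only: fps_zero_nth)
    thus False by (simp add: numeral_fps_const)
  qed
  ultimately show ?thesis using mult_left_cancel by blast
qed

lemma catalan_rec:
  "fps_nth catalan_fps (Suc n) = (\<Sum>i\<le>n. fps_nth catalan_fps i * fps_nth catalan_fps (n - i))"
proof -
  have "fps_nth catalan_fps (Suc n) = fps_nth (1 + fps_X * (catalan_fps * catalan_fps)) (Suc n)"
    using catalan_fps_eq by simp
  also have "\<dots> = fps_nth (catalan_fps * catalan_fps) n" by simp
  finally show ?thesis by (simp add: fps_mult_nth atLeast0AtMost)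
qed

text \<open>Cutting the edge to the first child of the root leaves the subtree of that child and the
  remaining tree. The redundant index \<open>i\<close> in \<open>P\<close> records the size of the
  subtree, so that the cardinality of \<open>P\<close> is the Catalan convolution.\<close>

lemma card_ptrees:
  "finite {T. num_edges T = n} \<and> real (card {T. num_edges T = n}) = fps_nth catalan_fps n"
proof (induction n rule: less_induct)
  case (less n)
  show ?case
  proof (cases n)
    case 0
    have "{T. num_edges T = 0} = {Node []}"
    proof -
      have "num_edges T = 0 \<longleftrightarrow> T = Node []" for T by (cases T) auto
      thus ?thesis by auto
    qed
    thus ?thesis by (simp add: 0 catalan_fps_def)
  next
    case (Suc m)
    define P where "P = (SIGMA i:{..m}. {T. num_edges T = i} \<times> {T. num_edges T = m - i})"
    have bij: "bij_betw (\<lambda>(i, t, T). Node (t # children T)) P {T. num_edges T = Suc m}"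
    proof (rule bij_betwI[where g = "\<lambda>T. (num_edges (hd (children T)), hd (children T), Node (tl (children T)))"])
      show "(\<lambda>(i, t, T). Node (t # children T)) \<in> P \<rightarrow> {T. num_edges T = Suc m}"
      proof
        fix z assume "z \<in> P"
        then obtain i t T where z: "z = (i, t, T)" "i \<le> m" "num_edges t = i" "num_edges T = m - i"
          by (auto simp: P_def)
        have "num_edges (Node (t # children T)) = num_edges t + 1 + num_edges T" by (cases T) simp
        thus "(case z of (i, t, T) \<Rightarrow> Node (t # children T)) \<in> {T. num_edges T = Suc m}"
          using z by simp
      qed
      have c: "\<exists>t ts. T = Node (t # ts)" if "num_edges T = Suc m" for T
      proof (cases T)
        case (Node ts)
        thus ?thesis using that by (cases ts) auto
      qed
      show "(\<lambda>T. (num_edges (hd (children T)), hd (children T), Node (tl (children T)))) \<in> {T. num_edges T = Suc m} \<rightarrow> P"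
      proof
        fix T assume "T \<in> {T. num_edges T = Suc m}"
        hence T: "num_edges T = Suc m" by simp
        obtain t ts where ts: "T = Node (t # ts)" using c[OF T] by blast
        have "num_edges T = num_edges t + 1 + num_edges (Node ts)" unfolding ts by simp
        thus "(num_edges (hd (children T)), hd (children T), Node (tl (children T))) \<in> P"
          using T by (simp add: ts P_def)
      qed
      show "(case case z of (i, t, T) \<Rightarrow> Node (t # children T) of T \<Rightarrow>
          (num_edges (hd (children T)), hd (children T), Node (tl (children T)))) = z" if "z \<in> P" for z
        using that by (auto simp: P_def)
      show "(case (num_edges (hd (children T)), hd (children T), Node (tl (children T))) of
          (i, t, T) \<Rightarrow> Node (t # children T)) = T" if "T \<in> {T. num_edges T = Suc m}" for T
        using c[of T] that by auto
    qed
    have IH: "finite {T. num_edges T = i}" "real (card {T. num_edges T = i}) = fps_nth catalan_fps i" if "i \<le> m" for i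
      using less[of i] that Suc by auto
    have finP: "finite P" unfolding P_def using IH by (intro finite_SigmaI finite_cartesian_product) auto
    hence "finite {T. num_edges T = n}" using bij_betw_finite[OF bij] Suc by simp
    moreover have "real (card {T. num_edges T = n}) = (\<Sum>i\<le>m. fps_nth catalan_fps i * fps_nth catalan_fps (m - i))"
    proof -
      have "card {T. num_edges T = n} = card P" using bij_betw_same_card[OF bij] Suc by simp
      also have "\<dots> = (\<Sum>i\<le>m. card {T. num_edges T = i} * card {T. num_edges T = m - i})"
        unfolding P_def using IH by (subst card_SigmaI) (auto simp: card_cartesian_product)
      finally show ?thesis using IH by simp
    qed
    ultimately show ?thesis using catalan_rec[of m] Suc by simp
  qed
qed

text \<open>Every vertex except the root is the child end of exactly one edge, and these edges are
  listed in preorder. This gives the contribution of parent edges to the degrees.\<close>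

lemma map_snd_tree_edges:
  "map snd (tree_edges i T) = [i + 1..<i + 1 + num_edges T]"
  "map snd (forest_edges p j ts) = [j..<j + (\<Sum>t\<leftarrow>ts. num_edges t + 1)]"
proof (induction i T and p j ts rule: tree_edges_forest_edges.induct)
  case (3 p j t ts)
  define s where "s = (\<Sum>t\<leftarrow>ts. num_edges t + 1)"
  have "[j..<j + (num_edges t + 1 + s)] = j # [j + 1..<(j + 1 + num_edges t) + s]"
    by (subst upt_conv_Cons) (simp_all add: add_ac)
  also have "[j + 1..<(j + 1 + num_edges t) + s] =
      [j + 1..<j + 1 + num_edges t] @ [j + 1 + num_edges t..<(j + 1 + num_edges t) + s]"
    by (rule upt_add_eq_append) simp
  also have "j + 1 + num_edges t = j + num_edges t + 1" by simp
  finally have "[j..<j + (\<Sum>t\<leftarrow>t # ts. num_edges t + 1)] =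
      j # [j + 1..<j + num_edges t + 1] @ [j + num_edges t + 1..<j + num_edges t + 1 + (\<Sum>t\<leftarrow>ts. num_edges t + 1)]"
    by (simp only: s_def list.map sum_list.Cons)
  moreover have "map snd (tree_edges j t) = [j + 1..<j + num_edges t + 1]" using 3(1) by (simp add: add_ac)
  ultimately show ?case by (simp only: forest_edges.simps list.map map_append 3(2) snd_conv append_Cons)
qed auto

section \<open>Permutations with odd cycles\<close>

text \<open>For finite \<open>S\<close>, all cycles have odd length at least 3: these are the
  permutations in O-trees without fixed points.\<close>

definition odd_perms :: "'a set \<Rightarrow> nat \<Rightarrow> ('a \<Rightarrow> 'a) set" where
  "odd_perms S t = {\<sigma>. \<sigma> permutes S \<and> (\<forall>c\<in>cycles_on \<sigma> S. odd (card c) \<and> card c \<noteq> 1) \<and>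
     card (cycles_on \<sigma> S) = t}"

lemma cycles_on_insert_fixpoint:
  assumes "p permutes A" "x \<notin> A"
  shows "cycles_on p (insert x A) = insert {x} (cycles_on p A)"
  using permutes_not_in[OF assms] by (simp add: cycles_on_def orbit_fixpoint)

text \<open>The product inserts \<open>y\<close> and \<open>z\<close> behind \<open>x\<close>: it
  sends \<open>x\<close> to \<open>y\<close>, \<open>y\<close> to \<open>z\<close> and
  \<open>z\<close> to \<open>p x\<close>. Each transposition joins a fixed point to the cycle of
  \<open>x\<close>.\<close>

lemma cycles_on_insert_two:
  assumes p: "p permutes S" "finite S" and x: "x \<in> S" and y: "y \<notin> S" and z: "z \<notin> S" "y \<noteq> z"
  shows "cycles_on (p \<circ> transpose x y \<circ> transpose y z) (insert z (insert y S)) =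
    insert (insert y (insert z (orbit p x))) (cycles_on p S - {orbit p x})"
    and "insert y (insert z (orbit p x)) \<notin> cycles_on p S"
proof -
  have sub: "c \<subseteq> S" if "c \<in> cycles_on p S" for c using Union_cycles_on[OF p] that by blast
  have ox: "orbit p x \<subseteq> S" using sub orbit_in_cycles_on[OF x] by blast
  show ny: "insert y (insert z (orbit p x)) \<notin> cycles_on p S" using sub y by blast
  define A where "A = insert y S"
  have pA: "p permutes A" unfolding A_def by (rule permutes_imp_permutes_insert[OF p(1)])
  have fA: "finite A" using p by (simp add: A_def)
  have oy: "orbit p y = {y}" by (rule orbit_fixpoint) (rule permutes_not_in[OF p(1) y])
  define q where "q = p \<circ> transpose x y"
  have ne: "orbit p x \<noteq> orbit p y" unfolding oy using ox y self_in_orbit[OF p, of x] x by blast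
  have "cycles_on q A = insert (orbit p x \<union> orbit p y) (cycles_on p A - {orbit p x, orbit p y})"
    unfolding q_def by (rule cycles_on_join[OF pA fA _ _ ne]) (use x in \<open>auto simp: A_def\<close>)
  also have "cycles_on p A = insert {y} (cycles_on p S)"
    unfolding A_def by (rule cycles_on_insert_fixpoint[OF p(1) y])
  also have "insert {y} (cycles_on p S) - {orbit p x, orbit p y} = cycles_on p S - {orbit p x}"
    using sub y by (auto simp: oy)
  finally have cq: "cycles_on q A = insert (insert y (orbit p x)) (cycles_on p S - {orbit p x})"
    by (simp add: oy)
  have q: "q permutes A" unfolding q_def using x
    by (intro permutes_compose[OF permutes_swap_id pA]) (auto simp: A_def)
  have oqy: "orbit q y = insert y (orbit p x)"
  proof -
    have "insert y (orbit p x) \<in> cycles_on q A" by (simp add: cq)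
    from cycles_on_eq_if_in_orbit[OF q fA this, of y] show ?thesis by simp
  qed
  have zA: "z \<notin> A" using z by (auto simp: A_def)
  define B where "B = insert z A"
  have qB: "q permutes B" unfolding B_def by (rule permutes_imp_permutes_insert[OF q])
  have fB: "finite B" using fA by (simp add: B_def)
  have oz: "orbit q z = {z}" by (rule orbit_fixpoint) (rule permutes_not_in[OF q zA])
  have ne': "orbit q y \<noteq> orbit q z" unfolding oz oqy using z(2) by blast
  have "cycles_on (q \<circ> transpose y z) B = insert (orbit q y \<union> orbit q z) (cycles_on q B - {orbit q y, orbit q z})"
    by (rule cycles_on_join[OF qB fB _ _ ne']) (auto simp: A_def B_def)
  also have "cycles_on q B = insert {z} (cycles_on q A)"
    unfolding B_def by (rule cycles_on_insert_fixpoint[OF q zA])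
  also note oqy
  also note oz
  also have "insert {z} (cycles_on q A) - {insert y (orbit p x), {z}} = cycles_on p S - {orbit p x}"
    unfolding cq using sub y z by auto
  also have "insert y (orbit p x) \<union> {z} = insert y (insert z (orbit p x))" by auto
  finally show "cycles_on (p \<circ> transpose x y \<circ> transpose y z) (insert z (insert y S)) =
      insert (insert y (insert z (orbit p x))) (cycles_on p S - {orbit p x})"
    by (simp only: q_def B_def A_def)
qed

text \<open>Inserting two elements keeps the parity of the cycle of \<open>x\<close>. Before the
  insertion, \<open>x\<close> lies either in a cycle of length at least 3 or is a fixed point; in
  the latter case \<open>p\<close> counts as a permutation of \<open>S - {x}\<close> with one cycle
  fewer.\<close>

lemma insert_two_odd_perms_iff:
  assumes p: "p permutes S" "finite S" and x: "x \<in> S" and y: "y \<notin> S" and z: "z \<notin> S" "y \<noteq> z"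
  shows "p \<circ> transpose x y \<circ> transpose y z \<in> odd_perms (insert z (insert y S)) (Suc t) \<longleftrightarrow>
    p \<in> odd_perms S (Suc t) \<union> odd_perms (S - {x}) t"
proof -
  define q where "q = p \<circ> transpose x y \<circ> transpose y z"
  define c where "c = insert y (insert z (orbit p x))"
  define E where "E = cycles_on p S - {orbit p x}"
  have q: "q permutes insert z (insert y S)"
    unfolding q_def using x p(1)
    by (intro permutes_compose permutes_swap_id) (auto intro: permutes_subset)
  have cyc: "cycles_on q (insert z (insert y S)) = insert c E"
    unfolding q_def c_def E_def by (rule cycles_on_insert_two(1)[OF assms])
  have cE: "c \<notin> E" using cycles_on_insert_two(2)[OF assms] by (auto simp: c_def E_def)
  have fE: "finite E" using p by (simp add: E_def finite_cycles_on)
  have ox: "orbit p x \<subseteq> S" "finite (orbit p x)" "x \<in> orbit p x"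
    using permutes_orbit_subset[OF p(1) x] p finite_subset self_in_orbit[OF p] by blast+
  have cc: "card c = card (orbit p x) + 2" using ox y z by (auto simp: c_def card_insert_if)
  have pS: "cycles_on p S = insert (orbit p x) E" "orbit p x \<notin> E"
    using orbit_in_cycles_on[OF x, of p] by (auto simp: E_def)
  have "q \<in> odd_perms (insert z (insert y S)) (Suc t) \<longleftrightarrow>
      odd (card (orbit p x)) \<and> (\<forall>c\<in>E. odd (card c) \<and> card c \<noteq> 1) \<and> card E = t"
    using q cE fE by (auto simp: odd_perms_def cyc cc)
  also have "\<dots> \<longleftrightarrow> p \<in> odd_perms S (Suc t) \<union> odd_perms (S - {x}) t"
  proof (cases "p x = x")
    case True
    hence o: "orbit p x = {x}" by (rule orbit_fixpoint)
    have pSx: "p permutes S - {x}" using p(1) True by (auto intro!: permutes_superset[OF p(1)])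
    have "cycles_on p S = insert {x} (cycles_on p (S - {x}))"
      using cycles_on_insert_fixpoint[OF pSx, of x] x by (simp add: insert_absorb)
    moreover have "{x} \<notin> cycles_on p (S - {x})"
      using Union_cycles_on[OF pSx] p(2) by auto
    ultimately have "E = cycles_on p (S - {x})" by (auto simp: E_def o)
    thus ?thesis using o pSx p fE pS by (auto simp: odd_perms_def)
  next
    case False
    hence "\<not> p permutes S - {x}" using permutes_not_in[of p "S - {x}" x] by auto
    moreover have "card (orbit p x) \<noteq> 1"
    proof
      assume "card (orbit p x) = 1"
      then obtain w where "orbit p x = {w}" using card_1_singletonE by blast
      hence "orbit p x = {x}" using ox(3) by simp
      thus False using False orbit_eq_singleton_iff[of p x] by blast
    qed
    ultimately show ?thesis using p fE pS by (auto simp: odd_perms_def)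
  qed
  finally show ?thesis by (simp add: q_def)
qed

lemma finite_odd_perms: "finite (odd_perms S t)" if "finite S"
proof (rule finite_subset)
  show "odd_perms S t \<subseteq> {p. p permutes S}" by (auto simp: odd_perms_def)
  show "finite {p. p permutes S}" using that by (rule finite_permutations)
qed

text \<open>
  In the cycle of \<open>x\<close>, which has length at least 3, remove the two elements \<open>y\<close>, \<open>z\<close> following \<open>x\<close>;
  either a shorter cycle of odd length at least 3 remains, or \<open>x\<close> becomes a fixed point.
\<close>

lemma card_odd_perms_rec:
  assumes S: "finite S" "x \<in> S"
  shows "card (odd_perms S (Suc t)) = (\<Sum>(y, z)\<in>{(y, z). y \<in> S - {x} \<and> z \<in> S - {x, y}}.
    card (odd_perms (S - {y, z}) (Suc t)) + card (odd_perms (S - {y, z} - {x}) t))"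
proof -
  define I where "I = {(y, z). y \<in> S - {x} \<and> z \<in> S - {x, y}}"
  define X where "X = (\<lambda>(y, z). odd_perms (S - {y, z}) (Suc t) \<union> odd_perms (S - {y, z} - {x}) t)"
  have finI: "finite I" by (rule finite_subset[of _ "S \<times> S"]) (use S in \<open>auto simp: I_def\<close>)
  have Xp: "p permutes S - {y, z}" if "p \<in> X (y, z)" for p y z
    using that permutes_subset[of p "S - {y, z} - {x}" "S - {y, z}"] by (auto simp: X_def odd_perms_def)
  have iff: "p \<circ> transpose x y \<circ> transpose y z \<in> odd_perms S (Suc t) \<longleftrightarrow> p \<in> X (y, z)"
    if "(y, z) \<in> I" "p permutes S - {y, z}" for p y z
  proof -
    have "insert z (insert y (S - {y, z})) = S" using that(1) by (auto simp: I_def)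
    thus ?thesis
      using insert_two_odd_perms_iff[OF that(2), of x y z t] that(1) S by (auto simp: I_def X_def)
  qed
  define f where "f = (\<lambda>((y, z), p :: 'a \<Rightarrow> 'a). p \<circ> transpose x y \<circ> transpose y z)"
  \<comment> \<open>The inverse reads \<open>y\<close> and \<open>z\<close> off as the first two
    images of \<open>x\<close> and undoes the transpositions in reverse order.\<close>
  define h where "h = (\<lambda>q :: 'a \<Rightarrow> 'a. ((q x, q (q x)), q \<circ> transpose (q x) (q (q x)) \<circ> transpose x (q x)))"
  have bij: "bij_betw f (Sigma I X) (odd_perms S (Suc t))"
  proof (rule bij_betwI[where g = h])
    show "f \<in> Sigma I X \<rightarrow> odd_perms S (Suc t)"
    proof
      fix w assume "w \<in> Sigma I X"
      then obtain y z p where w: "w = ((y, z), p)" "(y, z) \<in> I" "p \<in> X (y, z)" by auto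
      show "f w \<in> odd_perms S (Suc t)"
        using iff[OF w(2) Xp[OF w(3)]] w(3) unfolding w(1) f_def prod.case by blast
    qed
    show "h \<in> odd_perms S (Suc t) \<rightarrow> Sigma I X"
    proof
      fix q assume q: "q \<in> odd_perms S (Suc t)"
      define y where "y = q x"
      define z where "z = q y"
      define p where "p = q \<circ> transpose y z \<circ> transpose x y"
      have qS: "q permutes S" using q by (simp add: odd_perms_def)
      have c3: "odd (card (orbit q x))" "card (orbit q x) \<noteq> 1"
        using q orbit_in_cycles_on[OF S(2), of q] by (auto simp: odd_perms_def)
      have yS: "y \<in> S" "z \<in> S" using permutes_in_image[OF qS] S(2) by (auto simp: y_def z_def)
      have yx: "y \<noteq> x"
      proof
        assume "y = x"
        hence "orbit q x = {x}" using orbit_fixpoint[of q x] by (simp add: y_def)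
        thus False using c3 by simp
      qed
      have zy: "z \<noteq> y"
      proof
        assume "z = y"
        hence "q y = q x" by (simp add: y_def z_def)
        thus False using yx permutes_inj[OF qS] by (auto dest: injD)
      qed
      have zx: "z \<noteq> x"
      proof
        assume "z = x"
        hence "orbit q x = {x, y}" using orbit_involution[of q x] by (simp add: y_def z_def)
        thus False using c3(1) yx by simp
      qed
      have I: "(y, z) \<in> I" using yS yx zy zx by (auto simp: I_def)
      have pS: "p permutes S" unfolding p_def using S yS qS
        by (intro permutes_compose permutes_swap_id)
      have "p y = y" "p z = z" using yx zy zx by (auto simp: p_def y_def[symmetric] z_def[symmetric] transpose_def)
      hence pS': "p permutes S - {y, z}" by (auto intro!: permutes_superset[OF pS])
      have "p \<circ> transpose x y \<circ> transpose y z = q"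
        by (simp add: p_def fun_eq_iff)
      hence "p \<in> X (y, z)" using iff[OF I pS'] q by simp
      moreover have "h q = ((y, z), p)" by (simp only: h_def p_def y_def z_def)
      ultimately show "h q \<in> Sigma I X" using I by simp
    qed
    fix w assume "w \<in> Sigma I X"
    then obtain y z p where w: "w = ((y, z), p)" "(y, z) \<in> I" "p \<in> X (y, z)" by auto
    define q where "q = p \<circ> transpose x y \<circ> transpose y z"
    have "p y = y" "p z = z" using permutes_not_in[OF Xp[OF w(3)]] by auto
    moreover have "y \<noteq> x" "z \<noteq> y" "z \<noteq> x" using w(2) by (auto simp: I_def)
    ultimately have "q x = y" "q y = z" by (auto simp: q_def transpose_def)
    moreover have "q \<circ> transpose y z \<circ> transpose x y = p" by (simp add: q_def fun_eq_iff)
    ultimately have "h q = w" by (simp only: h_def w(1))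
    thus "h (f w) = w" by (simp only: w(1) f_def prod.case q_def)
  next
    show "f (h q) = q" for q by (simp add: f_def h_def fun_eq_iff)
  qed
  have "card (odd_perms S (Suc t)) = card (Sigma I X)" using bij_betw_same_card[OF bij] by simp
  also have "\<dots> = (\<Sum>yz\<in>I. card (X yz))"
    using finI S by (intro card_SigmaI) (auto simp: X_def finite_odd_perms)
  also have "\<dots> = (\<Sum>(y, z)\<in>I. card (odd_perms (S - {y, z}) (Suc t)) + card (odd_perms (S - {y, z} - {x}) t))"
  proof (intro sum.cong refl)
    fix yz assume "yz \<in> I"
    then obtain y z where yz: "yz = (y, z)" "x \<in> S - {y, z}" using S(2) by (auto simp: I_def)
    have "odd_perms (S - {y, z}) (Suc t) \<inter> odd_perms (S - {y, z} - {x}) t = {}"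
    proof -
      have False if p: "p \<in> odd_perms (S - {y, z}) (Suc t)" "p permutes S - {y, z} - {x}" for p
      proof -
        have "p x = x" using permutes_not_in[OF p(2)] by simp
        hence "{x} \<in> cycles_on p (S - {y, z})"
          using orbit_in_cycles_on[OF yz(2), of p] by (simp add: orbit_fixpoint)
        thus False using p(1) by (auto simp: odd_perms_def)
      qed
      thus ?thesis by (auto simp: odd_perms_def)
    qed
    thus "card (X yz) = (case yz of (y, z) \<Rightarrow>
        card (odd_perms (S - {y, z}) (Suc t)) + card (odd_perms (S - {y, z} - {x}) t))"
      using S by (simp add: yz(1) X_def card_Un_disjoint finite_odd_perms)
  qed
  finally show ?thesis by (simp add: I_def)
qed

text \<open>Removing two elements lowers \<open>g\<close> by one, and after division by the
  factorials the recurrence is \<open>partition_sum_two_term\<close>; so no bijection with cycle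
  types is needed.\<close>

lemma card_odd_perms:
  assumes "finite S" "card S = 2 * g + t"
  shows "real (card (odd_perms S t)) = fact (2 * g + t) * partition_sum g t"
  using assms
proof (induction g arbitrary: S t)
  case 0
  show ?case
  proof (cases "t = 0")
    case True
    hence "odd_perms S t = {id}" using 0 by (auto simp: odd_perms_def cycles_on_def)
    thus ?thesis using True by (simp add: partition_sum_g_0)
  next
    case False
    \<comment> \<open>Here \<open>S\<close> has only \<open>t\<close> elements, too few for
      \<open>t > 0\<close> cycles of length at least 3.\<close>
    have "odd_perms S t = {}"
    proof (rule ccontr)
      assume "odd_perms S t \<noteq> {}"
      then obtain p where p: "p permutes S" "\<forall>c\<in>cycles_on p S. odd (card c) \<and> card c \<noteq> 1" "card (cycles_on p S) = t"
        by (auto simp: odd_perms_def)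
      have "card S = card (\<Union> (cycles_on p S))" using Union_cycles_on[OF p(1) 0(1)] by simp
      also have "\<dots> = (\<Sum>c\<in>cycles_on p S. card c)"
      proof (rule card_Union_disjoint)
        show "pairwise disjnt (cycles_on p S)"
        proof (rule pairwiseI)
          fix c c' assume c: "c \<in> cycles_on p S" "c' \<in> cycles_on p S" "c \<noteq> c'"
          show "disjnt c c'"
            unfolding disjnt_iff
          proof (intro allI notI)
            fix y assume "y \<in> c \<and> y \<in> c'"
            hence "c = orbit p y" "c' = orbit p y" using cycles_on_eq_if_in_orbit[OF p(1) 0(1)] c by blast+
            thus False using c(3) by simp
          qed
        qed
        show "finite c" if "c \<in> cycles_on p S" for c
          using that Union_cycles_on[OF p(1) 0(1)] by (intro finite_subset[OF _ 0(1)]) blast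
      qed
      also have "\<dots> \<ge> (\<Sum>c\<in>cycles_on p S. 3)"
      proof (rule sum_mono)
        fix c assume "c \<in> cycles_on p S"
        hence "odd (card c)" "card c \<noteq> 1" using p(2) by auto
        thus "3 \<le> card c" by presburger
      qed
      finally show False using p(3) 0 False by simp
    qed
    thus ?thesis using False by (simp add: partition_sum_eq_0)
  qed
next
  case (Suc g)
  have "S \<noteq> {}" using Suc.prems by auto
  then obtain x where x: "x \<in> S" by blast
  show ?case
  proof (cases t)
    case 0
    have "cycles_on p S \<noteq> {}" for p using orbit_in_cycles_on[OF x, of p] by auto
    hence "odd_perms S t = {}" using Suc.prems(1) 0 by (auto simp: odd_perms_def finite_cycles_on)
    thus ?thesis using 0 by (simp add: partition_sum_g_0)
  next
    case (Suc s)
    \<comment> \<open>Of the \<open>N + 3\<close> elements of \<open>S\<close>, there remain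
      \<open>N + 1\<close> without \<open>y\<close> and \<open>z\<close>, and \<open>N\<close> if
      the fixed point \<open>x\<close> is dropped as well.\<close>
    define N where "N = 2 * g + s"
    have cS: "card S = N + 3" using Suc.prems Suc by (simp add: N_def)
    define I where "I = {(y, z). y \<in> S - {x} \<and> z \<in> S - {x, y}}"
    have I_eq: "I = (SIGMA y:S - {x}. S - {x, y})" by (auto simp: I_def)
    have "card (S - {x, y}) = N + 1" if "y \<in> S - {x}" for y
      using that cS x Suc.prems(1) by (subst card_Diff_subset) auto
    hence cI: "card I = (N + 2) * (N + 1)"
      unfolding I_eq using Suc.prems(1) cS x by (subst card_SigmaI) auto
    have "real (card (odd_perms S t)) = (\<Sum>(y, z)\<in>I. real (card (odd_perms (S - {y, z}) (Suc s))) +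
        real (card (odd_perms (S - {y, z} - {x}) s)))"
      unfolding Suc card_odd_perms_rec[OF Suc.prems(1) x] I_def[symmetric] of_nat_sum
      by (intro sum.cong refl) auto
    also have "\<dots> = (\<Sum>(y, z)\<in>I. fact (N + 1) * partition_sum g (Suc s) + fact N * partition_sum g s)"
    proof (intro sum.cong refl)
      fix yz assume "yz \<in> I"
      then obtain y z where yz: "yz = (y, z)" "y \<in> S" "z \<in> S" "y \<noteq> x" "z \<noteq> x" "z \<noteq> y" by (auto simp: I_def)
      have c1: "card (S - {y, z}) = N + 1" using yz cS Suc.prems(1) by (subst card_Diff_subset) auto
      have c2: "card (S - {y, z} - {x}) = N" using yz c1 x Suc.prems(1) by (subst card_Diff_singleton) auto
      show "(case yz of (y, z) \<Rightarrow> real (card (odd_perms (S - {y, z}) (Suc s))) +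
          real (card (odd_perms (S - {y, z} - {x}) s))) =
        (case yz of (y, z) \<Rightarrow> fact (N + 1) * partition_sum g (Suc s) + fact N * partition_sum g s)"
        using Suc.IH[of "S - {y, z}" "Suc s"] Suc.IH[of "S - {y, z} - {x}" s] c1 c2 Suc.prems(1)
        by (simp add: yz(1) N_def)
    qed
    also have "\<dots> = real ((N + 2) * (N + 1)) * (fact (N + 1) * partition_sum g (Suc s) + fact N * partition_sum g s)"
      by (simp add: cI)
    also have "\<dots> = real ((N + 2) * (N + 1)) * fact N * (partition_sum g s + real (2 * g + Suc s) * partition_sum g (Suc s))"
      by (simp add: N_def algebra_simps)
    also have "\<dots> = real ((N + 2) * (N + 1)) * fact N * (real (N + 3) * partition_sum (Suc g) (Suc s))"
      unfolding partition_sum_two_term[symmetric] by (simp add: N_def algebra_simps)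
    also have "\<dots> = fact (N + 3) * partition_sum (Suc g) (Suc s)"
      by (simp add: numeral_3_eq_3 algebra_simps)
    finally show ?thesis using Suc by (simp add: N_def numeral_3_eq_3)
  qed
qed


section \<open>The main theorem\<close>

lemma tree_edge_snd:
  "length (filter (\<lambda>(u, v). P v) (tree_edges 1 T)) = card {v \<in> {2..num_edges T + 1}. P v}"
proof -
  have "length (filter (\<lambda>(u, v). P v) (tree_edges 1 T)) = length (filter P (map snd (tree_edges 1 T)))"
    by (simp add: filter_map o_def split_def)
  also have "\<dots> = length (filter P [2..<num_edges T + 2])"
    by (simp add: map_snd_tree_edges numeral_2_eq_2)
  also have "\<dots> = card (set (filter P [2..<num_edges T + 2]))"
    by (rule distinct_card[symmetric]) simp
  also have "set (filter P [2..<num_edges T + 2]) = {v \<in> {2..num_edges T + 1}. P v}" by auto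
  finally show ?thesis .
qed

text \<open>Every vertex of a plane tree has degree at least 1, thanks to the plant edge.\<close>

lemma G_degree_ge:
  assumes \<sigma>: "\<sigma> permutes tree_verts T" and c: "c \<in> cycles_on \<sigma> (tree_verts T)"
  shows "card c \<le> G_degree (T, \<sigma>) c"
proof -
  have fin: "finite (tree_verts T)" by (simp add: tree_verts_def)
  have c_sub: "c \<subseteq> {1..num_edges T + 1}"
    using Union_cycles_on[OF \<sigma> fin] c by (auto simp: tree_verts_def)
  have "size {#e \<in># G_edges (T, \<sigma>). snd e = c#} =
      length (filter (\<lambda>e. snd e = c) (map (\<lambda>(u, v). (orbit \<sigma> u, orbit \<sigma> v)) (tree_edges 1 T)))"
    by (simp only: G_edges.simps mset_filter[symmetric] size_mset)
  also have "\<dots> = length (filter (\<lambda>(u, v). orbit \<sigma> v = c) (tree_edges 1 T))"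
    by (simp add: filter_map o_def split_def)
  also have "\<dots> = card {v \<in> {2..num_edges T + 1}. orbit \<sigma> v = c}" by (rule tree_edge_snd)
  \<comment> \<open>Only the child ends of edges are counted. The root is the one vertex without a
    parent edge, and the plant edge makes up for it.\<close>
  also have "\<dots> \<ge> card (c - {1})"
  proof (rule card_mono)
    show "c - {1} \<subseteq> {v \<in> {2..num_edges T + 1}. orbit \<sigma> v = c}"
    proof
      fix v assume v: "v \<in> c - {1}"
      hence "v \<in> {1..num_edges T + 1}" using c_sub by blast
      moreover have "c = orbit \<sigma> v" using cycles_on_eq_if_in_orbit[OF \<sigma> fin c] v by blast
      ultimately show "v \<in> {v \<in> {2..num_edges T + 1}. orbit \<sigma> v = c}" using v by auto
    qed
  qed simp
  finally have "card (c - {1}) \<le> size {#e \<in># G_edges (T, \<sigma>). snd e = c#}" .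
  moreover have "card c \<le> card (c - {1}) + (if 1 \<in> c then 1 else 0)"
    using finite_subset[OF c_sub] by (auto simp: card_Diff_singleton_if)
  ultimately show ?thesis by (simp add: G_degree_def)
qed

lemma R_set_eq:
  assumes "g \<ge> 1"
  shows "R_set g t 0 = {T. num_edges T = 2 * g + t - 1} \<times> odd_perms {1..2 * g + t} t"
proof -
  have "(T, \<sigma>) \<in> R_set g t 0 \<longleftrightarrow> num_edges T = 2 * g + t - 1 \<and> \<sigma> \<in> odd_perms {1..2 * g + t} t" for T \<sigma>
  proof (cases "num_edges T = 2 * g + t - 1")
    case True
    define V where "V = tree_verts T"
    have V: "V = {1..2 * g + t}" using True assms by (simp add: V_def tree_verts_def)
    have fin: "finite V" by (simp add: V)
    have fix_iff: "card {i \<in> V. \<sigma> i = i} = 0 \<longleftrightarrow> (\<forall>c\<in>cycles_on \<sigma> V. card c \<noteq> 1)" if \<sigma>: "\<sigma> permutes V"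
    proof -
      have "(\<sigma> i = i) \<longleftrightarrow> card (orbit \<sigma> i) = 1" for i
      proof
        assume "\<sigma> i = i" thus "card (orbit \<sigma> i) = 1" by (simp add: orbit_fixpoint)
      next
        assume "card (orbit \<sigma> i) = 1"
        then obtain w where "orbit \<sigma> i = {w}" using card_1_singletonE by blast
        hence "orbit \<sigma> i = {i}" using self_in_orbit[OF \<sigma> fin, of i] by simp
        thus "\<sigma> i = i" by (simp add: orbit_eq_singleton_iff)
      qed
      thus ?thesis using fin by (auto simp: cycles_on_def)
    qed
    have "(T, \<sigma>) \<in> R_set g t 0 \<longleftrightarrow> O_permutation_on \<sigma> V \<and> card {i \<in> V. \<sigma> i = i} = 0 \<and>
        card {c \<in> cycles_on \<sigma> V. card c > 1} = t \<and> (\<forall>c\<in>cycles_on \<sigma> V. G_degree (T, \<sigma>) c \<ge> 3)"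
      using True assms by (auto simp: R_set_def O_trees_def V_def)
    also have "\<dots> \<longleftrightarrow> \<sigma> \<in> odd_perms V t"
    proof (cases "\<sigma> permutes V \<and> (\<forall>c\<in>cycles_on \<sigma> V. odd (card c) \<and> card c \<noteq> 1)")
      case True
      hence \<sigma>: "\<sigma> permutes V" and odd: "\<And>c. c \<in> cycles_on \<sigma> V \<Longrightarrow> odd (card c) \<and> card c \<noteq> 1" by auto
      have big: "card c \<ge> 3" if "c \<in> cycles_on \<sigma> V" for c using odd[OF that] by presburger
      hence "{c \<in> cycles_on \<sigma> V. card c > 1} = cycles_on \<sigma> V" by fastforce
      moreover have "G_degree (T, \<sigma>) c \<ge> 3" if "c \<in> cycles_on \<sigma> V" for c
        using big[OF that] G_degree_ge[of \<sigma> T c] \<sigma> that unfolding V_def by linarith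
      ultimately show ?thesis using True fix_iff[OF \<sigma>] by (auto simp: odd_perms_def O_permutation_on_def)
    next
      case False
      thus ?thesis using fix_iff by (auto simp: odd_perms_def O_permutation_on_def)
    qed
    finally show ?thesis using True V by simp
  next
    case False
    thus ?thesis using assms by (auto simp: R_set_def)
  qed
  thus ?thesis by auto
qed

text \<open>The \<open>(n + 1)!\<close> in the number of permutations of the \<open>n + 1\<close>
  vertices cancels against the same factor in the denominator of the Catalan number.\<close>

lemma card_R_set:
  assumes "g \<ge> 1" "n = 2 * g + t - 1"
  shows "real (card (R_set g t 0)) = fact (2 * n) / fact n * partition_sum g t"
proof -
  have N: "2 * g + t = n + 1" using assms by simp
  have trees: "real (card {T. num_edges T = n}) = fact (2 * n) / (fact n * fact (n + 1))"
    using card_ptrees[of n] by (simp add: catalan_fps_def)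
  have perms: "real (card (odd_perms {1..2 * g + t} t)) = fact (n + 1) * partition_sum g t"
    unfolding N[symmetric] by (rule card_odd_perms) simp_all
  have "fact (n + 1) \<noteq> (0 :: real)" by (rule fact_nonzero)
  thus ?thesis
    unfolding R_set_eq[OF assms(1)] assms(2)[symmetric] card_cartesian_product of_nat_mult trees perms
    by (simp add: field_simps del: fact_Suc)
qed

text \<open>The coefficient at \<open>m = 2 * g + t - 1\<close>; its quotient of factorials cancels
  the normalisation \<open>fact m / fact (2 * m)\<close> of \<open>central_fps m\<close>.\<close>

definition kappa_coeff :: "nat \<Rightarrow> nat \<Rightarrow> real" where
  "kappa_coeff g t = fact (2 * (2 * g + t - 1)) / (2 ^ (2 * g) * fact (2 * g + t - 1)) * partition_sum g t"

text \<open>With \<open>m = 2 * g + t - 1\<close>, the term for \<open>t\<close> in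
  \<open>opart_coeff g (n + 1 - 2 * g)\<close> has denominator \<open>fact (n - m)\<close>. Together
  with the prefactor of \<open>eps_formula\<close> it is the coefficient of
  \<open>central_fps m\<close> up to a factor that does not involve \<open>n\<close>.\<close>

lemma eps_eq_sum:
  assumes "g \<ge> 1"
  shows "real (eps g n) = (\<Sum>t=1..g. kappa_coeff g t * fps_nth (central_fps (2 * g + t - 1)) n)"
proof (cases "n = 0")
  \<comment> \<open>The map without edges is treated apart in \<open>eps\<close>; on the right,
    every exponent \<open>2 * g + t - 1\<close> is at least 2.\<close>
  case True
  thus ?thesis using assms by (simp add: eps_def central_fps_def)
next
  case False
  hence n: "n \<ge> 1" by simp
  \<comment> \<open>The guard prevents truncated subtraction from turning a negative
    \<open>n + 1 - 2 * g - t\<close> into 0.\<close>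
  define a where "a = (\<lambda>t. if 2 * g + t \<le> n + 1 then partition_sum g t / fact (n + 1 - 2 * g - t) else 0)"
  have "(if 2 * g \<le> n + 1 then opart_coeff g (n + 1 - 2 * g) else 0) = (\<Sum>t=1..g. a t)"
  proof (cases "2 * g \<le> n + 1")
    case True
    have "(\<Sum>t\<le>n + 1 - 2 * g. partition_sum g t / fact (n + 1 - 2 * g - t)) = (\<Sum>t\<le>n + 1 - 2 * g. a t)"
      using True by (intro sum.cong refl) (auto simp: a_def)
    also have "\<dots> = (\<Sum>t\<le>n + 1 - 2 * g + g. a t)"
      by (rule sum.mono_neutral_left) (auto simp: a_def)
    \<comment> \<open>A partition of \<open>g \<ge> 1\<close> has at least one and at most
      \<open>g\<close> parts.\<close>
    also have "\<dots> = (\<Sum>t=1..g. a t)"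
      using assms by (intro sum.mono_neutral_right)
        (auto simp: a_def partition_sum_eq_0 partition_sum_g_0 not_le Suc_le_eq)
    finally show ?thesis using True by (simp add: opart_coeff_def)
  qed (simp add: a_def)
  hence "real (eps g n) = fact (2 * n) / (fact n * 2 ^ (2 * g)) * (\<Sum>t=1..g. a t)"
    unfolding eps_formula[OF n] by (auto split: if_splits)
  also have "\<dots> = (\<Sum>t=1..g. kappa_coeff g t * fps_nth (central_fps (2 * g + t - 1)) n)"
    unfolding sum_distrib_left
  proof (rule sum.cong[OF refl])
    fix t assume t: "t \<in> {1..g}"
    define m where "m = 2 * g + t - 1"
    have m: "2 * g + t = Suc m" using t by (simp add: m_def)
    have "a t = (if n < m then 0 else partition_sum g t / fact (n - m))"
      using m by (auto simp: a_def diff_diff_left)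
    thus "fact (2 * n) / (fact n * 2 ^ (2 * g)) * a t = kappa_coeff g t * fps_nth (central_fps (2 * g + t - 1)) n"
      unfolding kappa_coeff_def m_def[symmetric] by (simp add: central_fps_def ac_simps)
  qed
  finally show ?thesis .
qed

lemma K_star_eq:
  assumes "g \<ge> 1"
  shows "K_star g = (\<Sum>t=1..g. monom (kappa_coeff g t) (2 * g + t - 1))"
proof -
  define K where "K = (\<Sum>t=1..g. monom (kappa_coeff g t) (2 * g + t - 1))"
  have "is_K_star g K"
    unfolding is_K_star_def
  proof (intro conjI allI impI)
    fix n assume "coeff K n \<noteq> 0"
    then obtain t where "t \<in> {1..g}" "coeff (monom (kappa_coeff g t) (2 * g + t - 1)) n \<noteq> 0"
      unfolding K_def coeff_sum by (meson sum.neutral)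
    thus "2 * g \<le> n" "n \<le> 3 * g - 1" by (auto split: if_splits)
  next
    have "C_series g = (\<Sum>t=1..g. fps_const (kappa_coeff g t) * central_fps (2 * g + t - 1))"
      by (rule fps_ext) (simp add: C_series_def eps_eq_sum[OF assms] fps_sum_nth)
    also have "\<dots> = (\<Sum>t=1..g. fps_const (kappa_coeff g t) *
        (1 / fps_radical root 2 Q4 * (fps_X / Q4) ^ (2 * g + t - 1)))"
      by (simp only: central_fps_eq)
    also have "\<dots> = 1 / fps_radical root 2 Q4 *
        (\<Sum>t=1..g. fps_const (kappa_coeff g t) * (fps_X / Q4) ^ (2 * g + t - 1))"
      by (simp only: sum_distrib_left mult.left_commute)
    also have "(\<Sum>t=1..g. fps_const (kappa_coeff g t) * (fps_X / Q4) ^ (2 * g + t - 1)) =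
        fps_compose (fps_of_poly K) (fps_X / Q4)"
      unfolding K_def by (rule fps_of_poly_sum_monom_compose[symmetric]) (simp_all only: fps_X_div_Q4 finite_atLeastAtMost)
    finally show "C_series g = 1 / fps_radical root 2 Q4 * fps_compose (fps_of_poly K) (fps_X / Q4)" .
  qed
  thus ?thesis unfolding K_star_def K_def[symmetric] using is_K_star_unique by (blast intro: the_equality)
qed

theorem theorem2:
  fixes g t n :: nat
  assumes "g \<ge> 1" and "1 \<le> t" and "t \<le> g" and "n = 2 * g + t - 1"
  shows "kappa_star g n = real (card (R_set g t 0)) / 2 ^ (2 * g) \<and>
         real (card (R_set g t 0)) / 2 ^ (2 * g) =
           fact (2 * n) / (2 ^ (2 * g) * fact n) *
             (\<Sum>\<gamma>\<in>partitions_with_parts g t.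
                1 / (\<Prod>i\<in>set_mset \<gamma>. fact (count \<gamma> i) * (2 * real i + 1) ^ count \<gamma> i)) \<and>
         2 ^ (2 * g) * kappa_star g n = real (card (R_set g t 0))"
proof -
  \<comment> \<open>Different \<open>s\<close> give different exponents
    \<open>2 * g + s - 1\<close>, so a single monomial contributes.\<close>
  have "kappa_star g n = (\<Sum>s=1..g. if s = t then kappa_coeff g s else 0)"
    unfolding kappa_star_def K_star_eq[OF assms(1)] coeff_sum
    using assms by (intro sum.cong refl) auto
  hence kappa: "kappa_star g n = kappa_coeff g t" using assms by simp
  have R: "real (card (R_set g t 0)) / 2 ^ (2 * g) = kappa_coeff g t"
    unfolding card_R_set[OF assms(1,4)] kappa_coeff_def assms(4)[symmetric] by simp
  have "kappa_coeff g t = fact (2 * n) / (2 ^ (2 * g) * fact n) *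
      (\<Sum>\<gamma>\<in>partitions_with_parts g t.
         1 / (\<Prod>i\<in>set_mset \<gamma>. fact (count \<gamma> i) * (2 * real i + 1) ^ count \<gamma> i))"
    by (simp only: kappa_coeff_def assms(4) partition_sum_def part_weight_def)
  moreover have "2 ^ (2 * g) * kappa_star g n = real (card (R_set g t 0))"
    unfolding kappa R[symmetric] by simp
  ultimately show ?thesis using R kappa by (simp only:)
qed

end
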